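(* Let $S=(V,\mathcal{H})$ be a TBRSC of dimension $\geq 2$. Suppose that the graph of flats $\Gamma(L(S^{\varepsilon}))$ has $s$ connected components that are $\mathcal{H}^{\varepsilon}$-nontrivial and $r$ connected components that are $\mathcal{H}^{\varepsilon}$-trivial, of sizes $f_1,\dots,f_r$. Then the fundamental group $\pi_1(\|S\|)$ of the geometric realization of $S$ is a free group of rank $$\binom{s+f_1+\cdots+f_r-1}{2}-\sum_{i=1}^r\binom{f_i}{2},$$ equivalently of rank $\binom{s-1}{2}+(s-1)(f_1+\cdots+f_r)+\sum_{1\leq i<j\leq r}f_if_j$.
   Context: A (finite) simplicial complex is a pair $S=(V,\mathcal{H})$ where $V$ is a finite nonempty set and $\mathcal{H}\subseteq 2^V$ contains all singletons and is closed under taking subsets. Its dimension $d$ is $\max\{|I|:I\in\mathcal{H}\}-1$. $P_n(V)$ (resp. $P_{\leq n}(V)$) is the set of subsets of size exactly (resp. at most) $n$. A flat of a simplicial complex $(V,\mathcal{J})$ is $X\subseteq V$ with $I\cup\{p\}\in\mathcal{J}$ for all $I\in\mathcal{J}\cap 2^X$, $p\in V\setminus X$; $L(\cdot)$ denotes the set of flats, and the closure $\overline{X}$ is the intersection of all flats containing $X$. For a family $\mathcal{F}\subseteq 2^V$ containing $V$ and closed under intersection, $\mathrm{Tr}(\mathcal{F})$ is the set of $X\subseteq V$ with an enumeration $x_1,\dots,x_k$ and a chain $F_0\subset\cdots\subset F_k$ in $\mathcal{F}$ with $x_i\in F_i\setminus F_{i-1}$. $S$ is boolean representable (BRSC) if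 $\mathcal{H}$ equals the set of $M$-independent column sets of a boolean matrix $M$ (sets $X$ of columns with some square submatrix on $X$ congruent to a lower unitriangular boolean matrix). $T_k(S)=(V,\mathcal{H}\cap P_{\leq k}(V))$; $S$ is a TBRSC if $S=T_k(S')$ for a BRSC $S'$ and $k\geq1$. Define $\varepsilon(S)=\{X\subseteq V : \forall Y\in\mathcal{H}\cap P_{\leq d}(X)\ \forall p\in V\setminus X,\ Y\cup\{p\}\in\mathcal{H}\}$, $\mathcal{H}^{\varepsilon}=\mathrm{Tr}(\varepsilon(S))$ and $S^{\varepsilon}=(V,\mathcal{H}^{\varepsilon})$. The graph of flats $\Gamma(L(S^{\varepsilon}))$ has vertex set $V$ and an edge $p - q$ whenever $p\neq q$ and the closure of $\{p,q\}$ in $L(S^{\varepsilon})$ is a proper subset of $V$. A connected component $C$ is $\mathcal{H}^{\varepsilon}$-nontrivial if $\mathcal{H}^{\varepsilon}\cap P_2(C)\neq\emptyset$ and $\mathcal{H}^{\varepsilon}$-trivial otherwise; its size is its number of vertices. *)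

theory Defs
  imports "HOL-Analysis.Analysis" "HOL-Algebra.Group"
begin

section \<open>Simplicial complexes, flats and truncations\<close>

text \<open>
  A complex \<open>(V, H)\<close> is given by its vertex set \<open>V\<close>, a finite subset of an arbitrary type, and its
  family of faces \<open>H\<close>. (The constant \<^const>\<open>simplicial_complex\<close> of the library is the geometric
  notion, for sets of simplices in a Euclidean space.)
\<close>

definition abstract_simplicial_complex :: "'a set \<Rightarrow> 'a set set \<Rightarrow> bool" where
  "abstract_simplicial_complex V H \<longleftrightarrow>
     finite V \<and> V \<noteq> {} \<and> H \<subseteq> Pow V \<and> (\<forall>v\<in>V. {v} \<in> H) \<and> (\<forall>X\<in>H. \<forall>Y. Y \<subseteq> X \<longrightarrow> Y \<in> H)"

definition complex_dim :: "'a set set \<Rightarrow> nat" where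
  "complex_dim H = Max (card ` H) - 1"

definition subsets_exactly :: "nat \<Rightarrow> 'a set \<Rightarrow> 'a set set" where
  "subsets_exactly n V = {X. X \<subseteq> V \<and> finite X \<and> card X = n}"

definition subsets_upto :: "nat \<Rightarrow> 'a set \<Rightarrow> 'a set set" where
  "subsets_upto n V = {X. X \<subseteq> V \<and> finite X \<and> card X \<le> n}"

definition flats :: "'a set \<Rightarrow> 'a set set \<Rightarrow> 'a set set" where
  "flats V J = {X. X \<subseteq> V \<and> (\<forall>I\<in>J \<inter> Pow X. \<forall>p\<in>V - X. I \<union> {p} \<in> J)}"

definition flat_closure :: "'a set \<Rightarrow> 'a set set \<Rightarrow> 'a set \<Rightarrow> 'a set" where
  "flat_closure V J X = \<Inter>{F \<in> flats V J. X \<subseteq> F}"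

definition transversals :: "'a set \<Rightarrow> 'a set set \<Rightarrow> 'a set set" where
  "transversals V \<F> =
     {X. X \<subseteq> V \<and>
       (\<exists>k x F. bij_betw x {1..k} X \<and> (\<forall>i\<le>k. F i \<in> \<F>) \<and>
          (\<forall>i\<in>{1..k::nat}. F (i - 1) \<subset> F i \<and> x i \<in> F i - F (i - 1)))}"

definition truncation :: "nat \<Rightarrow> 'a set \<Rightarrow> 'a set set \<Rightarrow> 'a set set" where
  "truncation k V H = H \<inter> subsets_upto k V"

section \<open>Boolean representability\<close>

definition lower_unitriangular :: "nat \<Rightarrow> (nat \<Rightarrow> nat \<Rightarrow> bool) \<Rightarrow> bool" where
  "lower_unitriangular n A \<longleftrightarrow> (\<forall>i<n. A i i) \<and> (\<forall>i<n. \<forall>j<n. i < j \<longrightarrow> \<not> A i j)"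

text \<open>
  A boolean matrix with \<open>m\<close> rows and columns indexed by \<open>V\<close> is a function \<open>M\<close>, read at row indices
  \<open>i < m\<close> and columns \<open>v \<in> V\<close>. The injection \<open>\<rho>\<close> selects and orders rows and \<open>\<kappa>\<close> orders the
  columns: together they give a square submatrix on \<open>X\<close> up to permuting rows and columns
  independently, i.e. up to congruence.
\<close>

definition columns_independent :: "nat \<Rightarrow> (nat \<Rightarrow> 'a \<Rightarrow> bool) \<Rightarrow> 'a set \<Rightarrow> bool" where
  "columns_independent m M X \<longleftrightarrow>
     (\<exists>n \<rho> \<kappa>. inj_on \<rho> {..<n} \<and> \<rho> ` {..<n} \<subseteq> {..<m} \<and> bij_betw \<kappa> {..<n} X \<and>
        lower_unitriangular n (\<lambda>i j. M (\<rho> i) (\<kappa> j)))"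

definition BRSC :: "'a set \<Rightarrow> 'a set set \<Rightarrow> bool" where
  "BRSC V H \<longleftrightarrow>
     abstract_simplicial_complex V H \<and> (\<exists>m M. H = {X. X \<subseteq> V \<and> columns_independent m M X})"

definition TBRSC :: "'a set \<Rightarrow> 'a set set \<Rightarrow> bool" where
  "TBRSC V H \<longleftrightarrow> (\<exists>k H'. k \<ge> 1 \<and> BRSC V H' \<and> H = truncation k V H')"

section \<open>The complex \<open>S\<^sup>\<epsilon>\<close> and its graph of flats\<close>

definition eps :: "'a set \<Rightarrow> 'a set set \<Rightarrow> 'a set set" where
  "eps V H =
     {X. X \<subseteq> V \<and> (\<forall>Y\<in>H \<inter> subsets_upto (complex_dim H) X. \<forall>p\<in>V - X. Y \<union> {p} \<in> H)}"

definition H_eps :: "'a set \<Rightarrow> 'a set set \<Rightarrow> 'a set set" where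
  "H_eps V H = transversals V (eps V H)"

definition flat_graph :: "'a set \<Rightarrow> 'a set set \<Rightarrow> ('a \<times> 'a) set" where
  "flat_graph V J = {(p, q). p \<in> V \<and> q \<in> V \<and> p \<noteq> q \<and> flat_closure V J {p, q} \<subset> V}"

definition graph_components :: "'a set \<Rightarrow> ('a \<times> 'a) set \<Rightarrow> 'a set set" where
  "graph_components V E = V // {(p, q). p \<in> V \<and> q \<in> V \<and> (p, q) \<in> E\<^sup>*}"

definition nontrivial_wrt :: "'a set set \<Rightarrow> 'a set \<Rightarrow> bool" where
  "nontrivial_wrt J C \<longleftrightarrow> J \<inter> subsets_exactly 2 C \<noteq> {}"

definition nontrivial_components :: "'a set \<Rightarrow> 'a set set \<Rightarrow> 'a set set" where
  "nontrivial_components V J = {C \<in> graph_components V (flat_graph V J). nontrivial_wrt J C}"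

definition trivial_components :: "'a set \<Rightarrow> 'a set set \<Rightarrow> 'a set set" where
  "trivial_components V J = {C \<in> graph_components V (flat_graph V J). \<not> nontrivial_wrt J C}"

section \<open>Geometric realization and fundamental group\<close>

text \<open>
  Points of the realization are written in barycentric coordinates. The topology is that of the
  product topology on \<open>'a \<Rightarrow> real\<close>; as all points vanish outside the finite set \<open>V\<close>, this is the
  Euclidean topology of \<open>\<real>\<^sup>V\<close>, in which the vertices form the standard basis.
\<close>

definition geometric_realization :: "'a set \<Rightarrow> 'a set set \<Rightarrow> ('a \<Rightarrow> real) set" where
  "geometric_realization V H =
     {\<alpha>. (\<forall>v. \<alpha> v \<ge> 0) \<and> {v. \<alpha> v \<noteq> 0} \<in> H \<and> (\<Sum>v\<in>V. \<alpha> v) = 1}"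

definition loops_at :: "'b::topological_space set \<Rightarrow> 'b \<Rightarrow> (real \<Rightarrow> 'b) set" where
  "loops_at X a = {p. path p \<and> path_image p \<subseteq> X \<and> pathstart p = a \<and> pathfinish p = a}"

definition path_class :: "'b::topological_space set \<Rightarrow> (real \<Rightarrow> 'b) \<Rightarrow> (real \<Rightarrow> 'b) set" where
  "path_class X p = {q. homotopic_paths X p q}"

text \<open>The union below is over representatives; it is a single homotopy class.\<close>

definition fundamental_group :: "'b::topological_space set \<Rightarrow> 'b \<Rightarrow> (real \<Rightarrow> 'b) set monoid" where
  "fundamental_group X a =
     \<lparr>carrier = path_class X ` loops_at X a,
      mult = (\<lambda>A B. \<Union>p\<in>A. \<Union>q\<in>B. path_class X (p +++ q)),
      one = path_class X (\<lambda>_. a)\<rparr>"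

section \<open>Free groups\<close>

text \<open>
  Words are lists of letters \<open>(b, x)\<close>, standing for the generator \<open>x\<close> if \<open>b\<close> is true and for its
  inverse otherwise. Elements of the free group are the reduced words; the product is the reduced
  form of the concatenation, obtained by putting the letters of the left factor in front of the
  right factor one at a time, starting from the last, and cancelling where possible.
\<close>

fun inv_letter :: "bool \<times> 'b \<Rightarrow> bool \<times> 'b" where
  "inv_letter (b, x) = (\<not> b, x)"

fun reduced_word :: "(bool \<times> 'b) list \<Rightarrow> bool" where
  "reduced_word [] \<longleftrightarrow> True"
| "reduced_word [x] \<longleftrightarrow> True"
| "reduced_word (x # y # w) \<longleftrightarrow> y \<noteq> inv_letter x \<and> reduced_word (y # w)"

fun cons_reduce :: "bool \<times> 'b \<Rightarrow> (bool \<times> 'b) list \<Rightarrow> (bool \<times> 'b) list" where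
  "cons_reduce x [] = [x]"
| "cons_reduce x (y # w) = (if y = inv_letter x then w else x # y # w)"

definition free_group :: "'b set \<Rightarrow> (bool \<times> 'b) list monoid" where
  "free_group B =
     \<lparr>carrier = {w. set w \<subseteq> UNIV \<times> B \<and> reduced_word w},
      mult = (\<lambda>u v. foldr cons_reduce u v),
      one = []\<rparr>"

definition free_of_rank :: "('g, 'm) monoid_scheme \<Rightarrow> nat \<Rightarrow> bool" where
  "free_of_rank G n \<longleftrightarrow> G \<cong> free_group {..<n}"

lemma inv_letter_inv_letter [simp]: "inv_letter (inv_letter x) = x"
  by (cases x) simp

lemma snd_inv_letter [simp]: "snd (inv_letter x) = snd x"
  by (cases x) simp

lemma inv_letter_neq [simp]: "inv_letter x \<noteq> x"
  by (cases x) simp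

lemma reduced_word_ConsD: "reduced_word (x # w) \<Longrightarrow> reduced_word w"
  by (cases w) auto

lemma reduced_cons_reduce: "reduced_word w \<Longrightarrow> reduced_word (cons_reduce x w)"
  by (cases w) (auto dest: reduced_word_ConsD)

lemma set_cons_reduce: "set (cons_reduce x w) \<subseteq> insert x (set w)"
  by (cases w) auto

lemma reduced_foldr: "reduced_word w \<Longrightarrow> reduced_word (foldr cons_reduce u w)"
  by (induction u) (auto intro: reduced_cons_reduce)

lemma set_foldr: "set (foldr cons_reduce u w) \<subseteq> set u \<union> set w"
  using set_cons_reduce by (induction u) fastforce+

lemma cons_reduce_reduced: "reduced_word (x # w) \<Longrightarrow> cons_reduce x w = x # w"
  by (cases w) auto

lemma cons_reduce_inverse:
  assumes "reduced_word w"
  shows "cons_reduce x (cons_reduce (inv_letter x) w) = w"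
  using assms by (cases w) (auto simp: cons_reduce_reduced)

lemma foldr_cons_reduce:
  assumes "reduced_word w"
  shows "foldr cons_reduce (cons_reduce x t) w = cons_reduce x (foldr cons_reduce t w)"
proof (cases t)
  case (Cons y ys)
  then show ?thesis
    using cons_reduce_inverse[OF reduced_foldr[OF assms], of x ys] by simp
qed simp

lemma foldr_assoc:
  assumes "reduced_word w"
  shows "foldr cons_reduce (foldr cons_reduce u v) w = foldr cons_reduce u (foldr cons_reduce v w)"
  using assms by (induction u) (simp_all add: foldr_cons_reduce)

lemma foldr_Nil: "reduced_word u \<Longrightarrow> foldr cons_reduce u [] = u"
proof (induction u)
  case (Cons x u)
  then show ?case using reduced_word_ConsD cons_reduce_reduced by fastforce
qed simp

lemma foldr_inverse:
  "reduced_word w \<Longrightarrow> foldr cons_reduce (rev (map inv_letter u)) (foldr cons_reduce u w) = w"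
proof (induction u arbitrary: w)
  case (Cons x u)
  then show ?case
    using cons_reduce_inverse[OF reduced_foldr[OF Cons.prems], of "inv_letter x" u] by simp
qed simp

lemma group_free_group: "group (free_group B)"
proof (rule groupI, goal_cases)
  case (1 x y)
  then show ?case
    using set_foldr[of x y] by (auto simp: free_group_def reduced_foldr)
next
  case 2
  then show ?case by (simp add: free_group_def)
next
  case (3 x y z)
  then show ?case by (simp add: free_group_def foldr_assoc)
next
  case (4 x)
  then show ?case by (simp add: free_group_def)
next
  case (5 x)
  let ?y = "foldr cons_reduce (rev (map inv_letter x)) []"
  have "foldr cons_reduce ?y x = []"
    using 5 foldr_inverse[of "[]" x] by (simp add: free_group_def foldr_assoc foldr_Nil)
  moreover have "set (rev (map inv_letter x)) \<subseteq> UNIV \<times> B"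
    using 5 by (force simp: free_group_def)
  then have "?y \<in> carrier (free_group B)"
    using order_trans[OF set_foldr[of "rev (map inv_letter x)" "[]"]]
    by (simp add: free_group_def reduced_foldr)
  ultimately show ?case by (auto simp: free_group_def)
qed

end

theory Submission
  imports Defs
begin

text \<open>
  Up to size \<open>3\<close> the faces of \<open>S\<close> are those of \<open>S\<^sup>\<epsilon>\<close>, and a triangle always has two vertices in a common proper
  flat of \<open>S\<^sup>\<epsilon>\<close>, hence in one nontrivial component of the graph of flats. Conversely the part of the
  complex inside a nontrivial component can be coned off, edge by edge, from a vertex outside a proper
  flat. So the edge groupoid of \<open>S\<close> is that of the graph obtained by contracting the nontrivial
  components to points: vertices in different components are joined, those of a trivial component are
  not. There is always a nontrivial component, and the star of its point is a spanning tree, so the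
  rank is the number of the remaining edges.

  Instead of van Kampen's theorem, the proof uses holonomy. A \<open>G\<close>-valued cocycle \<open>g\<close> on the edges that
  is multiplicative on triangles defines a flat bundle, hence a homomorphism from the fundamental
  group \<open>P\<close> to \<open>G\<close>. For the cocycle in \<open>P\<close> itself, given by the loops through the edges, the holonomy
  is the identity: the class of the initial piece of a loop is an explicit flat section. For the free
  group \<open>F\<close> this yields a homomorphism from \<open>P\<close> onto \<open>F\<close>, which is injective because the homomorphism
  from \<open>F\<close> to \<open>P\<close> that carries the \<open>F\<close>-valued cocycle to the \<open>P\<close>-valued one is a left inverse.
\<close>

section \<open>Homotopies of paths in topological spaces\<close>

text \<open>Membership in \<open>eps V H\<close> only tests faces of size at most d, so S and
  \<open>S\<^sup>\<epsilon>\<close> are compared only up to size d + 1. For d >= 2 this includes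
  triangles, and a cocycle sees nothing larger. Coning works because a face of size at most two
  inside a proper flat extends by every vertex outside that flat. A triangle meets a proper flat in
  two vertices because the last element of a transversal lies outside a flat that contains the
  others. The obstacle is that two vertices of one component need not span an edge. Vertices
  spanning no edge are called parallel; no flat separates them, and inside a nontrivial component
  they are compared through a common neighbour. The base point is arbitrary, so a vertex
  \<open>v0\<close> of the simplex carrying it is imposed from outside, and the root
  \<open>z\<close> of the tree is chosen not parallel to \<open>v0\<close>. Points are functions
  with the product topology, so homotopies are obtained by reparametrizing one path or from explicit
  formulas in coordinates.\<close>

lemma homotopic_paths_reparametrizations:
  fixes p :: "real \<Rightarrow> 'b::topological_space"
  assumes p: "path p" "path_image p \<subseteq> S"
    and f: "continuous_on {0..1} f" "f ` {0..1} \<subseteq> {0..1}"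
    and g: "continuous_on {0..1} g" "g ` {0..1} \<subseteq> {0..1}"
    and ends: "f 0 = g 0" "f 1 = g 1"
    and q: "\<And>t. t \<in> {0..1} \<Longrightarrow> q t = p (f t)" and r: "\<And>t. t \<in> {0..1} \<Longrightarrow> r t = p (g t)"
  shows "homotopic_paths S q r"
proof -
  \<comment> \<open>The homotopy runs in the domain of \<open>p\<close>: \<open>f\<close> and
    \<open>g\<close> are joined linearly inside the convex interval, and \<open>p\<close> is applied
    afterwards. Hence the target can be any topological space.\<close>
  define k where "k = (\<lambda>z::real \<times> real. (1 - fst z) * f (snd z) + fst z * g (snd z))"
  have "continuous_on ({0..1} \<times> {0..1}) k"
    unfolding k_def
    by (intro continuous_intros continuous_on_compose2[OF f(1)] continuous_on_compose2[OF g(1)]) auto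
  moreover have k01: "k z \<in> {0..1}" if "z \<in> {0..1} \<times> {0..1}" for z
  proof -
    have *: "f (snd z) \<in> {0..1}" "g (snd z) \<in> {0..1}" "fst z \<in> {0..1}" using that f g by auto
    have "(1 - fst z) *\<^sub>R f (snd z) + fst z *\<^sub>R g (snd z) \<in> {0..1}"
      by (rule convexD_alt) (use * in auto)
    then show ?thesis by (simp add: k_def)
  qed
  ultimately have "continuous_on ({0..1} \<times> {0..1}) (\<lambda>z. p (k z))"
    by (intro continuous_on_compose2[OF p(1)[unfolded path_def]]) auto
  moreover have "p (k z) \<in> S" if "z \<in> {0..1} \<times> {0..1}" for z
    using p(2) k01[OF that] by (auto simp: path_image_def)
  ultimately show ?thesis
    unfolding homotopic_paths
    by (intro exI[of _ "\<lambda>z. p (k z)"])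
      (auto simp: k_def q r pathstart_def pathfinish_def ends algebra_simps)
qed

lemma path_const [simp]: "path (\<lambda>_. a)"
  by (simp add: path_def)

lemma path_image_const [simp]: "path_image (\<lambda>_. a) = {a}"
  by (auto simp: path_image_def)

lemma pathstart_const [simp]: "pathstart (\<lambda>_. a) = a"
  and pathfinish_const [simp]: "pathfinish (\<lambda>_. a) = a"
  by (simp_all add: pathstart_def pathfinish_def)

section \<open>Groupoid laws for paths up to homotopy\<close>

lemma homotopic_paths_const_right:
  assumes "path p" "path_image p \<subseteq> S" "pathfinish p = b"
  shows "homotopic_paths S (p +++ (\<lambda>_. b)) p"
  by (rule homotopic_paths_reparametrizations[where p=p and f="\<lambda>t. min (2 * t) 1" and g="\<lambda>t. t"])
    (use assms in \<open>auto simp: joinpaths_def pathfinish_def intro!: continuous_intros\<close>)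

lemma homotopic_paths_const_left:
  assumes "path p" "path_image p \<subseteq> S" "pathstart p = b"
  shows "homotopic_paths S ((\<lambda>_. b) +++ p) p"
  by (rule homotopic_paths_reparametrizations[where p=p and f="\<lambda>t. max (2 * t - 1) 0" and g="\<lambda>t. t"])
    (use assms in \<open>auto simp: joinpaths_def pathstart_def intro!: continuous_intros\<close>)

lemma homotopic_paths_reverse_right:
  assumes "path p" "path_image p \<subseteq> S"
  shows "homotopic_paths S (p +++ reversepath p) (\<lambda>_. pathstart p)"
  by (rule homotopic_paths_reparametrizations[where p=p and f="\<lambda>t. min (2 * t) (2 - 2 * t)" and g="\<lambda>t. 0"])
    (use assms in \<open>auto simp: joinpaths_def pathstart_def reversepath_def intro!: continuous_intros\<close>)

lemma homotopic_paths_reverse_left: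
  assumes "path p" "path_image p \<subseteq> S"
  shows "homotopic_paths S (reversepath p +++ p) (\<lambda>_. pathfinish p)"
  using homotopic_paths_reverse_right[of "reversepath p" S] assms by simp

text \<open>Both sides reparametrize \<open>p\<close> with the same parameter ends \<open>0\<close>
  and \<open>s\<close>. Since \<open>s\<close> may lie on either side of \<open>t\<close>, the
  second piece may run backwards; this compares initial pieces of a loop at nearby times.\<close>

lemma homotopic_paths_split:
  fixes p :: "real \<Rightarrow> 'b::topological_space"
  assumes p: "path p" "path_image p \<subseteq> S" and t: "t \<in> {0..1}" and s: "s \<in> {0..1}"
  shows "homotopic_paths S ((\<lambda>x. p (t * x)) +++ (\<lambda>x. p (t + (s - t) * x))) (\<lambda>x. p (s * x))"
proof (rule homotopic_paths_reparametrizations[OF p,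
    where f="\<lambda>x. t * min (2 * x) 1 + (s - t) * max (2 * x - 1) 0" and g="\<lambda>x. s * x"])
  show "(\<lambda>x. t * min (2 * x) 1 + (s - t) * max (2 * x - 1) 0) ` {0..1} \<subseteq> {0..1}"
  proof clarify
    fix x :: real assume x: "x \<in> {0..1}"
    show "t * min (2 * x) 1 + (s - t) * max (2 * x - 1) 0 \<in> {0..1}"
    proof (cases "x \<le> 1/2")
      case True
      then show ?thesis using x t by (auto simp: min_def max_def intro: mult_le_one)
    next
      case False
      have "(1 - (2 * x - 1)) *\<^sub>R t + (2 * x - 1) *\<^sub>R s \<in> {0..1}"
        by (rule convexD_alt) (use x t s False in auto)
      then show ?thesis using False by (simp add: min_def max_def algebra_simps)
    qed
  qed
qed (use t s in \<open>auto simp: joinpaths_def mult_le_one intro!: continuous_intros\<close>)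

lemma homotopic_paths_join_left:
  assumes "homotopic_paths S p p'" "path q" "path_image q \<subseteq> S" "pathfinish p = pathstart q"
  shows "homotopic_paths S (p +++ q) (p' +++ q)"
  using assms by (intro homotopic_paths_join) auto

lemma homotopic_paths_join_right:
  assumes "homotopic_paths S q q'" "path p" "path_image p \<subseteq> S" "pathfinish p = pathstart q"
  shows "homotopic_paths S (p +++ q) (p +++ q')"
  using assms by (intro homotopic_paths_join) auto

lemma homotopic_paths_cancel:
  assumes "path p" "path_image p \<subseteq> S" "path q" "path_image q \<subseteq> S" "path r" "path_image r \<subseteq> S"
    and "pathfinish p = pathfinish q" "pathstart r = pathfinish q"
  shows "homotopic_paths S ((p +++ reversepath q) +++ (q +++ r)) (p +++ r)"
proof -
  note [simp] = path_image_join
  have "homotopic_paths S ((p +++ reversepath q) +++ (q +++ r)) (((p +++ reversepath q) +++ q) +++ r)"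
    by (rule homotopic_paths_assoc) (use assms in auto)
  also have "homotopic_paths S \<dots> ((p +++ (reversepath q +++ q)) +++ r)"
    by (intro homotopic_paths_join_left homotopic_paths_sym[OF homotopic_paths_assoc]) (use assms in auto)
  also have "homotopic_paths S \<dots> ((p +++ (\<lambda>_. pathfinish q)) +++ r)"
    by (intro homotopic_paths_join_left homotopic_paths_join_right homotopic_paths_reverse_left) (use assms in auto)
  also have "homotopic_paths S \<dots> (p +++ r)"
    by (intro homotopic_paths_join_left homotopic_paths_const_right) (use assms in auto)
  finally show ?thesis .
qed

section \<open>The fundamental group\<close>

lemma path_class_eq: "homotopic_paths X p q \<Longrightarrow> path_class X p = path_class X q"
  unfolding path_class_def using homotopic_paths_sym homotopic_paths_trans by blast

lemma fundamental_group_mult: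
  assumes "p \<in> loops_at X a" "q \<in> loops_at X a"
  shows "path_class X p \<otimes>\<^bsub>fundamental_group X a\<^esub> path_class X q = path_class X (p +++ q)"
proof -
  have *: "path_class X (p' +++ q') = path_class X (p +++ q)"
    if "p' \<in> path_class X p" "q' \<in> path_class X q" for p' q'
    by (rule sym, rule path_class_eq, rule homotopic_paths_join)
      (use that assms in \<open>auto simp: loops_at_def path_class_def\<close>)
  have "p \<in> path_class X p" "q \<in> path_class X q"
    using assms by (auto simp: path_class_def loops_at_def)
  then have "(\<Union>p'\<in>path_class X p. \<Union>q'\<in>path_class X q. path_class X (p' +++ q')) = path_class X (p +++ q)"
    using * by blast
  then show ?thesis
    by (simp add: fundamental_group_def)
qed

lemma loops_at_join: "p \<in> loops_at X a \<Longrightarrow> q \<in> loops_at X a \<Longrightarrow> p +++ q \<in> loops_at X a"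
  by (auto simp: loops_at_def path_image_join)

lemma loops_at_const: "a \<in> X \<Longrightarrow> (\<lambda>_. a) \<in> loops_at X a"
  by (auto simp: loops_at_def)

lemma carrier_fundamental_group: "carrier (fundamental_group X a) = path_class X ` loops_at X a"
  by (simp add: fundamental_group_def)

lemma one_fundamental_group: "\<one>\<^bsub>fundamental_group X a\<^esub> = path_class X (\<lambda>_. a)"
  by (simp add: fundamental_group_def)

lemma group_fundamental_group:
  assumes "a \<in> X"
  shows "group (fundamental_group X a)"
proof (rule groupI, goal_cases)
  case (1 x y)
  then show ?case
    by (auto simp: carrier_fundamental_group fundamental_group_mult loops_at_join)
next
  case 2
  then show ?case
    using loops_at_const[OF assms] by (auto simp: carrier_fundamental_group one_fundamental_group)
next
  case (3 x y z)
  then obtain p q r where "x = path_class X p" "y = path_class X q" "z = path_class X r"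
    "p \<in> loops_at X a" "q \<in> loops_at X a" "r \<in> loops_at X a"
    by (auto simp: carrier_fundamental_group)
  moreover have "homotopic_paths X (p +++ (q +++ r)) ((p +++ q) +++ r)"
    by (rule homotopic_paths_assoc) (use calculation in \<open>auto simp: loops_at_def\<close>)
  ultimately show ?case
    by (simp add: fundamental_group_mult loops_at_join path_class_eq)
next
  case (4 x)
  then obtain p where "x = path_class X p" "p \<in> loops_at X a"
    by (auto simp: carrier_fundamental_group)
  moreover have "homotopic_paths X ((\<lambda>_. a) +++ p) p"
    by (rule homotopic_paths_const_left) (use calculation in \<open>auto simp: loops_at_def\<close>)
  ultimately show ?case
    using loops_at_const[OF assms]
    by (simp add: one_fundamental_group fundamental_group_mult path_class_eq)
next
  case (5 x)
  then obtain p where p: "x = path_class X p" "p \<in> loops_at X a"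
    by (auto simp: carrier_fundamental_group)
  then have r: "reversepath p \<in> loops_at X a"
    by (auto simp: loops_at_def)
  have "homotopic_paths X (reversepath p +++ p) (\<lambda>_. a)"
    using homotopic_paths_reverse_left[of p X] p by (auto simp: loops_at_def)
  then have "path_class X (reversepath p) \<otimes>\<^bsub>fundamental_group X a\<^esub> x = \<one>\<^bsub>fundamental_group X a\<^esub>"
    using p r by (simp add: one_fundamental_group fundamental_group_mult path_class_eq)
  then show ?case
    using r unfolding carrier_fundamental_group by blast
qed

text \<open>Meant for \<open>q\<close> and \<open>t\<close> with the same ends. With
  \<open>t\<close> fixed as the way back, every path to its endpoint becomes an element of the
  fundamental group.\<close>

definition return_class :: "'b::topological_space set \<Rightarrow> (real \<Rightarrow> 'b) \<Rightarrow> (real \<Rightarrow> 'b) \<Rightarrow> (real \<Rightarrow> 'b) set" where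
  "return_class X q t = path_class X (q +++ reversepath t)"

definition paths_in :: "'b::topological_space set \<Rightarrow> 'b \<Rightarrow> 'b \<Rightarrow> (real \<Rightarrow> 'b) set" where
  "paths_in X a b = {p. path p \<and> path_image p \<subseteq> X \<and> pathstart p = a \<and> pathfinish p = b}"

lemma loops_at_eq_paths_in: "loops_at X a = paths_in X a a"
  by (simp add: loops_at_def paths_in_def)

lemma paths_in_join: "p \<in> paths_in X a b \<Longrightarrow> q \<in> paths_in X b c \<Longrightarrow> p +++ q \<in> paths_in X a c"
  by (auto simp: paths_in_def path_image_join)

lemma paths_in_reversepath: "p \<in> paths_in X a b \<Longrightarrow> reversepath p \<in> paths_in X b a"
  by (auto simp: paths_in_def)

lemma return_class_closed:
  "q \<in> paths_in X a b \<Longrightarrow> t \<in> paths_in X a b \<Longrightarrow> return_class X q t \<in> carrier (fundamental_group X a)"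
  unfolding return_class_def carrier_fundamental_group loops_at_eq_paths_in
  by (blast intro: paths_in_join paths_in_reversepath)

lemma return_class_cong:
  assumes "homotopic_paths X q q'" "q \<in> paths_in X a b" "t \<in> paths_in X a b"
  shows "return_class X q t = return_class X q' t"
  unfolding return_class_def
  by (intro path_class_eq homotopic_paths_join_left) (use assms in \<open>auto simp: paths_in_def\<close>)

lemma return_class_self:
  assumes "homotopic_paths X q t" "t \<in> paths_in X a b"
  shows "return_class X q t = \<one>\<^bsub>fundamental_group X a\<^esub>"
proof -
  have "q \<in> paths_in X a b"
    using homotopic_paths_imp_path[OF assms(1)] homotopic_paths_imp_subset[OF assms(1)]
      homotopic_paths_imp_pathstart[OF assms(1)] homotopic_paths_imp_pathfinish[OF assms(1)] assms(2)
    by (simp add: paths_in_def)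
  then have "return_class X q t = return_class X t t"
    using assms return_class_cong by blast
  also have "\<dots> = \<one>\<^bsub>fundamental_group X a\<^esub>"
    unfolding return_class_def one_fundamental_group
    using homotopic_paths_reverse_right[of t X] assms(2) by (auto simp: paths_in_def intro!: path_class_eq)
  finally show ?thesis .
qed

text \<open>The way back along \<open>t\<close> cancels against the way out along \<open>t\<close>,
  leaving \<open>q\<close>, \<open>r\<close> and the way back along \<open>u\<close>.\<close>

lemma return_class_mult:
  assumes "q \<in> paths_in X a b" "t \<in> paths_in X a b" "r \<in> paths_in X b c" "u \<in> paths_in X a c"
  shows "return_class X q t \<otimes>\<^bsub>fundamental_group X a\<^esub> return_class X (t +++ r) u = return_class X (q +++ r) u"
proof -
  note [simp] = path_image_join
  have "homotopic_paths X ((q +++ reversepath t) +++ ((t +++ r) +++ reversepath u))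
      ((q +++ reversepath t) +++ (t +++ (r +++ reversepath u)))"
    by (intro homotopic_paths_join_right homotopic_paths_sym[OF homotopic_paths_assoc])
      (use assms in \<open>auto simp: paths_in_def\<close>)
  also have "homotopic_paths X \<dots> (q +++ (r +++ reversepath u))"
    by (intro homotopic_paths_cancel) (use assms in \<open>auto simp: paths_in_def\<close>)
  also have "homotopic_paths X \<dots> ((q +++ r) +++ reversepath u)"
    by (intro homotopic_paths_assoc) (use assms in \<open>auto simp: paths_in_def\<close>)
  finally have "homotopic_paths X ((q +++ reversepath t) +++ ((t +++ r) +++ reversepath u))
    ((q +++ r) +++ reversepath u)" .
  moreover have "q +++ reversepath t \<in> loops_at X a" "(t +++ r) +++ reversepath u \<in> loops_at X a"
    unfolding loops_at_eq_paths_in using assms by (blast intro: paths_in_join paths_in_reversepath)+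
  ultimately show ?thesis
    unfolding return_class_def by (simp add: fundamental_group_mult path_class_eq)
qed

section \<open>Homomorphisms from free groups\<close>

definition letter_value :: "('g, 'm) monoid_scheme \<Rightarrow> ('b \<Rightarrow> 'g) \<Rightarrow> bool \<times> 'b \<Rightarrow> 'g" where
  "letter_value G f x = (if fst x then f (snd x) else inv\<^bsub>G\<^esub> f (snd x))"

definition word_value :: "('g, 'm) monoid_scheme \<Rightarrow> ('b \<Rightarrow> 'g) \<Rightarrow> (bool \<times> 'b) list \<Rightarrow> 'g" where
  "word_value G f w = foldr (\<lambda>x y. letter_value G f x \<otimes>\<^bsub>G\<^esub> y) w \<one>\<^bsub>G\<^esub>"

context group
begin

lemma word_value_Nil [simp]: "word_value G f [] = \<one>"
  and word_value_Cons [simp]: "word_value G f (x # w) = letter_value G f x \<otimes> word_value G f w"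
  by (simp_all add: word_value_def)

lemma letter_value_closed: "f \<in> B \<rightarrow> carrier G \<Longrightarrow> x \<in> UNIV \<times> B \<Longrightarrow> letter_value G f x \<in> carrier G"
  by (auto simp: letter_value_def)

lemma letter_value_inv:
  "f \<in> B \<rightarrow> carrier G \<Longrightarrow> x \<in> UNIV \<times> B \<Longrightarrow> letter_value G f (inv_letter x) = inv (letter_value G f x)"
  by (cases x) (auto simp: letter_value_def Pi_def)

lemma word_value_closed: "f \<in> B \<rightarrow> carrier G \<Longrightarrow> set w \<subseteq> UNIV \<times> B \<Longrightarrow> word_value G f w \<in> carrier G"
  by (induction w) (auto simp: letter_value_closed)

text \<open>Multiplication in the free group is iterated \<open>cons_reduce\<close>, so this is the
  whole content of multiplicativity. In the case of a cancelled letter, its value meets the inverse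
  value.\<close>

lemma word_value_cons_reduce:
  assumes f: "f \<in> B \<rightarrow> carrier G" and x: "x \<in> UNIV \<times> B" and w: "set w \<subseteq> UNIV \<times> B"
  shows "word_value G f (cons_reduce x w) = letter_value G f x \<otimes> word_value G f w"
proof (cases "\<exists>w'. w = inv_letter x # w'")
  case True
  then obtain w' where w': "w = inv_letter x # w'" by blast
  have "letter_value G f x \<in> carrier G" "word_value G f w' \<in> carrier G"
    using letter_value_closed[OF f x] word_value_closed[OF f, of w'] w w' by auto
  then show ?thesis
    unfolding w' by (simp add: letter_value_inv[OF f x] m_assoc[symmetric])
next
  case False
  then have "cons_reduce x w = x # w" by (cases w) auto
  then show ?thesis by simp
qed

lemma word_value_foldr:
  assumes f: "f \<in> B \<rightarrow> carrier G" and "set u \<subseteq> UNIV \<times> B" "set w \<subseteq> UNIV \<times> B"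
  shows "word_value G f (foldr cons_reduce u w) = word_value G f u \<otimes> word_value G f w"
  using assms(2)
proof (induction u)
  case Nil
  then show ?case using word_value_closed[OF f assms(3)] by simp
next
  case (Cons x u)
  then have "set (foldr cons_reduce u w) \<subseteq> UNIV \<times> B"
    using set_foldr[of u w] assms(3) by auto
  then have "word_value G f (foldr cons_reduce (x # u) w) = letter_value G f x \<otimes> (word_value G f u \<otimes> word_value G f w)"
    using Cons word_value_cons_reduce[OF f] by auto
  then show ?case
    using Cons letter_value_closed[OF f] word_value_closed[OF f] assms(3) by (auto simp: m_assoc)
qed

lemma word_value_hom:
  assumes "f \<in> B \<rightarrow> carrier G"
  shows "word_value G f \<in> hom (free_group B) G"
  using word_value_closed[OF assms] word_value_foldr[OF assms]
  by (intro homI) (auto simp: free_group_def)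

end

text \<open>In a reduced word the first letter does not cancel against the rest, so the word is the
  product of that letter and its tail. The induction therefore only needs the one-letter
  words.\<close>

lemma free_group_generated:
  assumes K: "subgroup K (free_group B)" and gen: "\<And>x. x \<in> B \<Longrightarrow> [(True, x)] \<in> K"
  shows "carrier (free_group B) \<subseteq> K"
proof
  interpret group "free_group B" by (rule group_free_group)
  have letter: "[l] \<in> K" if "l \<in> UNIV \<times> B" for l
  proof (cases l)
    case (Pair b x)
    then have x: "x \<in> B" using that by auto
    have "inv\<^bsub>free_group B\<^esub> [(True, x)] = [(False, x)]"
      by (rule inv_equality) (use x in \<open>auto simp: free_group_def\<close>)
    then have "[(False, x)] \<in> K"
      using subgroup.m_inv_closed[OF K gen[OF x]] by simp
    then show ?thesis using gen[OF x] Pair by (cases b) auto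
  qed
  fix w assume "w \<in> carrier (free_group B)"
  then have "set w \<subseteq> UNIV \<times> B" "reduced_word w" by (auto simp: free_group_def)
  then show "w \<in> K"
  proof (induction w)
    case Nil
    then show ?case using subgroup.one_closed[OF K] by (simp add: free_group_def)
  next
    case (Cons l w)
    then have "w \<in> K" "[l] \<in> K"
      using letter[of l] reduced_word_ConsD[OF Cons.prems(2)] by auto
    then have "[l] \<otimes>\<^bsub>free_group B\<^esub> w \<in> K" by (rule subgroup.m_closed[OF K, rotated])
    then show ?case using cons_reduce_reduced[OF Cons.prems(2)] by (simp add: free_group_def)
  qed
qed

section \<open>Holonomy of a cocycle on a simplicial complex\<close>

text \<open>The vertices may coincide. Degenerate triples force the identity on constant pairs and
  inverse values on reversed edges.\<close>

definition cocycle :: "('g, 'm) monoid_scheme \<Rightarrow> 'a set set \<Rightarrow> ('a \<Rightarrow> 'a \<Rightarrow> 'g) \<Rightarrow> bool" where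
  "cocycle G H g \<longleftrightarrow>
     (\<forall>u v w. {u, v, w} \<in> H \<longrightarrow> g u v \<in> carrier G \<and> g u v \<otimes>\<^bsub>G\<^esub> g v w = g u w)"

text \<open>
  Over the open star of a vertex the \<open>G\<close>-bundle glued from \<open>g\<close> is trivial, and \<open>c z v\<close> is the value at
  \<open>z\<close> of a locally constant section of its pullback along \<open>q\<close>, read in the trivialisation at \<open>v\<close>.
\<close>

definition flat_section ::
    "('g, 'm) monoid_scheme \<Rightarrow> ('a \<Rightarrow> 'a \<Rightarrow> 'g) \<Rightarrow> 'z::topological_space set \<Rightarrow> ('z \<Rightarrow> 'a \<Rightarrow> real) \<Rightarrow>
      ('z \<Rightarrow> 'a \<Rightarrow> 'g) \<Rightarrow> bool" where
  "flat_section G g Z q c \<longleftrightarrow>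
     (\<forall>z\<in>Z. \<forall>v. q z v \<noteq> 0 \<longrightarrow> c z v \<in> carrier G) \<and>
     (\<forall>z\<in>Z. \<forall>v w. q z v \<noteq> 0 \<longrightarrow> q z w \<noteq> 0 \<longrightarrow> c z w = c z v \<otimes>\<^bsub>G\<^esub> g v w) \<and>
     (\<forall>z\<in>Z. \<forall>v. q z v \<noteq> 0 \<longrightarrow> eventually (\<lambda>y. c y v = c z v) (at z within Z))"

lemma flat_sectionI:
  assumes "\<And>z v. z \<in> Z \<Longrightarrow> q z v \<noteq> 0 \<Longrightarrow> c z v \<in> carrier G"
    and "\<And>z v w. z \<in> Z \<Longrightarrow> q z v \<noteq> 0 \<Longrightarrow> q z w \<noteq> 0 \<Longrightarrow> c z w = c z v \<otimes>\<^bsub>G\<^esub> g v w"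
    and "\<And>z v. z \<in> Z \<Longrightarrow> q z v \<noteq> 0 \<Longrightarrow> eventually (\<lambda>y. c y v = c z v) (at z within Z)"
  shows "flat_section G g Z q c"
  unfolding flat_section_def using assms by blast

lemma flat_sectionD:
  assumes "flat_section G g Z q c" "z \<in> Z" "q z v \<noteq> 0"
  shows "c z v \<in> carrier G" "q z w \<noteq> 0 \<Longrightarrow> c z w = c z v \<otimes>\<^bsub>G\<^esub> g v w"
    "eventually (\<lambda>y. c y v = c z v) (at z within Z)"
  using assms unfolding flat_section_def by blast+

section \<open>Operations on flat sections\<close>

lemma flat_section_pullback:
  assumes c: "flat_section G g Z q c" and \<phi>: "continuous_on Y \<phi>" "\<phi> ` Y \<subseteq> Z"
    and q': "\<And>y. y \<in> Y \<Longrightarrow> q' y = q (\<phi> y)"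
  shows "flat_section G g Y q' (\<lambda>y. c (\<phi> y))"
proof (rule flat_sectionI)
  fix y v assume y: "y \<in> Y" "q' y v \<noteq> 0"
  then have z: "\<phi> y \<in> Z" "q (\<phi> y) v \<noteq> 0" using \<phi>(2) q' by auto
  show "c (\<phi> y) v \<in> carrier G" using flat_sectionD(1)[OF c z] .
  show "eventually (\<lambda>x. c (\<phi> x) v = c (\<phi> y) v) (at y within Y)"
  proof -
    obtain S where S: "open S" "\<phi> y \<in> S" "\<And>x. x \<in> S \<Longrightarrow> x \<noteq> \<phi> y \<Longrightarrow> x \<in> Z \<Longrightarrow> c x v = c (\<phi> y) v"
      using flat_sectionD(3)[OF c z] unfolding eventually_at_topological by blast
    obtain T where "open T" "y \<in> T" "\<And>x. x \<in> Y \<Longrightarrow> x \<in> T \<Longrightarrow> \<phi> x \<in> S"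
      using \<phi>(1) S(1,2) y(1) unfolding continuous_on_topological by metis
    then show ?thesis
      unfolding eventually_at_topological using S(3) \<phi>(2) by (metis image_subset_iff)
  qed
next
  fix y v w assume "y \<in> Y" "q' y v \<noteq> 0" "q' y w \<noteq> 0"
  then show "c (\<phi> y) w = c (\<phi> y) v \<otimes>\<^bsub>G\<^esub> g v w"
    using flat_sectionD(2)[OF c, of "\<phi> y" v w] \<phi>(2) q' by auto
qed

lemma flat_section_subset: "flat_section G g Z q c \<Longrightarrow> Y \<subseteq> Z \<Longrightarrow> flat_section G g Y q c"
  using flat_section_pullback[of G g Z q c Y "\<lambda>y. y" q] by simp

lemma flat_section_hom:
  assumes "flat_section G g Z q c" "\<psi> \<in> hom G K"
    and "\<And>z v w. z \<in> Z \<Longrightarrow> q z v \<noteq> 0 \<Longrightarrow> q z w \<noteq> 0 \<Longrightarrow> g v w \<in> carrier G \<and> \<psi> (g v w) = g' v w"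
  shows "flat_section K g' Z q (\<lambda>z v. \<psi> (c z v))"
proof (rule flat_sectionI)
  fix z v assume z: "z \<in> Z" "q z v \<noteq> 0"
  note D = flat_sectionD[OF assms(1) z]
  show "\<psi> (c z v) \<in> carrier K" using D(1) assms(2) by (auto simp: hom_def)
  show "eventually (\<lambda>y. \<psi> (c y v) = \<psi> (c z v)) (at z within Z)"
    using D(3) by eventually_elim simp
  fix w assume w: "q z w \<noteq> 0"
  show "\<psi> (c z w) = \<psi> (c z v) \<otimes>\<^bsub>K\<^esub> g' v w"
    using D(1) D(2)[OF w] assms(3)[OF z w] hom_mult[OF assms(2)] by auto
qed

text \<open>Local constancy on a union of two closed sets is checked on each of them: near a point
  outside one set, that set contributes nothing.\<close>

lemma flat_section_Un:
  assumes c: "flat_section G g Z q c1" "flat_section G g Y q c2" and cl: "closed Z" "closed Y"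
    and eq: "\<And>z v. z \<in> Z \<inter> Y \<Longrightarrow> q z v \<noteq> 0 \<Longrightarrow> c1 z v = c2 z v"
    and cont: "continuous_on (Z \<union> Y) q"
  shows "flat_section G g (Z \<union> Y) q (\<lambda>z. if z \<in> Z then c1 z else c2 z)"
proof (rule flat_sectionI)
  let ?c = "\<lambda>z. if z \<in> Z then c1 z else c2 z"
  fix z v assume z: "z \<in> Z \<union> Y" "q z v \<noteq> 0"
  show "?c z v \<in> carrier G"
    using z flat_sectionD(1)[OF c(1), of z v] flat_sectionD(1)[OF c(2), of z v] by auto
  \<comment> \<open>The two sections are known to agree only in trivialisations at nonzero
    coordinates. Coordinate \<open>v\<close> must therefore stay nonzero near \<open>z\<close>
    before the glued section can be read as \<open>c2\<close> on \<open>Y\<close>.\<close>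
  have nz: "eventually (\<lambda>y. q y v \<noteq> 0) (at z within Z \<union> Y)"
    using continuous_on_product_then_coordinatewise[OF cont, of v] z
    by (intro tendsto_imp_eventually_ne[of _ "q z v"]) (auto simp: continuous_on_def)
  have inY: "?c y v = c2 y v" if "y \<in> Y" "q y v \<noteq> 0" for y
    using that eq by auto
  have "eventually (\<lambda>y. y \<in> Z \<longrightarrow> ?c y v = ?c z v) (at z within Z \<union> Y)"
  proof (cases "z \<in> Z")
    case True
    have "eventually (\<lambda>y. y \<noteq> z \<longrightarrow> y \<in> Z \<longrightarrow> c1 y v = c1 z v) (nhds z)"
      using flat_sectionD(3)[OF c(1) True z(2)] by (simp add: eventually_at_filter)
    then have "eventually (\<lambda>y. y \<noteq> z \<longrightarrow> y \<in> Z \<union> Y \<longrightarrow> (y \<in> Z \<longrightarrow> ?c y v = ?c z v)) (nhds z)"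
      by eventually_elim (use True in auto)
    then show ?thesis by (simp add: eventually_at_filter)
  next
    case False
    then have "eventually (\<lambda>y. y \<in> - Z) (nhds z)"
      using cl(1) by (intro eventually_nhds_in_open) auto
    then show ?thesis unfolding eventually_at_filter by eventually_elim auto
  qed
  moreover have "eventually (\<lambda>y. y \<in> Y \<longrightarrow> ?c y v = ?c z v) (at z within Z \<union> Y)"
  proof (cases "z \<in> Y")
    case True
    have "eventually (\<lambda>y. y \<noteq> z \<longrightarrow> y \<in> Y \<longrightarrow> c2 y v = c2 z v) (nhds z)"
      using flat_sectionD(3)[OF c(2) True z(2)] by (simp add: eventually_at_filter)
    moreover have "eventually (\<lambda>y. y \<noteq> z \<longrightarrow> y \<in> Z \<union> Y \<longrightarrow> q y v \<noteq> 0) (nhds z)"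
      using nz by (simp add: eventually_at_filter)
    ultimately have "eventually (\<lambda>y. y \<noteq> z \<longrightarrow> y \<in> Z \<union> Y \<longrightarrow> (y \<in> Y \<longrightarrow> ?c y v = ?c z v)) (nhds z)"
      by eventually_elim (use inY inY[OF True z(2)] in auto)
    then show ?thesis by (simp add: eventually_at_filter)
  next
    case False
    then have "eventually (\<lambda>y. y \<in> - Y) (nhds z)"
      using cl(2) by (intro eventually_nhds_in_open) auto
    then show ?thesis unfolding eventually_at_filter by eventually_elim auto
  qed
  moreover have "eventually (\<lambda>y. y \<in> Z \<union> Y) (at z within Z \<union> Y)"
    by (simp add: eventually_at_filter)
  ultimately show "eventually (\<lambda>y. ?c y v = ?c z v) (at z within Z \<union> Y)"
    by eventually_elim blast
next
  fix z v w assume "z \<in> Z \<union> Y" "q z v \<noteq> 0" "q z w \<noteq> 0"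
  then show "(if z \<in> Z then c1 z else c2 z) w = (if z \<in> Z then c1 z else c2 z) v \<otimes>\<^bsub>G\<^esub> g v w"
    using flat_sectionD(2)[OF c(1), of z v w] flat_sectionD(2)[OF c(2), of z v w] by auto
qed

locale finite_complex =
  fixes V :: "'v set" and H :: "'v set set"
  assumes complex: "abstract_simplicial_complex V H"
begin

abbreviation "X \<equiv> geometric_realization V H"

lemma face_subset: "A \<in> H \<Longrightarrow> B \<subseteq> A \<Longrightarrow> B \<in> H"
  using complex by (auto simp: abstract_simplicial_complex_def)

lemma realization_ex_nonzero: "x \<in> X \<Longrightarrow> \<exists>v. x v \<noteq> 0"
  unfolding geometric_realization_def using sum.neutral[of V x] by fastforce

end

locale complex_cocycle = finite_complex V H + group G
  for V :: "'v set" and H :: "'v set set" and G (structure) +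
  fixes g :: "'v \<Rightarrow> 'v \<Rightarrow> 'a"
  assumes cocycle: "cocycle G H g"
begin

lemma g_closed: "{u, v} \<in> H \<Longrightarrow> g u v \<in> carrier G"
  using cocycle unfolding cocycle_def by (metis insert_absorb2)

lemma g_mult: "{u, v, w} \<in> H \<Longrightarrow> g u v \<otimes> g v w = g u w"
  using cocycle unfolding cocycle_def by blast

lemma g_self: "{u} \<in> H \<Longrightarrow> g u u = \<one>"
  using g_mult[of u u u] g_closed[of u u] by (simp add: r_cancel_one)

lemma g_inverse: "{u, v} \<in> H \<Longrightarrow> g v u = inv g u v"
  using g_mult[of v u v] g_self[of v] face_subset[of "{u, v}" "{v}"] g_closed[of u v] g_closed[of v u]
  by (auto simp: insert_commute intro!: inv_equality[symmetric])

lemma g_carrier_at: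
  assumes "x \<in> X" "x v \<noteq> 0" "x w \<noteq> 0" shows "g v w \<in> carrier G"
  using assms face_subset[of "{v. x v \<noteq> 0}" "{v, w}"]
  by (auto simp: geometric_realization_def intro!: g_closed)

text \<open>By the transition rule, agreement in one trivialisation at a point means agreement in
  all of them. It is thus a property of the point alone, and it is locally constant on the connected
  set \<open>Z\<close>.\<close>

lemma flat_section_unique:
  assumes "connected Z" and q: "continuous_on Z q" "q ` Z \<subseteq> X"
    and c: "flat_section G g Z q c" "flat_section G g Z q c'"
    and z0: "z0 \<in> Z" "q z0 v0 \<noteq> 0" "c z0 v0 = c' z0 v0"
    and z: "z \<in> Z" "q z v \<noteq> 0"
  shows "c z v = c' z v"
proof -
  define f where "f y = (\<exists>u. q y u \<noteq> 0 \<and> c y u = c' y u)" for y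
  have f_iff: "f y \<longleftrightarrow> c y u = c' y u" if "y \<in> Z" "q y u \<noteq> 0" for y u
  proof
    assume "f y"
    then obtain u' where u': "q y u' \<noteq> 0" "c y u' = c' y u'" by (auto simp: f_def)
    then show "c y u = c' y u"
      using flat_sectionD(2)[OF c(1) that(1) u'(1) that(2)] flat_sectionD(2)[OF c(2) that(1) u'(1) that(2)]
      by simp
  qed (use that in \<open>auto simp: f_def\<close>)
  have "f z0 = f z"
  proof (rule connected_local_const[OF assms(1) z0(1) z(1)], rule ballI)
    fix y assume y: "y \<in> Z"
    then obtain u where u: "q y u \<noteq> 0" using realization_ex_nonzero q(2) by blast
    have "eventually (\<lambda>x. q x u \<noteq> 0) (at y within Z)"
      using continuous_on_product_then_coordinatewise[OF q(1), of u] u y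
      by (intro tendsto_imp_eventually_ne[of _ "q y u"]) (auto simp: continuous_on_def)
    moreover have "eventually (\<lambda>x. x \<in> Z) (at y within Z)"
      by (simp add: eventually_at_filter)
    ultimately show "eventually (\<lambda>x. f y = f x) (at y within Z)"
      using flat_sectionD(3)[OF c(1) y u] flat_sectionD(3)[OF c(2) y u]
      by eventually_elim (simp add: f_iff[OF _ u] f_iff y u)
  qed
  then show ?thesis using f_iff[OF z0(1,2)] f_iff[OF z] z0(3) by blast
qed

text \<open>Transition functions act on the right, so left multiplication by a constant preserves
  flatness.\<close>

lemma flat_section_translate:
  assumes c: "flat_section G g Z q c" and k: "k \<in> carrier G" and q: "q ` Z \<subseteq> X"
  shows "flat_section G g Z q (\<lambda>z v. k \<otimes> c z v)"
proof (rule flat_sectionI)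
  fix z v assume z: "z \<in> Z" "q z v \<noteq> 0"
  note D = flat_sectionD[OF c z]
  show "k \<otimes> c z v \<in> carrier G" using D(1) k by auto
  show "eventually (\<lambda>y. k \<otimes> c y v = k \<otimes> c z v) (at z within Z)"
    using D(3) by eventually_elim simp
  fix w assume w: "q z w \<noteq> 0"
  show "k \<otimes> c z w = k \<otimes> c z v \<otimes> g v w"
    using D(1) D(2)[OF w] k g_carrier_at[of "q z" v w] q z w by (auto simp: m_assoc)
qed

text \<open>This is the section with the identity as its value in the trivialisation at
  \<open>v\<close>; the transition rule is the cocycle identity on \<open>{v, u, w}\<close>.
  Coordinate \<open>v\<close> itself may vanish.\<close>

lemma flat_section_star:
  assumes "\<And>z. z \<in> Z \<Longrightarrow> insert v {w. q z w \<noteq> 0} \<in> H"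
  shows "flat_section G g Z q (\<lambda>z w. g v w)"
proof (rule flat_sectionI)
  fix z u assume z: "z \<in> Z" "q z u \<noteq> 0"
  show "g v u \<in> carrier G"
    using face_subset[OF assms[OF z(1)], of "{v, u}"] z by (auto intro: g_closed)
  fix w assume "q z w \<noteq> 0"
  then show "g v w = g v u \<otimes> g u w"
    using face_subset[OF assms[OF z(1)], of "{v, u, w}"] z by (auto intro: g_mult[symmetric])
qed auto

lemma flat_section_normalize:
  assumes c: "flat_section G g Z q c" and q: "q ` Z \<subseteq> X" and z: "z \<in> Z" "q z v \<noteq> 0"
    and k: "k \<in> carrier G"
  obtains c' where "flat_section G g Z q c'" "c' z v = k"
proof
  have cz: "c z v \<in> carrier G" using flat_sectionD(1)[OF c z] .
  show "flat_section G g Z q (\<lambda>y w. (k \<otimes> inv c z v) \<otimes> c y w)"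
    by (rule flat_section_translate[OF c]) (use cz k q in auto)
  show "(k \<otimes> inv c z v) \<otimes> c z v = k"
    using cz k by (simp add: m_assoc)
qed

text \<open>A left translation makes the sections agree at one point of the overlap, and
  connectedness spreads the agreement over it.\<close>

lemma flat_section_glue:
  assumes c: "flat_section G g Z q c1" "flat_section G g Y q c2" and cl: "closed Z" "closed Y"
    and conn: "connected (Z \<inter> Y)" "Z \<inter> Y \<noteq> {}"
    and q: "continuous_on (Z \<union> Y) q" "q ` (Z \<union> Y) \<subseteq> X"
  shows "\<exists>c. flat_section G g (Z \<union> Y) q c"
proof -
  obtain z where z: "z \<in> Z" "z \<in> Y" using conn(2) by blast
  then obtain v where v: "q z v \<noteq> 0" using realization_ex_nonzero q(2) by blast
  obtain c3 where c3: "flat_section G g Y q c3" "c3 z v = c1 z v"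
    using flat_section_normalize[OF c(2) _ z(2) v flat_sectionD(1)[OF c(1) z(1) v]] q(2) by blast
  have "c1 y w = c3 y w" if "y \<in> Z \<inter> Y" "q y w \<noteq> 0" for y w
  proof (rule flat_section_unique[OF conn(1), of q c1 c3 z v y w])
    show "continuous_on (Z \<inter> Y) q" by (rule continuous_on_subset[OF q(1)]) auto
    show "flat_section G g (Z \<inter> Y) q c1" by (rule flat_section_subset[OF c(1)]) auto
    show "flat_section G g (Z \<inter> Y) q c3" by (rule flat_section_subset[OF c3(1)]) auto
  qed (use that z v q(2) c3(2) in auto)
  then show ?thesis
    using flat_section_Un[OF c(1) c3(1) cl _ q(1)] by blast
qed

text \<open>Near each point some coordinate stays nonzero, which gives a star section. Bisection in
  the second coordinate glues these to a section over a whole strip around each \<open>x\<close>;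
  bisection in the first coordinate glues the strips. The overlaps are products of an interval and a
  point, hence connected.\<close>

lemma flat_section_square:
  fixes q :: "real \<times> real \<Rightarrow> 'v \<Rightarrow> real"
  assumes q: "continuous_on ({0..1} \<times> {0..1}) q" "q ` ({0..1} \<times> {0..1}) \<subseteq> X"
  shows "\<exists>c. flat_section G g ({0..1} \<times> {0..1}) q c"
proof -
  have strip: "\<exists>d>0. \<exists>c. flat_section G g (({x - d..x + d} \<inter> {0..1}) \<times> {0..1}) q c" if x: "x \<in> {0..1}" for x
  proof -
    \<comment> \<open>\<open>Bolzano\<close> also tests intervals that leave \<open>{0..1}\<close>;
      the premises on \<open>l\<close> and \<open>u\<close> make \<open>P\<close> vacuous
      there.\<close>
    define P where "P l u \<longleftrightarrow> (0 \<le> l \<longrightarrow> u \<le> 1 \<longrightarrow>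
      (\<exists>d>0. \<exists>c. flat_section G g (({x - d..x + d} \<inter> {0..1}) \<times> {l..u}) q c))" for l u :: real
    have "P 0 1"
    proof (rule Bolzano[of 0 1 P])
      fix l m u assume trans: "P l m" "P m u" "l \<le> m" "m \<le> u"
      show "P l u"
        unfolding P_def
      proof (intro impI)
        assume lu: "0 \<le> l" "u \<le> 1"
        then obtain d1 c1 d2 c2 where d: "d1 > 0" "d2 > 0"
          and c: "flat_section G g (({x - d1..x + d1} \<inter> {0..1}) \<times> {l..m}) q c1"
            "flat_section G g (({x - d2..x + d2} \<inter> {0..1}) \<times> {m..u}) q c2"
          using trans unfolding P_def by force
        define I where "I = {x - min d1 d2..x + min d1 d2} \<inter> {0..1}"
        have I: "I \<times> {l..m} \<union> I \<times> {m..u} = I \<times> {l..u}" "I \<times> {l..m} \<inter> I \<times> {m..u} = I \<times> {m}" "x \<in> I"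
          using trans(3,4) d x by (auto simp: I_def)
        have "\<exists>c. flat_section G g (I \<times> {l..m} \<union> I \<times> {m..u}) q c"
        proof (rule flat_section_glue)
          show "flat_section G g (I \<times> {l..m}) q c1" "flat_section G g (I \<times> {m..u}) q c2"
            by (rule flat_section_subset[OF c(1)], use I_def in auto)
              (rule flat_section_subset[OF c(2)], use I_def in auto)
          show "closed (I \<times> {l..m})" "closed (I \<times> {m..u})"
            by (auto simp: I_def intro!: closed_Times)
          show "connected (I \<times> {l..m} \<inter> I \<times> {m..u})"
            unfolding I(2) by (intro convex_connected convex_Times) (auto simp: I_def intro: convex_Int)
          show "continuous_on (I \<times> {l..m} \<union> I \<times> {m..u}) q"
            unfolding I(1) by (rule continuous_on_subset[OF q(1)]) (use lu in \<open>auto simp: I_def\<close>)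
          show "q ` (I \<times> {l..m} \<union> I \<times> {m..u}) \<subseteq> X"
            unfolding I(1) by (rule subset_trans[OF image_mono q(2)]) (use lu in \<open>auto simp: I_def\<close>)
        qed (use I in auto)
        then show "\<exists>d>0. \<exists>c. flat_section G g (({x - d..x + d} \<inter> {0..1}) \<times> {l..u}) q c"
          unfolding I(1) using d by (intro exI[of _ "min d1 d2"]) (auto simp: I_def)
      qed
    next
      fix y :: real assume "0 \<le> y" "y \<le> 1"
      then have xy: "(x, y) \<in> {0..1} \<times> {0..1}" using x by auto
      then obtain v where v: "q (x, y) v \<noteq> 0" using realization_ex_nonzero q(2) by blast
      have "continuous_on ({0..1} \<times> {0..1}) (\<lambda>z. q z v)"
        using continuous_on_product_then_coordinatewise[OF q(1)] .
      then obtain d where "d > 0"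
        and d': "\<And>z. z \<in> {0..1} \<times> {0..1} \<Longrightarrow> dist z (x, y) < d \<Longrightarrow> dist (q z v) (q (x, y) v) < \<bar>q (x, y) v\<bar>"
        unfolding continuous_on_iff using xy v by (meson zero_less_abs_iff)
      have d: "d > 0" "\<And>z. z \<in> {0..1} \<times> {0..1} \<Longrightarrow> dist z (x, y) < d \<Longrightarrow> q z v \<noteq> 0"
        using \<open>d > 0\<close> d' by (fastforce simp: dist_real_def)+
      \<comment> \<open>A box of half-width \<open>d/3\<close> and height below \<open>d/2\<close>
        stays within distance \<open>d\<close> of \<open>(x, y)\<close>, since the two coordinate
        deviations add up to less than \<open>d\<close>.\<close>
      show "\<exists>e>0. \<forall>l u. l \<le> y \<and> y \<le> u \<and> u - l < e \<longrightarrow> P l u"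
        unfolding P_def
      proof (rule exI[of _ "d/2"], intro conjI allI impI)
        fix l u assume lu: "l \<le> y \<and> y \<le> u \<and> u - l < d/2" "0 \<le> l" "u \<le> 1"
        have "insert v {w. q z w \<noteq> 0} \<in> H" if z: "z \<in> ({x - d/3..x + d/3} \<inter> {0..1}) \<times> {l..u}" for z
        proof -
          have "dist z (x, y) \<le> \<bar>fst z - x\<bar> + \<bar>snd z - y\<bar>"
            using sqrt_sum_squares_le_sum_abs by (simp add: dist_prod_def dist_real_def)
          also have "\<dots> < d" using z lu(1) d(1) by auto
          finally have "q z v \<noteq> 0" using d(2)[of z] z lu by auto
          moreover have "q z \<in> X" using q(2) z lu by auto
          ultimately show ?thesis
            by (simp add: geometric_realization_def insert_absorb)
        qed
        then have "flat_section G g (({x - d/3..x + d/3} \<inter> {0..1}) \<times> {l..u}) q (\<lambda>z w. g v w)"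
          by (rule flat_section_star)
        then show "\<exists>e>0. \<exists>c. flat_section G g (({x - e..x + e} \<inter> {0..1}) \<times> {l..u}) q c"
          using d(1) by (intro exI[of _ "d/3"]) auto
      qed (use d in auto)
    qed simp
    then show ?thesis by (simp add: P_def)
  qed
  define P where "P l u \<longleftrightarrow> (0 \<le> l \<longrightarrow> u \<le> 1 \<longrightarrow> (\<exists>c. flat_section G g ({l..u} \<times> {0..1}) q c))"
    for l u :: real
  have "P 0 1"
  proof (rule Bolzano[of 0 1 P])
    fix l m u assume trans: "P l m" "P m u" "l \<le> m" "m \<le> u"
    show "P l u"
      unfolding P_def
    proof (intro impI)
      assume lu: "0 \<le> l" "u \<le> 1"
      then obtain c1 c2 where
        c: "flat_section G g ({l..m} \<times> {0..1}) q c1" "flat_section G g ({m..u} \<times> {0..1}) q c2"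
        using trans unfolding P_def by force
      have I: "{l..m} \<times> {0..1} \<union> {m..u} \<times> {0..1::real} = {l..u} \<times> {0..1}"
        "({l..m} \<times> {0..1}) \<inter> ({m..u} \<times> {0..1::real}) = {m} \<times> {0..1}"
        using trans(3,4) by auto
      have "\<exists>c. flat_section G g ({l..m} \<times> {0..1} \<union> {m..u} \<times> {0..1}) q c"
      proof (rule flat_section_glue[OF c])
        show "connected (({l..m} \<times> {0..1}) \<inter> ({m..u} \<times> {0..1::real}))"
          unfolding I(2) by (intro convex_connected convex_Times) auto
        show "continuous_on ({l..m} \<times> {0..1} \<union> {m..u} \<times> {0..1}) q"
          unfolding I(1) by (rule continuous_on_subset[OF q(1)]) (use lu in auto)
        show "q ` ({l..m} \<times> {0..1} \<union> {m..u} \<times> {0..1}) \<subseteq> X"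
          unfolding I(1) by (rule subset_trans[OF image_mono q(2)]) (use lu in auto)
      qed (auto simp: I(2) intro!: closed_Times)
      then show "\<exists>c. flat_section G g ({l..u} \<times> {0..1}) q c" unfolding I(1) .
    qed
  next
    fix x :: real assume "0 \<le> x" "x \<le> 1"
    then obtain d c where d: "d > 0" "flat_section G g (({x - d..x + d} \<inter> {0..1}) \<times> {0..1}) q c"
      using strip[of x] by auto
    have "\<exists>c. flat_section G g ({l..u} \<times> {0..1}) q c"
      if "l \<le> x \<and> x \<le> u \<and> u - l < d" "0 \<le> l" "u \<le> 1" for l u
    proof -
      have "{l..u} \<times> {0..1} \<subseteq> ({x - d..x + d} \<inter> {0..1}) \<times> {0..1::real}"
        using that by auto
      then show ?thesis using flat_section_subset[OF d(2)] by blast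
    qed
    then show "\<exists>d>0. \<forall>l u. l \<le> x \<and> x \<le> u \<and> u - l < d \<longrightarrow> P l u"
      using d(1) unfolding P_def by blast
  qed simp
  then show ?thesis by (simp add: P_def)
qed

section \<open>Parallel transport along paths\<close>

definition transport :: "(real \<Rightarrow> 'v \<Rightarrow> real) \<Rightarrow> 'v \<Rightarrow> 'v \<Rightarrow> 'a \<Rightarrow> bool" where
  "transport p v w k \<longleftrightarrow>
     path p \<and> path_image p \<subseteq> X \<and> pathstart p v \<noteq> 0 \<and> pathfinish p w \<noteq> 0 \<and>
     (\<exists>c. flat_section G g {0..1} p c \<and> c 0 v = \<one> \<and> c 1 w = k)"

lemma transport_closed: "transport p v w k \<Longrightarrow> k \<in> carrier G"
  unfolding transport_def pathfinish_def using flat_sectionD(1)[of G g "{0..1}" p _ 1 w] by auto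

lemma transport_unique:
  assumes "transport p v w k" "transport p v w l" shows "k = l"
proof -
  obtain c d where c: "flat_section G g {0..1} p c" "c 0 v = \<one>" "c 1 w = k"
    and d: "flat_section G g {0..1} p d" "d 0 v = \<one>" "d 1 w = l"
    using assms unfolding transport_def by blast
  have "c 1 w = d 1 w"
    by (rule flat_section_unique[of "{0..1}" p c d 0 v 1 w])
      (use assms c d in \<open>auto simp: transport_def path_def path_image_def pathstart_def pathfinish_def\<close>)
  then show ?thesis using c d by simp
qed

text \<open>A flat section over the square of the homotopy restricts to both paths. On the two
  remaining sides the homotopy is constant and so is the section, hence both paths carry the
  identity to the same end value.\<close>

lemma transport_homotopic:
  assumes hom: "homotopic_paths X p q" and v: "pathstart p v \<noteq> 0" and w: "pathfinish p w \<noteq> 0"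
  shows "\<exists>k. transport p v w k \<and> transport q v w k"
proof -
  obtain h :: "real \<times> real \<Rightarrow> 'v \<Rightarrow> real" where h: "continuous_on ({0..1} \<times> {0..1}) h" "h ` ({0..1} \<times> {0..1}) \<subseteq> X"
    and h0: "\<And>x. x \<in> {0..1} \<Longrightarrow> h (0, x) = p x" and h1: "\<And>x. x \<in> {0..1} \<Longrightarrow> h (1, x) = q x"
    and ends: "\<And>t. t \<in> {0..1} \<Longrightarrow> h (t, 0) = p 0" "\<And>t. t \<in> {0..1} \<Longrightarrow> h (t, 1) = p 1"
    using hom unfolding homotopic_paths pathstart_def pathfinish_def comp_def by blast
  have pv: "p 0 v \<noteq> 0" and pw: "p 1 w \<noteq> 0" using v w by (auto simp: pathstart_def pathfinish_def)
  obtain c0 where "flat_section G g ({0..1} \<times> {0..1}) h c0" using flat_section_square[OF h] by blast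
  then obtain c where c: "flat_section G g ({0..1} \<times> {0..1}) h c" "c (0, 0) v = \<one>"
    using flat_section_normalize[OF _ h(2), of c0 "(0,0)" v \<one>] ends(1)[of 0] pv by force
  have side: "c (1, y) u = c (0, y) u" if "y \<in> {0, 1}" "p y u \<noteq> 0" for y u
  proof (rule connected_local_const[of "{0..1::real}" 1 0 "\<lambda>s. c (s, y) u"])
    have "flat_section G g {0..1} (\<lambda>s. h (s, y)) (\<lambda>s. c (s, y))"
      by (rule flat_section_pullback[OF c(1)]) (use that in \<open>auto intro!: continuous_intros\<close>)
    then have "eventually (\<lambda>b. c (b, y) u = c (a, y) u) (at a within {0..1})" if "a \<in> {0..1}" for a
      using flat_sectionD(3)[of G g "{0..1}" "\<lambda>s. h (s, y)" "\<lambda>s. c (s, y)" a u]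
      \<open>y \<in> {0,1}\<close> \<open>p y u \<noteq> 0\<close> ends that by auto
    then show "\<forall>a\<in>{0..1}. eventually (\<lambda>b. c (a, y) u = c (b, y) u) (at a within {0..1})"
      by (simp add: eq_commute)
  qed auto
  have "flat_section G g {0..1} p (\<lambda>t. c (0, t))" "flat_section G g {0..1} q (\<lambda>t. c (1, t))"
    by (rule flat_section_pullback[OF c(1)]; use h0 h1 in \<open>auto intro!: continuous_intros\<close>)+
  moreover have "path p" "path q" "path_image p \<subseteq> X" "path_image q \<subseteq> X" "pathstart q = pathstart p"
    "pathfinish q = pathfinish p"
    using homotopic_paths_imp_path[OF hom] homotopic_paths_imp_subset[OF hom]
      homotopic_paths_imp_pathstart[OF hom] homotopic_paths_imp_pathfinish[OF hom] by auto
  ultimately have "transport p v w (c (0, 1) w)" "transport q v w (c (0, 1) w)"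
    unfolding transport_def using v w c(2) side[of 0 v] side[of 1 w] pv pw by auto
  then show ?thesis by blast
qed

lemma transport_exists:
  "path p \<Longrightarrow> path_image p \<subseteq> X \<Longrightarrow> pathstart p v \<noteq> 0 \<Longrightarrow> pathfinish p w \<noteq> 0 \<Longrightarrow> \<exists>k. transport p v w k"
  using transport_homotopic[of p p v w] by auto

lemma transport_cong:
  assumes "homotopic_paths X p q" "transport p v w k" shows "transport q v w k"
proof -
  obtain l where "transport p v w l" "transport q v w l"
    using transport_homotopic[OF assms(1), of v w] assms(2) by (auto simp: transport_def)
  then show ?thesis using transport_unique[OF assms(2)] by simp
qed

lemma transport_star:
  assumes "path p" "path_image p \<subseteq> X" "pathstart p v \<noteq> 0" "pathfinish p w \<noteq> 0"
    and "\<And>t. t \<in> {0..1} \<Longrightarrow> insert v {u. p t u \<noteq> 0} \<in> H"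
  shows "transport p v w (g v w)"
proof -
  have "{v} \<in> H" using face_subset[OF assms(5)[of 0], of "{v}"] by simp
  then show ?thesis
    unfolding transport_def using assms flat_section_star[of "{0..1}" v p] g_self by auto
qed

text \<open>The section along \<open>q\<close> is translated by the result \<open>k\<close> of the
  transport along \<open>p\<close>, so that the two halves meet.\<close>

lemma transport_join:
  assumes p: "transport p v w k" and q: "transport q w u l" and pq: "pathfinish p = pathstart q"
  shows "transport (p +++ q) v u (k \<otimes> l)"
proof -
  obtain c d where c: "flat_section G g {0..1} p c" "c 0 v = \<one>" "c 1 w = k"
    and d: "flat_section G g {0..1} q d" "d 0 w = \<one>" "d 1 u = l"
    using assms unfolding transport_def by blast
  have path: "path (p +++ q)" "path_image (p +++ q) \<subseteq> X"
    using assms by (auto simp: transport_def path_image_join)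
  have k: "k \<in> carrier G" using transport_closed p by blast
  have d': "flat_section G g {0..1} q (\<lambda>z x. k \<otimes> d z x)"
    by (rule flat_section_translate[OF d(1) k]) (use q in \<open>auto simp: transport_def path_image_def\<close>)
  have join: "(p +++ q) t = q (2 * t - 1)" if "t \<in> {1/2..1}" for t
  proof (cases "t = 1/2")
    case True
    show ?thesis unfolding True using pq by (simp add: joinpaths_def pathstart_def pathfinish_def)
  qed (use that in \<open>auto simp: joinpaths_def\<close>)
  have "flat_section G g {0..1/2} (p +++ q) (\<lambda>t. c (2 * t))"
    by (rule flat_section_pullback[OF c(1)]) (auto simp: joinpaths_def intro!: continuous_intros)
  moreover have "flat_section G g {1/2..1} (p +++ q) (\<lambda>t x. k \<otimes> d (2 * t - 1) x)"
    by (rule flat_section_pullback[OF d' _ _ join]) (auto intro!: continuous_intros)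
  \<comment> \<open>The halves are matched at \<open>w\<close>, but gluing requires agreement in
    every trivialisation \<open>x\<close> at the midpoint; the transition rule from \<open>w\<close>
    to \<open>x\<close> supplies it.\<close>
  moreover have "c (2 * z) x = k \<otimes> d (2 * z - 1) x" if z: "z \<in> {0..1/2} \<inter> {1/2..1}" "(p +++ q) z x \<noteq> 0" for z x
  proof -
    have "z = 1/2" using z by auto
    moreover have p1: "p 1 w \<noteq> 0" "p 1 x \<noteq> 0" and q0: "q 0 w \<noteq> 0" "q 0 x \<noteq> 0"
      using z p q pq \<open>z = 1/2\<close> by (auto simp: joinpaths_def pathfinish_def pathstart_def transport_def)
    moreover have "c 1 x = k \<otimes> g w x"
      using flat_sectionD(2)[OF c(1), of 1 w x] p1 c(3) by simp
    moreover have "p 1 \<in> X" using p by (auto simp: transport_def path_image_def)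
    then have "d 0 x = g w x"
      using flat_sectionD(2)[OF d(1), of 0 w x] q0 d(2) g_carrier_at[of "p 1" w x] p1 by auto
    ultimately show ?thesis unfolding \<open>z = 1/2\<close> by simp
  qed
  ultimately have "flat_section G g ({0..1/2} \<union> {1/2..1}) (p +++ q)
      (\<lambda>z. if z \<in> {0..1/2} then c (2 * z) else (\<lambda>x. k \<otimes> d (2 * z - 1) x))"
    using path(1) by (intro flat_section_Un) (auto simp: path_def ivl_disj_un_two_touch)
  moreover have "{0..1/2} \<union> {1/2..1} = {0..1::real}" by auto
  ultimately show ?thesis
    unfolding transport_def using path c d p q
    by (intro conjI exI[of _ "\<lambda>z. if z \<in> {0..1/2} then c (2 * z) else (\<lambda>x. k \<otimes> d (2 * z - 1) x)"])
      (auto simp: transport_def)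
qed

lemma transport_reversepath:
  assumes p: "transport p v w k"
  shows "transport (reversepath p) w v (inv k)"
proof -
  obtain c where c: "flat_section G g {0..1} p c" "c 0 v = \<one>" "c 1 w = k"
    using assms unfolding transport_def by blast
  have k: "k \<in> carrier G" using transport_closed p by blast
  have "flat_section G g {0..1} (reversepath p) (\<lambda>t. c (1 - t))"
    by (rule flat_section_pullback[OF c(1)]) (auto simp: reversepath_def intro!: continuous_intros)
  then have "flat_section G g {0..1} (reversepath p) (\<lambda>t x. inv k \<otimes> c (1 - t) x)"
    by (rule flat_section_translate) (use k p in \<open>auto simp: transport_def path_image_def reversepath_def\<close>)
  then show ?thesis
    using p c k unfolding transport_def
    by (intro conjI exI[of _ "\<lambda>t x. inv k \<otimes> c (1 - t) x"]) auto
qed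

section \<open>The holonomy homomorphism\<close>

definition holonomy :: "'v \<Rightarrow> (real \<Rightarrow> 'v \<Rightarrow> real) set \<Rightarrow> 'a" where
  "holonomy v A = (THE k. \<exists>p\<in>A. transport p v v k)"

lemma holonomy_eq:
  assumes "transport p v v k"
  shows "holonomy v (path_class X p) = k"
  unfolding holonomy_def
proof (rule the_equality)
  show "\<exists>q\<in>path_class X p. transport q v v k"
    using assms by (intro bexI[of _ p]) (auto simp: path_class_def transport_def)
  fix l assume "\<exists>q\<in>path_class X p. transport q v v l"
  then show "l = k"
    unfolding path_class_def using transport_cong[OF _ assms] transport_unique by blast
qed

lemma transport_holonomy:
  assumes "p \<in> loops_at X a" "a v \<noteq> 0"
  shows "transport p v v (holonomy v (path_class X p))"
proof -
  obtain k where "transport p v v k"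
    using transport_exists[of p v v] assms by (auto simp: loops_at_def)
  then show ?thesis using holonomy_eq by simp
qed

lemma holonomy_hom:
  assumes "a v \<noteq> 0"
  shows "holonomy v \<in> hom (fundamental_group X a) G"
proof (rule homI)
  fix A assume "A \<in> carrier (fundamental_group X a)"
  then obtain p where p: "A = path_class X p" "p \<in> loops_at X a" by (auto simp: carrier_fundamental_group)
  show "holonomy v A \<in> carrier G"
    using transport_closed[OF transport_holonomy[OF p(2) assms]] p(1) by simp
next
  fix A B assume "A \<in> carrier (fundamental_group X a)" "B \<in> carrier (fundamental_group X a)"
  then obtain p q where pq: "A = path_class X p" "B = path_class X q" "p \<in> loops_at X a" "q \<in> loops_at X a"
    by (auto simp: carrier_fundamental_group)
  then have "transport (p +++ q) v v (holonomy v A \<otimes> holonomy v B)"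
    using transport_join[OF transport_holonomy transport_holonomy, of p a v q a] assms
    by (auto simp: loops_at_def)
  then show "holonomy v (A \<otimes>\<^bsub>fundamental_group X a\<^esub> B) = holonomy v A \<otimes> holonomy v B"
    using pq by (simp add: fundamental_group_mult holonomy_eq)
qed

end

section \<open>Paths in the geometric realization\<close>

definition straight :: "('a \<Rightarrow> real) \<Rightarrow> ('a \<Rightarrow> real) \<Rightarrow> real \<Rightarrow> 'a \<Rightarrow> real" where
  "straight x y t = (\<lambda>u. (1 - t) * x u + t * y u)"

definition vertex_point :: "'a \<Rightarrow> 'a \<Rightarrow> real" where
  "vertex_point v = (\<lambda>u. if u = v then 1 else 0)"

lemma straight_0 [simp]: "straight x y 0 = x"
  and straight_1 [simp]: "straight x y 1 = y"
  by (simp_all add: straight_def)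

lemma pathstart_straight [simp]: "pathstart (straight x y) = x"
  and pathfinish_straight [simp]: "pathfinish (straight x y) = y"
  by (simp_all add: pathstart_def pathfinish_def)

lemma continuous_on_straight:
  assumes "continuous_on S x" "continuous_on S y" "continuous_on S t"
  shows "continuous_on S (\<lambda>z. straight (x z) (y z) (t z))"
  unfolding straight_def
proof (rule continuous_on_coordinatewise_then_product)
  fix u
  show "continuous_on S (\<lambda>z. (1 - t z) * x z u + t z * y z u)"
    using assms(1,2)[THEN continuous_on_product_then_coordinatewise, of u] assms(3)
    by (intro continuous_on_add continuous_on_mult continuous_on_diff continuous_on_const)
qed

lemma path_straight [simp]: "path (straight x y)"
  unfolding path_def using continuous_on_straight[of "{0..1}" "\<lambda>_. x" "\<lambda>_. y" "\<lambda>t. t"] by simp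

lemma vertex_point_nonzero [simp]: "vertex_point v u \<noteq> 0 \<longleftrightarrow> u = v"
  by (simp add: vertex_point_def)

lemma paths_in_at: "p \<in> paths_in S x y \<Longrightarrow> t \<in> {0..1} \<Longrightarrow> p t \<in> S"
  by (auto simp: paths_in_def path_image_def)

context finite_complex
begin

lemma vertex_face: "v \<in> V \<Longrightarrow> {v} \<in> H"
  using complex by (auto simp: abstract_simplicial_complex_def)

lemma face_carrier: "A \<in> H \<Longrightarrow> A \<subseteq> V"
  using complex by (auto simp: abstract_simplicial_complex_def)

lemma vertex_point_in: "v \<in> V \<Longrightarrow> vertex_point v \<in> X"
  using vertex_face[of v] complex
  by (auto simp: geometric_realization_def vertex_point_def abstract_simplicial_complex_def)

lemma support_face: "x \<in> X \<Longrightarrow> {v. x v \<noteq> 0} \<in> H"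
  by (simp add: geometric_realization_def)

lemma straight_in:
  assumes "x \<in> X" "y \<in> X" and H: "{v. x v \<noteq> 0} \<union> {v. y v \<noteq> 0} \<in> H" and t: "t \<in> {0..1}"
  shows "straight x y t \<in> X"
proof -
  have "{v. straight x y t v \<noteq> 0} \<in> H"
    by (rule face_subset[OF H]) (auto simp: straight_def)
  moreover have "(\<Sum>v\<in>V. straight x y t v) = 1"
    using assms by (simp add: straight_def geometric_realization_def sum.distrib flip: sum_distrib_left)
  ultimately show ?thesis
    using assms by (simp add: geometric_realization_def straight_def)
qed

lemma straight_paths_in:
  assumes "x \<in> X" "y \<in> X" "{v. x v \<noteq> 0} \<union> {v. y v \<noteq> 0} \<in> H"
  shows "straight x y \<in> paths_in X x y"
  using straight_in[OF assms] by (auto simp: paths_in_def path_image_def)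

text \<open>
  At time \<open>\<sigma>\<close> the homotopy follows \<open>p\<close> up to \<open>1 - \<sigma>\<close> while \<open>l\<close> moves it along the segment to \<open>z\<close>; \<open>m\<close> and \<open>l\<close>
  are chosen so that \<open>\<sigma> = 0\<close> and \<open>\<sigma> = 1\<close> give the two paths on the nose.
\<close>

lemma homotopic_paths_cone:
  assumes p: "p \<in> paths_in X x y" and z: "z \<in> X"
    and cone: "\<And>t. t \<in> {0..1} \<Longrightarrow> {v. p t v \<noteq> 0} \<union> {v. z v \<noteq> 0} \<in> H"
  shows "homotopic_paths X (p +++ straight y z) (straight x z)"
proof -
  define l where "l = (\<lambda>w::real\<times>real. (1 - fst w) * max (2 * snd w - 1) 0 + fst w * snd w)"
  define m where "m = (\<lambda>w::real\<times>real. min (2 * snd w) 1 * (1 - fst w))"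
  define h where "h w = straight (p (m w)) z (l w)" for w
  have m01: "m w \<in> {0..1}" if "w \<in> {0..1} \<times> {0..1}" for w
    using that by (auto simp: m_def mult_le_one min_def)
  have l01: "l w \<in> {0..1}" if "w \<in> {0..1} \<times> {0..1}" for w
  proof -
    have "(1 - fst w) *\<^sub>R max (2 * snd w - 1) 0 + fst w *\<^sub>R snd w \<in> {0..1}"
      by (rule convexD_alt) (use that in auto)
    then show ?thesis by (simp add: l_def)
  qed
  have xy: "p 0 = x" "p 1 = y" "path p"
    using p by (auto simp: paths_in_def pathstart_def pathfinish_def)
  show ?thesis
    unfolding homotopic_paths
  proof (intro exI[of _ h] conjI ballI)
    have "continuous_on ({0..1} \<times> {0..1}) (\<lambda>w. p (m w))"
      by (rule continuous_on_compose2[OF xy(3)[unfolded path_def]])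
        (use m01 in \<open>auto simp: m_def intro!: continuous_intros\<close>)
    moreover have "continuous_on ({0..1} \<times> {0..1}) l"
      unfolding l_def by (intro continuous_intros)
    ultimately show "continuous_on ({0..1} \<times> {0..1}) h"
      unfolding h_def by (intro continuous_on_straight continuous_on_const)
    show "h \<in> {0..1} \<times> {0..1} \<rightarrow> X"
    proof
      fix w :: "real \<times> real" assume "w \<in> {0..1} \<times> {0..1}"
      then show "h w \<in> X"
        unfolding h_def by (intro straight_in paths_in_at[OF p] cone z m01 l01)
    qed
    fix t :: real assume t: "t \<in> {0..1}"
    show "h (0, t) = (p +++ straight y z) t"
      using t xy by (auto simp: h_def l_def m_def joinpaths_def)
    show "h (1, t) = straight x z t"
      using xy by (simp add: h_def l_def m_def)
    show "pathstart (h \<circ> Pair t) = pathstart (p +++ straight y z)"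
      using t xy by (simp add: pathstart_def h_def l_def m_def joinpaths_def)
    show "pathfinish (h \<circ> Pair t) = pathfinish (p +++ straight y z)"
      by (simp add: pathfinish_def h_def l_def m_def joinpaths_def)
  qed
qed

lemma edge_path:
  assumes "{v, w} \<in> H"
  shows "straight (vertex_point v) (vertex_point w) \<in> paths_in X (vertex_point v) (vertex_point w)"
proof (rule straight_paths_in)
  have "{u. vertex_point v u \<noteq> 0} \<union> {u. vertex_point w u \<noteq> 0} = {v, w}" by auto
  then show "{u. vertex_point v u \<noteq> 0} \<union> {u. vertex_point w u \<noteq> 0} \<in> H" using assms by simp
qed (use face_carrier[OF assms] in \<open>auto intro: vertex_point_in\<close>)

lemma spoke_path:
  assumes "x \<in> X" "x v \<noteq> 0" shows "straight x (vertex_point v) \<in> paths_in X x (vertex_point v)"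
proof -
  have "{u. x u \<noteq> 0} \<union> {u. vertex_point v u \<noteq> 0} = {u. x u \<noteq> 0}" using assms(2) by auto
  moreover have "v \<in> V" using face_carrier[OF support_face[OF assms(1)]] assms(2) by blast
  ultimately show ?thesis
    using assms(1) support_face by (intro straight_paths_in vertex_point_in) auto
qed

lemma homotopic_paths_spoke_edge:
  assumes "x \<in> X" "insert w {u. x u \<noteq> 0} \<in> H" "x v \<noteq> 0"
  shows "homotopic_paths X (straight x (vertex_point v) +++ straight (vertex_point v) (vertex_point w))
    (straight x (vertex_point w))"
proof (rule homotopic_paths_cone[OF spoke_path])
  show "vertex_point w \<in> X" using face_carrier[OF assms(2)] by (simp add: vertex_point_in)
  fix t :: real
  show "{u. straight x (vertex_point v) t u \<noteq> 0} \<union> {u. vertex_point w u \<noteq> 0} \<in> H"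
    by (rule face_subset[OF assms(2)]) (use assms(3) in \<open>auto simp: straight_def vertex_point_def\<close>)
qed (use assms in auto)

lemma homotopic_paths_edge_edge:
  assumes "{u, v, w} \<in> H"
  shows "homotopic_paths X (straight (vertex_point u) (vertex_point v) +++ straight (vertex_point v) (vertex_point w))
    (straight (vertex_point u) (vertex_point w))"
proof (rule homotopic_paths_cone[OF edge_path])
  show "{u, v} \<in> H" by (rule face_subset[OF assms]) auto
  show "vertex_point w \<in> X" using face_carrier[OF assms(1)] by (simp add: vertex_point_in)
  fix t :: real
  show "{x. straight (vertex_point u) (vertex_point v) t x \<noteq> 0} \<union> {u. vertex_point w u \<noteq> 0} \<in> H"
    by (rule face_subset[OF assms]) (auto simp: straight_def vertex_point_def split: if_splits)
qed

end

section \<open>Edge classes and a criterion for the fundamental group\<close>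

text \<open>The base point need not be a vertex: \<open>v0\<close> is a vertex of the simplex
  carrying it, and \<open>\<tau>\<close> chooses a path to each vertex. Condition
  \<open>tau_v0\<close> makes the holonomy of the loop cocycle, read at \<open>v0\<close>, the
  identity map and not merely a conjugation.\<close>

locale based_complex = finite_complex V H for V :: "'v set" and H :: "'v set set" +
  fixes a :: "'v \<Rightarrow> real" and v0 :: 'v and \<tau> :: "'v \<Rightarrow> real \<Rightarrow> 'v \<Rightarrow> real"
  assumes base: "a \<in> X" "a v0 \<noteq> 0"
    and tau: "\<And>v. v \<in> V \<Longrightarrow> \<tau> v \<in> paths_in X a (vertex_point v)"
    and tau_v0: "homotopic_paths X (straight a (vertex_point v0)) (\<tau> v0)"
begin

abbreviation "P \<equiv> fundamental_group X a"

definition edge_class :: "'v \<Rightarrow> 'v \<Rightarrow> (real \<Rightarrow> 'v \<Rightarrow> real) set" where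
  "edge_class v w = return_class X (\<tau> v +++ straight (vertex_point v) (vertex_point w)) (\<tau> w)"

lemma group_P: "group P"
  by (rule group_fundamental_group[OF base(1)])

lemma return_edge_class:
  assumes "q \<in> paths_in X a (vertex_point v)" "{v, w} \<in> H"
  shows "return_class X q (\<tau> v) \<otimes>\<^bsub>P\<^esub> edge_class v w =
    return_class X (q +++ straight (vertex_point v) (vertex_point w)) (\<tau> w)"
  unfolding edge_class_def using face_carrier[OF assms(2)]
  by (intro return_class_mult[OF assms(1) _ edge_path[OF assms(2)]] tau) auto

text \<open>In the product the inner way back and way out along \<open>\<tau> v\<close> cancel, and
  the triangle deforms its two edges into the third.\<close>

lemma edge_class_cocycle: "cocycle P H edge_class"
  unfolding cocycle_def
proof (intro allI impI conjI)
  fix u v w assume H: "{u, v, w} \<in> H"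
  have H2: "{u, v} \<in> H" "{v, w} \<in> H" by (rule face_subset[OF H], auto)+
  have V: "u \<in> V" "v \<in> V" "w \<in> V" using face_carrier[OF H] by auto
  let ?e = "\<lambda>u v. straight (vertex_point u) (vertex_point v)"
  have uv: "\<tau> u +++ ?e u v \<in> paths_in X a (vertex_point v)"
    using paths_in_join tau[OF V(1)] edge_path[OF H2(1)] by blast
  then show "edge_class u v \<in> carrier P"
    unfolding edge_class_def using return_class_closed tau[OF V(2)] by blast
  have "homotopic_paths X ((\<tau> u +++ ?e u v) +++ ?e v w) (\<tau> u +++ (?e u v +++ ?e v w))"
    by (rule homotopic_paths_sym[OF homotopic_paths_assoc])
      (use tau[OF V(1)] edge_path[OF H2(1)] edge_path[OF H2(2)] in \<open>auto simp: paths_in_def\<close>)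
  also have "homotopic_paths X \<dots> (\<tau> u +++ ?e u w)"
    by (rule homotopic_paths_join_right[OF homotopic_paths_edge_edge[OF H]])
      (use tau[OF V(1)] in \<open>auto simp: paths_in_def\<close>)
  finally have "return_class X ((\<tau> u +++ ?e u v) +++ ?e v w) (\<tau> w) = edge_class u w"
    unfolding edge_class_def
    by (rule return_class_cong[OF _ paths_in_join[OF uv edge_path[OF H2(2)]] tau[OF V(3)]])
  then show "edge_class u v \<otimes>\<^bsub>P\<^esub> edge_class v w = edge_class u w"
    using return_edge_class[OF uv H2(2)] unfolding edge_class_def by simp
qed

sublocale edge: complex_cocycle V H P edge_class
  using complex group_P edge_class_cocycle
  by (simp add: complex_cocycle_def finite_complex_def complex_cocycle_axioms_def)

section \<open>The tautological flat section of a loop\<close>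

lemma initial_path:
  assumes "p \<in> paths_in X a b" "t \<in> {0..1}"
  shows "(\<lambda>x. p (t * x)) \<in> paths_in X a (p t)"
proof -
  have "continuous_on {0..1} (\<lambda>x. p (t * x))"
    by (rule continuous_on_compose2[of "{0..1}" p])
      (use assms in \<open>auto simp: paths_in_def path_def mult_le_one intro!: continuous_intros\<close>)
  moreover have "p (t * x) \<in> X" if "x \<in> {0..1}" for x
    using paths_in_at[OF assms(1), of "t * x"] that assms(2) by (auto simp: mult_le_one)
  ultimately show ?thesis
    using assms(1) by (auto simp: paths_in_def path_def path_image_def pathstart_def pathfinish_def)
qed

lemma middle_path:
  assumes p: "p \<in> paths_in X a b" and t: "t \<in> {0..1}" "s \<in> {0..1}"
    and S: "\<And>x. x \<in> closed_segment t s \<Longrightarrow> p x \<in> S"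
  shows "(\<lambda>x. p (t + (s - t) * x)) \<in> paths_in S (p t) (p s)"
proof -
  have seg: "t + (s - t) * x \<in> closed_segment t s" if "x \<in> {0..1}" for x
    unfolding in_segment using that by (intro exI[of _ x]) (auto simp: algebra_simps)
  have "closed_segment t s \<subseteq> {0..1}"
    using t by (intro closed_segment_subset) auto
  then have sub: "(\<lambda>x. t + (s - t) * x) ` {0..1} \<subseteq> {0..1}"
    using seg by blast
  have "continuous_on {0..1} p" using p by (simp add: paths_in_def path_def)
  then have "continuous_on {0..1} (\<lambda>x. p (t + (s - t) * x))"
    by (rule continuous_on_compose2[OF _ _ sub]) (intro continuous_intros)
  then show ?thesis
    using S(1)[OF seg] by (auto simp: paths_in_def path_def path_image_def pathstart_def pathfinish_def)
qed

text \<open>Passing from \<open>v\<close> to \<open>w\<close> appends an edge, and spoke and edge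
  deform to the spoke to \<open>w\<close> inside the simplex carrying \<open>p t\<close>. For local
  constancy, \<open>s\<close> is taken so close to \<open>t\<close> that coordinate \<open>v\<close>
  is nonzero in between: the arc from \<open>p t\<close> to \<open>p s\<close> followed by the spoke
  to \<open>v\<close> can then be coned to the spoke from \<open>p t\<close>.\<close>

lemma tautological_section:
  assumes p: "p \<in> loops_at X a"
  shows "flat_section P edge_class {0..1} p
    (\<lambda>t v. return_class X ((\<lambda>x. p (t * x)) +++ straight (p t) (vertex_point v)) (\<tau> v))"
proof (rule flat_sectionI)
  let ?c = "\<lambda>t v. return_class X ((\<lambda>x. p (t * x)) +++ straight (p t) (vertex_point v)) (\<tau> v)"
  have pp: "p \<in> paths_in X a a" using p by (simp add: loops_at_eq_paths_in)
  fix t v assume t: "t \<in> {0..1}" and v: "p t v \<noteq> 0"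
  have pt: "p t \<in> X" using paths_in_at[OF pp t] .
  have inV: "u \<in> V" if "p t u \<noteq> 0" for u using face_carrier[OF support_face[OF pt]] that by blast
  note q = paths_in_join[OF initial_path[OF pp t] spoke_path[OF pt v]]
  show "?c t v \<in> carrier P" by (rule return_class_closed[OF q tau[OF inV[OF v]]])
  {
    fix w assume w: "p t w \<noteq> 0"
    let ?e = "straight (vertex_point v) (vertex_point w)"
    have vw: "{v, w} \<in> H" by (rule face_subset[OF support_face[OF pt]]) (use v w in auto)
    have "homotopic_paths X (((\<lambda>x. p (t * x)) +++ straight (p t) (vertex_point v)) +++ ?e)
      ((\<lambda>x. p (t * x)) +++ (straight (p t) (vertex_point v) +++ ?e))"
      by (rule homotopic_paths_sym[OF homotopic_paths_assoc])
        (use initial_path[OF pp t] spoke_path[OF pt v] edge_path[OF vw] in \<open>auto simp: paths_in_def\<close>)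
    also have "homotopic_paths X \<dots> ((\<lambda>x. p (t * x)) +++ straight (p t) (vertex_point w))"
    proof (rule homotopic_paths_join_right[OF homotopic_paths_spoke_edge[OF pt _ v]])
      show "insert w {u. p t u \<noteq> 0} \<in> H" using support_face[OF pt] w by (simp add: insert_absorb)
    qed (use initial_path[OF pp t] in \<open>auto simp: paths_in_def\<close>)
    finally show "?c t w = ?c t v \<otimes>\<^bsub>P\<^esub> edge_class v w"
      unfolding return_edge_class[OF q vw]
      by (rule return_class_cong[OF _ paths_in_join[OF q edge_path[OF vw]] tau[OF inV[OF w]], symmetric])
  }
  let ?S = "{x \<in> X. x v \<noteq> 0}"
  have "continuous_on {0..1} p" using pp by (simp add: paths_in_def path_def)
  then have "continuous_on {0..1} (\<lambda>s. p s v)"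
    by (rule continuous_on_product_then_coordinatewise)
  then obtain d where d: "d > 0" "\<And>s. s \<in> {0..1} \<Longrightarrow> dist s t < d \<Longrightarrow> dist (p s v) (p t v) < \<bar>p t v\<bar>"
    unfolding continuous_on_iff using t v by (meson zero_less_abs_iff)
  have "?c s v = ?c t v" if s: "s \<in> {0..1}" "dist s t < d" for s
  proof -
    have seg: "p x \<in> ?S" if x: "x \<in> closed_segment t s" for x
    proof -
      have x01: "x \<in> {0..1}" using x t s(1) by (auto simp: closed_segment_eq_real_ivl split: if_splits)
      have "dist x t < d" using x s(2) by (auto simp: closed_segment_eq_real_ivl dist_real_def split: if_splits)
      then have "p x v \<noteq> 0" using d(2)[OF x01] by (auto simp: dist_real_def)
      then show ?thesis using paths_in_at[OF pp x01] by simp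
    qed
    have psv: "p s v \<noteq> 0" "p s \<in> X" using seg[of s] by auto
    let ?m = "\<lambda>x. p (t + (s - t) * x)"
    have m: "?m \<in> paths_in ?S (p t) (p s)" by (rule middle_path[OF pp t s(1) seg])
    then have m': "?m \<in> paths_in X (p t) (p s)" by (auto simp: paths_in_def)
    note ini = initial_path[OF pp s(1)] and it = initial_path[OF pp t]
    have "homotopic_paths X ((\<lambda>x. p (s * x)) +++ straight (p s) (vertex_point v))
      (((\<lambda>x. p (t * x)) +++ ?m) +++ straight (p s) (vertex_point v))"
      by (intro homotopic_paths_join_left homotopic_paths_sym[OF homotopic_paths_split])
        (use pp t s ini spoke_path[OF psv(2,1)] in \<open>auto simp: paths_in_def\<close>)
    also have "homotopic_paths X \<dots> ((\<lambda>x. p (t * x)) +++ (?m +++ straight (p s) (vertex_point v)))"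
      by (rule homotopic_paths_sym[OF homotopic_paths_assoc])
        (use it m' spoke_path[OF psv(2,1)] in \<open>auto simp: paths_in_def\<close>)
    also have "homotopic_paths X \<dots> ((\<lambda>x. p (t * x)) +++ straight (p t) (vertex_point v))"
    proof (rule homotopic_paths_join_right[OF homotopic_paths_cone[OF m']])
      show "vertex_point v \<in> X" by (rule vertex_point_in[OF inV[OF v]])
      fix y :: real assume "y \<in> {0..1}"
      then have "?m y \<in> ?S" by (rule paths_in_at[OF m])
      then show "{u. ?m y u \<noteq> 0} \<union> {u. vertex_point v u \<noteq> 0} \<in> H"
        using support_face[of "?m y"] by (simp add: insert_absorb)
    qed (use it m' in \<open>auto simp: paths_in_def\<close>)
    finally show ?thesis
      by (rule return_class_cong[OF _ paths_in_join[OF ini spoke_path[OF psv(2,1)]] tau[OF inV[OF v]]])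
  qed
  then show "eventually (\<lambda>s. ?c s v = ?c t v) (at t within {0..1})"
    unfolding eventually_at using d(1) by blast
qed

text \<open>Read at \<open>v0\<close>, the tautological section starts with the identity, because
  \<open>\<tau> v0\<close> is homotopic to the spoke; at time one the whole loop has been traversed,
  and spoke and way back cancel again.\<close>

lemma holonomy_edge_class:
  assumes "A \<in> carrier P"
  shows "edge.holonomy v0 A = A"
proof -
  obtain p where A: "A = path_class X p" and p: "p \<in> loops_at X a"
    using assms by (auto simp: carrier_fundamental_group)
  have pp: "p \<in> paths_in X a a" using p by (simp add: loops_at_eq_paths_in)
  have p01: "p 0 = a" "p 1 = a" using p by (auto simp: loops_at_def pathstart_def pathfinish_def)
  let ?c = "\<lambda>t v. return_class X ((\<lambda>x. p (t * x)) +++ straight (p t) (vertex_point v)) (\<tau> v)"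
  note spoke = spoke_path[OF base]
  have v0: "v0 \<in> V" using face_carrier[OF support_face[OF base(1)]] base(2) by blast
  have const: "(\<lambda>_. a) \<in> paths_in X a a" using base by (simp add: paths_in_def)
  have "homotopic_paths X ((\<lambda>x. p (0 * x)) +++ straight (p 0) (vertex_point v0)) (straight a (vertex_point v0))"
    using homotopic_paths_const_left[of "straight a (vertex_point v0)" X a] spoke p01
    by (simp add: paths_in_def)
  then have 0: "?c 0 v0 = \<one>\<^bsub>P\<^esub>"
    using return_class_self[OF _ tau[OF v0]] tau_v0 homotopic_paths_trans by blast
  have "?c 1 v0 = return_class X (p +++ straight a (vertex_point v0)) (\<tau> v0)"
    using p01 by simp
  also have "\<dots> = return_class X (p +++ \<tau> v0) (\<tau> v0)"
    by (rule return_class_cong[OF homotopic_paths_join_right[OF tau_v0] paths_in_join[OF pp spoke] tau[OF v0]])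
      (use pp in \<open>auto simp: paths_in_def\<close>)
  also have "\<dots> = path_class X p"
    unfolding return_class_def
  proof (rule path_class_eq)
    have t: "\<tau> v0 \<in> paths_in X a (vertex_point v0)" by (rule tau[OF v0])
    have "homotopic_paths X ((p +++ \<tau> v0) +++ reversepath (\<tau> v0)) (p +++ (\<tau> v0 +++ reversepath (\<tau> v0)))"
      by (rule homotopic_paths_sym[OF homotopic_paths_assoc]) (use t pp in \<open>auto simp: paths_in_def\<close>)
    also have "homotopic_paths X \<dots> (p +++ (\<lambda>_. a))"
      using homotopic_paths_reverse_right[of "\<tau> v0" X] t pp
      by (intro homotopic_paths_join_right) (auto simp: paths_in_def)
    also have "homotopic_paths X \<dots> p"
      by (rule homotopic_paths_const_right) (use pp in \<open>auto simp: paths_in_def\<close>)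
    finally show "homotopic_paths X ((p +++ \<tau> v0) +++ reversepath (\<tau> v0)) p" .
  qed
  finally have 1: "?c 1 v0 = A" using A by simp
  have "edge.transport p v0 v0 A"
    unfolding edge.transport_def using 0 1 tautological_section[OF p] p base
    by (intro conjI exI[of _ ?c]) (auto simp: loops_at_def)
  then show ?thesis unfolding A by (rule edge.holonomy_eq)
qed

text \<open>By \<open>tau1\<close> the loop through an edge has holonomy exactly
  \<open>g v w\<close>, so \<open>gen\<close> gives surjectivity. For injectivity,
  \<open>\<psi>\<close> turns the flat section of a loop into one for \<open>edge_class\<close>,
  whose end value is the class of that loop.\<close>

theorem fundamental_group_iso:
  assumes "complex_cocycle V H G g"
    and psi: "\<psi> \<in> hom G P" "\<And>v w. {v, w} \<in> H \<Longrightarrow> \<psi> (g v w) = edge_class v w"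
    and tau1: "\<And>v. v \<in> V \<Longrightarrow> complex_cocycle.transport V H G g (\<tau> v) v0 v \<one>\<^bsub>G\<^esub>"
    and gen: "\<And>K. subgroup K G \<Longrightarrow> (\<And>v w. {v, w} \<in> H \<Longrightarrow> g v w \<in> K) \<Longrightarrow> carrier G \<subseteq> K"
  shows "P \<cong> G"
proof -
  interpret C: complex_cocycle V H G g by fact
  let ?h = "C.holonomy v0"
  have hom: "?h \<in> hom P G" using C.holonomy_hom[of a v0] base(2) by simp
  have inv: "\<psi> (?h A) = A" if A: "A \<in> carrier P" for A
  proof -
    obtain p where p: "A = path_class X p" "p \<in> loops_at X a"
      using A by (auto simp: carrier_fundamental_group)
    then have t: "C.transport p v0 v0 (?h A)" using C.transport_holonomy[of p a v0] base(2) by simp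
    then obtain c where c: "flat_section G g {0..1} p c" "c 0 v0 = \<one>\<^bsub>G\<^esub>" "c 1 v0 = ?h A"
      unfolding C.transport_def by blast
    have "flat_section P edge_class {0..1} p (\<lambda>z v. \<psi> (c z v))"
    proof (rule flat_section_hom[OF c(1) psi(1)])
      fix z v w assume z: "z \<in> {0..1}" "p z v \<noteq> 0" "p z w \<noteq> 0"
      then have "p z \<in> X" using p(2) by (auto simp: loops_at_def path_image_def)
      then have "{v, w} \<in> H" by (rule face_subset[OF support_face]) (use z in auto)
      then show "g v w \<in> carrier G \<and> \<psi> (g v w) = edge_class v w"
        using C.g_closed psi(2) by blast
    qed
    then have "edge.transport p v0 v0 (\<psi> (?h A))"
      using t c hom_one[OF psi(1) C.is_group group_P] unfolding edge.transport_def C.transport_def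
      by (intro conjI exI[of _ "\<lambda>z v. \<psi> (c z v)"]) auto
    then show ?thesis
      using edge.holonomy_eq holonomy_edge_class[OF A] p(1) by metis
  qed
  have "inj_on ?h (carrier P)" by (rule inj_on_inverseI[where g=\<psi>]) (rule inv)
  moreover have "carrier G \<subseteq> ?h ` carrier P"
  proof (rule gen)
    show "subgroup (?h ` carrier P) G"
      using group_hom.img_is_subgroup[of P G ?h] hom group_P C.is_group
      by (simp add: group_hom_def group_hom_axioms_def)
    fix v w assume H: "{v, w} \<in> H"
    then have V: "v \<in> V" "w \<in> V" using face_carrier by auto
    let ?e = "straight (vertex_point v) (vertex_point w)"
    have "C.transport ?e v w (g v w)"
    proof (rule C.transport_star)
      fix t :: real
      show "insert v {u. ?e t u \<noteq> 0} \<in> H"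
        by (rule face_subset[OF H]) (auto simp: straight_def vertex_point_def split: if_splits)
    qed (use edge_path[OF H] in \<open>auto simp: paths_in_def\<close>)
    then have "C.transport (\<tau> v +++ ?e) v0 w (\<one>\<^bsub>G\<^esub> \<otimes>\<^bsub>G\<^esub> g v w)"
      by (rule C.transport_join[OF tau1[OF V(1)]]) (use tau[OF V(1)] in \<open>simp add: paths_in_def\<close>)
    then have "C.transport ((\<tau> v +++ ?e) +++ reversepath (\<tau> w)) v0 v0
        (\<one>\<^bsub>G\<^esub> \<otimes>\<^bsub>G\<^esub> g v w \<otimes>\<^bsub>G\<^esub> inv\<^bsub>G\<^esub> \<one>\<^bsub>G\<^esub>)"
      by (rule C.transport_join[OF _ C.transport_reversepath[OF tau1[OF V(2)]]])
        (use tau[OF V(2)] in \<open>simp add: paths_in_def\<close>)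
    then have "?h (edge_class v w) = g v w"
      unfolding edge_class_def return_class_def using C.holonomy_eq C.g_closed[OF H] by simp
    moreover have "edge_class v w \<in> carrier P" by (rule edge.g_closed[OF H])
    ultimately show "g v w \<in> ?h ` carrier P" by (metis imageI)
  qed
  ultimately have "?h \<in> iso P G"
    using hom by (auto simp: iso_def bij_betw_def hom_def)
  then show ?thesis by (auto simp: is_iso_def)
qed

end

section \<open>Truncated boolean representable complexes\<close>

text \<open>Row \<open>r\<close> and column \<open>p\<close> are put in front. Row \<open>r\<close>
  vanishes on \<open>Y\<close>, which keeps the matrix lower unitriangular; it is also a new row,
  since each selected row has a diagonal entry one in a column of \<open>Y\<close>.\<close>

lemma columns_independent_insert:
  assumes Y: "columns_independent m M Y" and r: "r < m" "\<And>y. y \<in> Y \<Longrightarrow> \<not> M r y" "M r p"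
  shows "columns_independent m M (insert p Y)"
proof -
  obtain n \<rho> \<kappa> where \<rho>: "inj_on \<rho> {..<n}" "\<rho> ` {..<n} \<subseteq> {..<m}" and \<kappa>: "bij_betw \<kappa> {..<n} Y"
    and tri: "lower_unitriangular n (\<lambda>i j. M (\<rho> i) (\<kappa> j))"
    using Y unfolding columns_independent_def by blast
  define \<rho>' where "\<rho>' = case_nat r \<rho>"
  define \<kappa>' where "\<kappa>' = case_nat p \<kappa>"
  have Suc: "{..<Suc n} = insert 0 (Suc ` {..<n})" by (simp add: lessThan_Suc_eq_insert_0)
  have Y_eq: "\<kappa> ` {..<n} = Y" using \<kappa> by (simp add: bij_betw_def)
  have "r \<noteq> \<rho> i" if "i < n" for i
    using tri that r(2)[of "\<kappa> i"] Y_eq by (auto simp: lower_unitriangular_def)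
  then have "inj_on \<rho>' {..<Suc n}"
    unfolding Suc \<rho>'_def using \<rho>(1) by (auto simp: inj_on_def)
  moreover have "\<rho>' ` {..<Suc n} \<subseteq> {..<m}"
    unfolding Suc \<rho>'_def using \<rho>(2) r(1) by auto
  moreover have "bij_betw \<kappa>' {..<Suc n} (insert p Y)"
    unfolding Suc \<kappa>'_def bij_betw_def using \<kappa> r Y_eq by (auto simp: inj_on_def bij_betw_def image_image)
  moreover have "lower_unitriangular (Suc n) (\<lambda>i j. M (\<rho>' i) (\<kappa>' j))"
    unfolding lower_unitriangular_def \<rho>'_def \<kappa>'_def
    using tri r Y_eq by (auto simp: lower_unitriangular_def less_Suc_eq_0_disj)
  ultimately show ?thesis unfolding columns_independent_def by blast
qed

lemma ex_face_card:
  assumes "abstract_simplicial_complex V H"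
  shows "\<exists>A\<in>H. card A = complex_dim H + 1"
proof -
  have "finite H" using assms finite_subset by (auto simp: abstract_simplicial_complex_def)
  moreover obtain v where "{v} \<in> H" using assms by (auto simp: abstract_simplicial_complex_def)
  \<comment> \<open>The singleton makes the maximum at least one, so the subtraction in
    \<open>complex_dim\<close> does not truncate.\<close>
  ultimately have "Max (card ` H) \<in> card ` H" "card {v} \<le> Max (card ` H)"
    by (auto intro!: Max_in Max_ge simp del: card.insert)
  then show ?thesis by (auto simp: complex_dim_def)
qed

lemma TBRSC_complex:
  assumes "TBRSC V H" shows "abstract_simplicial_complex V H"
proof -
  obtain k H' where k: "k \<ge> 1" and H': "abstract_simplicial_complex V H'" "H = truncation k V H'"
    using assms unfolding TBRSC_def BRSC_def by blast
  have "card Y \<le> k" if "card X \<le> k" "Y \<subseteq> X" "finite X" for X Y :: "'a set"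
    using card_mono[OF that(3,2)] that(1) by simp
  then show ?thesis
    using H' k unfolding abstract_simplicial_complex_def truncation_def subsets_upto_def
    by (auto intro: finite_subset)
qed

text \<open>A triangular submatrix is read backwards: the common zero sets of its first
  \<open>n - i\<close> rows grow with \<open>i\<close>, and the reversed columns climb through them.
  A vertex outside such a set is detected by a row vanishing on the set, so it can be adjoined to
  any independent set inside.\<close>

lemma TBRSC_subset_H_eps:
  assumes "TBRSC V H" shows "H \<subseteq> H_eps V H"
proof
  note complex = TBRSC_complex[OF assms]
  obtain k H' m M where H': "abstract_simplicial_complex V H'" "H = truncation k V H'"
    and M: "H' = {X. X \<subseteq> V \<and> columns_independent m M X}"
    using assms unfolding TBRSC_def BRSC_def by blast
  \<comment> \<open>A face of maximal size survives the truncation, so adjoining one vertex to a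
    face of size at most \<open>complex_dim H\<close> is never cut off.\<close>
  have dim: "complex_dim H + 1 \<le> k"
    using ex_face_card[OF complex] H'(2) by (auto simp: truncation_def subsets_upto_def)
  fix X assume "X \<in> H"
  then have X: "X \<subseteq> V" "columns_independent m M X" using H' M by (auto simp: truncation_def)
  then obtain n \<rho> \<kappa> where \<rho>: "inj_on \<rho> {..<n}" "\<rho> ` {..<n} \<subseteq> {..<m}" and \<kappa>: "bij_betw \<kappa> {..<n} X"
    and tri: "lower_unitriangular n (\<lambda>i j. M (\<rho> i) (\<kappa> j))"
    unfolding columns_independent_def by blast
  define x where "x i = \<kappa> (n - i)" for i
  define F where "F i = {v \<in> V. \<forall>l<n - i. \<not> M (\<rho> l) v}" for i
  have "bij_betw (\<lambda>i. n - i) {1..n} {..<n}"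
    by (rule bij_betwI[where g="\<lambda>i. n - i"]) auto
  then have x: "bij_betw x {1..n} X"
    unfolding x_def using bij_betw_trans[OF _ \<kappa>] by (simp add: comp_def)
  have "F i \<in> eps V H" for i
    unfolding eps_def
  proof (intro CollectI conjI ballI)
    show "F i \<subseteq> V" by (auto simp: F_def)
    fix Y p assume Y: "Y \<in> H \<inter> subsets_upto (complex_dim H) (F i)" and p: "p \<in> V - F i"
    then obtain l where l: "l < n - i" "M (\<rho> l) p" by (auto simp: F_def)
    have "columns_independent m M (insert p Y)"
    proof (rule columns_independent_insert)
      show "columns_independent m M Y" using Y H' M by (auto simp: truncation_def)
      have "l < n" using l(1) by simp
      then show "\<rho> l < m" using \<rho>(2) by auto
      show "\<not> M (\<rho> l) y" if "y \<in> Y" for y using that Y l by (auto simp: subsets_upto_def F_def)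
    qed (fact l)
    moreover have "insert p Y \<subseteq> V" using Y p by (auto simp: subsets_upto_def F_def)
    moreover have "card (insert p Y) \<le> k" "finite Y"
      using Y dim card_insert_le_m1[of "complex_dim H + 1" Y p] by (auto simp: subsets_upto_def)
    ultimately show "Y \<union> {p} \<in> H" using H' M by (auto simp: truncation_def subsets_upto_def)
  qed
  moreover have "x i \<in> F i" "x i \<notin> F (i - 1)" "F (i - 1) \<subseteq> F i" if i: "i \<in> {1..n}" for i
  proof -
    have "n - i < n - (i - 1)" "n - i < n" using i by auto
    moreover from this have "x i \<in> V" using x i X(1) by (auto simp: bij_betw_def)
    ultimately show "x i \<in> F i" "x i \<notin> F (i - 1)"
      using tri i by (auto simp: F_def x_def lower_unitriangular_def)
    show "F (i - 1) \<subseteq> F i" by (auto simp: F_def)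
  qed
  ultimately show "X \<in> H_eps V H"
    unfolding H_eps_def transversals_def using X(1) x
    by (intro CollectI conjI exI[of _ n] exI[of _ x] exI[of _ F]) blast+
qed

text \<open>The transversal is built up in order: its first \<open>i\<close> elements form a face
  inside \<open>F i\<close>, and the next element lies outside \<open>F i\<close>. The bound on
  \<open>X\<close> guarantees that \<open>i\<close> is at most \<open>complex_dim H\<close> whenever
  an element is adjoined.\<close>

lemma H_eps_small_face:
  assumes H: "abstract_simplicial_complex V H" and X: "X \<in> H_eps V H" "card X \<le> complex_dim H + 1"
  shows "X \<in> H"
proof -
  obtain k :: nat and x F where x: "bij_betw x {1..k} X" and F: "\<And>i. i \<le> k \<Longrightarrow> F i \<in> eps V H"
    and step: "\<And>i. i \<in> {1..k} \<Longrightarrow> F (i - 1) \<subset> F i \<and> x i \<in> F i - F (i - 1)"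
    and "X \<subseteq> V"
    using X(1) unfolding H_eps_def transversals_def by blast
  have k: "card X = k" using bij_betw_same_card[OF x] by simp
  have "x ` {1..i} \<in> H \<and> x ` {1..i} \<subseteq> F i" if "i \<le> k" for i
    using that
  proof (induction i)
    case 0
    obtain v where "{v} \<in> H" using H by (auto simp: abstract_simplicial_complex_def)
    then show ?case using H by (auto simp: abstract_simplicial_complex_def)
  next
    case (Suc i)
    let ?Y = "x ` {1..i}"
    have S: "F i \<subset> F (Suc i)" "x (Suc i) \<in> F (Suc i)" "x (Suc i) \<notin> F i"
      using step[of "Suc i"] Suc.prems by auto
    have V: "F i \<in> eps V H" "F (Suc i) \<subseteq> V" using F[of i] F[of "Suc i"] Suc.prems by (auto simp: eps_def)
    have "card ?Y \<le> i" using card_image_le[of "{1..i}" x] by simp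
    then have "?Y \<in> H \<inter> subsets_upto (complex_dim H) (F i)"
      using Suc X(2) k by (auto simp: subsets_upto_def)
    then have "?Y \<union> {x (Suc i)} \<in> H" using V S unfolding eps_def by blast
    moreover have "x ` {1..Suc i} = ?Y \<union> {x (Suc i)}" by (simp add: atLeastAtMostSuc_conv)
    ultimately show ?case using S Suc by auto
  qed
  from this[of k] show ?thesis using x by (simp add: bij_betw_def)
qed

text \<open>The element \<open>a\<close> is the one of \<open>A\<close> enumerated last, and
  \<open>F\<close> is the member of the chain just before it.\<close>

lemma transversal_split:
  assumes I: "I \<in> transversals V \<F>" and A: "A \<subseteq> I" "A \<noteq> {}"
  shows "\<exists>a\<in>A. \<exists>F\<in>\<F>. A - {a} \<subseteq> F \<and> a \<notin> F"
proof -
  obtain k :: nat and x F where x: "bij_betw x {1..k} I" and F: "\<And>i. i \<le> k \<Longrightarrow> F i \<in> \<F>"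
    and step: "\<And>i. i \<in> {1..k} \<Longrightarrow> F (i - 1) \<subset> F i \<and> x i \<in> F i - F (i - 1)"
    using I unfolding transversals_def by blast
  have mono: "F i \<subseteq> F j" if "i \<le> j" "j \<le> k" for i j
    using that
  proof (induction j)
    case (Suc j)
    then show ?case using step[of "Suc j"] by (cases "i = Suc j") auto
  qed simp
  define J where "J = {j \<in> {1..k}. x j \<in> A}"
  have A_eq: "A = x ` J" using x A(1) by (auto simp: J_def bij_betw_def)
  have J: "finite J" "J \<noteq> {}" using A(2) unfolding A_eq by (simp_all add: J_def)
  have m: "Max J \<in> J" "\<And>j. j \<in> J \<Longrightarrow> j \<le> Max J" using Max_in[OF J] Max_ge[OF J(1)] by blast+
  have "x j \<in> F (Max J - 1)" if "j \<in> J" "j \<noteq> Max J" for j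
  proof -
    have "j \<le> Max J - 1" using m(2)[OF that(1)] that(2) by simp
    then have "F j \<subseteq> F (Max J - 1)" using m(1) by (intro mono) (auto simp: J_def)
    then show ?thesis using step[of j] that(1) by (auto simp: J_def)
  qed
  then have "A - {x (Max J)} \<subseteq> F (Max J - 1)" unfolding A_eq by auto
  moreover have J_max: "Max J \<in> {1..k}" "x (Max J) \<in> A" using m(1) unfolding J_def by blast+
  moreover have "Max J - 1 \<le> k" using J_max(1) by (intro diff_le_self[THEN order_trans]) simp
  then have "F (Max J - 1) \<in> \<F>" by (rule F)
  moreover have "x (Max J) \<notin> F (Max J - 1)" using step J_max(1) by blast
  ultimately show ?thesis by blast
qed

text \<open>The chain for \<open>I\<close> is intersected with \<open>X\<close> and continued by
  \<open>V\<close>. The family \<open>eps V H\<close> is closed under intersection, the steps stay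
  strict because \<open>I\<close> lies in \<open>X\<close>, and the new last step picks up
  \<open>p\<close>.\<close>

lemma eps_subset_flats: "eps V H \<subseteq> flats V (H_eps V H)"
proof
  fix X assume X: "X \<in> eps V H"
  show "X \<in> flats V (H_eps V H)"
    unfolding flats_def
  proof (intro CollectI conjI ballI)
    show XV: "X \<subseteq> V" using X by (auto simp: eps_def)
    fix I p assume I: "I \<in> H_eps V H \<inter> Pow X" and p: "p \<in> V - X"
    then obtain k :: nat and x F where x: "bij_betw x {1..k} I" and F: "\<And>i. i \<le> k \<Longrightarrow> F i \<in> eps V H"
      and step: "\<And>i. i \<in> {1..k} \<Longrightarrow> F (i - 1) \<subset> F i \<and> x i \<in> F i - F (i - 1)"
      unfolding H_eps_def transversals_def by blast
    define x' where "x' = x(Suc k := p)"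
    define F' where "F' i = (if i \<le> k then F i \<inter> X else V)" for i
    have "bij_betw x' {1..k} I"
      using x bij_betw_cong[of "{1..k}" x x' I] by (simp add: x'_def)
    then have "bij_betw x' ({1..k} \<union> {Suc k}) (I \<union> {x' (Suc k)})"
      using p I by (intro notIn_Un_bij_betw) (auto simp: x'_def)
    moreover have "{1..k} \<union> {Suc k} = {1..Suc k}" by auto
    ultimately have bij: "bij_betw x' {1..Suc k} (I \<union> {p})" by (simp add: x'_def)
    have "Y \<inter> X \<in> eps V H" if "Y \<in> eps V H" for Y
      using that X unfolding eps_def subsets_upto_def by auto
    moreover have "V \<in> eps V H" by (auto simp: eps_def)
    ultimately have "F' i \<in> eps V H" for i using F by (simp add: F'_def)
    moreover have "F' (i - 1) \<subset> F' i \<and> x' i \<in> F' i - F' (i - 1)" if i: "i \<in> {1..Suc k}" for i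
    proof (cases "i = Suc k")
      case True
      then show ?thesis using p XV by (auto simp: F'_def x'_def)
    next
      case False
      then have "i \<in> {1..k}" using i by auto
      moreover from this have "x i \<in> X" using x I by (auto simp: bij_betw_def)
      ultimately show ?thesis using step[of i] by (auto simp: F'_def x'_def)
    qed
    moreover have "I \<union> {p} \<subseteq> V" using I p XV by auto
    ultimately show "I \<union> {p} \<in> H_eps V H"
      unfolding H_eps_def transversals_def using bij
      by (intro CollectI conjI exI[of _ "Suc k"] exI[of _ x'] exI[of _ F']) blast+
  qed
qed

section \<open>Graphs of flats\<close>

text \<open>
  \<open>L\<close> stands for the flats of \<open>S\<^sup>\<epsilon>\<close>, and \<open>H\<close> for any complex with the same faces of size at most
  three. The set in \<open>L_class\<close> is the closure of \<open>p\<close>.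
\<close>

locale flat_complex = finite_complex V H for V :: "'v set" and H :: "'v set set" +
  fixes L :: "'v set set"
  assumes L_subset: "F \<in> L \<Longrightarrow> F \<subseteq> V"
    and L_split: "A \<in> H \<Longrightarrow> A \<noteq> {} \<Longrightarrow> \<exists>a\<in>A. \<exists>F\<in>L. A - {a} \<subseteq> F \<and> a \<notin> F"
    and L_extend: "F \<in> L \<Longrightarrow> A \<in> H \<Longrightarrow> A \<subseteq> F \<Longrightarrow> card A \<le> 2 \<Longrightarrow> p \<in> V - F \<Longrightarrow> insert p A \<in> H"
    and L_class: "p \<in> V \<Longrightarrow> {q \<in> V. q = p \<or> {p, q} \<notin> H} \<in> L"
    and triangle: "\<exists>u v w. u \<noteq> v \<and> u \<noteq> w \<and> v \<noteq> w \<and> {u, v, w} \<in> H"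
begin

text \<open>Parallel in the sense of matroid theory. It proves to be an equivalence relation whose
  classes are not split by any flat.\<close>

definition par :: "'v \<Rightarrow> 'v \<Rightarrow> bool" where
  "par p q \<longleftrightarrow> p \<in> V \<and> q \<in> V \<and> (q = p \<or> {p, q} \<notin> H)"

text \<open>The closure of a pair is proper exactly when some proper flat contains the pair, so this
  is the graph of flats without reference to closures.\<close>

definition adj :: "'v \<Rightarrow> 'v \<Rightarrow> bool" where
  "adj p q \<longleftrightarrow> p \<noteq> q \<and> (\<exists>F\<in>L. F \<noteq> V \<and> p \<in> F \<and> q \<in> F)"

definition conn :: "'v \<Rightarrow> 'v \<Rightarrow> bool" where
  "conn p q \<longleftrightarrow> p \<in> V \<and> q \<in> V \<and> (p, q) \<in> {(p, q). adj p q}\<^sup>*"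

definition nontriv :: "'v set \<Rightarrow> bool" where
  "nontriv C \<longleftrightarrow> (\<exists>p\<in>C. \<exists>q\<in>C. p \<noteq> q \<and> {p, q} \<in> H)"

abbreviation comp_of :: "'v \<Rightarrow> 'v set" where
  "comp_of v \<equiv> {u. conn v u}"

lemma edge_in_V: "{p, q} \<in> H \<Longrightarrow> p \<in> V \<and> q \<in> V"
  using face_carrier by blast

lemma adj_in_V: "adj p q \<Longrightarrow> p \<in> V \<and> q \<in> V"
  using L_subset unfolding adj_def by blast

lemma adj_sym: "adj p q \<Longrightarrow> adj q p"
  unfolding adj_def by blast

lemma par_sym: "par p q \<Longrightarrow> par q p"
  unfolding par_def by (auto simp: insert_commute)

lemma par_refl: "p \<in> V \<Longrightarrow> par p p"
  by (simp add: par_def)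

lemma not_par: "p \<in> V \<Longrightarrow> q \<in> V \<Longrightarrow> \<not> par p q \<Longrightarrow> {p, q} \<in> H \<and> p \<noteq> q"
  by (auto simp: par_def)

text \<open>Otherwise the singleton face at \<open>p\<close> would extend by \<open>q\<close> to an
  edge.\<close>

lemma par_flat:
  assumes "par p q" "F \<in> L" "p \<in> F" shows "q \<in> F"
proof (rule ccontr)
  assume q: "q \<notin> F"
  have "p \<in> V" "q \<in> V" using assms(1) by (auto simp: par_def)
  then have "insert q {p} \<in> H"
    by - (rule L_extend[OF assms(2)], use assms(2,3) q vertex_face in \<open>auto\<close>)
  then show False using assms(1,3) q unfolding par_def by (metis insert_commute)
qed

lemma edge_split:
  assumes "{p, q} \<in> H" "p \<noteq> q" shows "\<exists>F\<in>L. (p \<in> F) \<noteq> (q \<in> F)"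
proof -
  obtain a F where "a \<in> {p, q}" "F \<in> L" "{p, q} - {a} \<subseteq> F" "a \<notin> F"
    using L_split[OF assms(1)] by blast
  then show ?thesis using assms(2) by blast
qed

lemma edge_not_par: "{p, q} \<in> H \<Longrightarrow> p \<noteq> q \<Longrightarrow> \<not> par p q"
  by (simp add: par_def)

text \<open>The ends of an edge are separated by a flat, whereas parallel vertices lie in the same
  flats.\<close>

lemma par_trans:
  assumes "par p q" "par q r" shows "par p r"
proof (rule ccontr)
  assume "\<not> par p r"
  then obtain F where "F \<in> L" "(p \<in> F) \<noteq> (r \<in> F)"
    using assms not_par edge_split unfolding par_def by metis
  then show False using assms par_sym par_flat by metis
qed

text \<open>The parallel class of \<open>p\<close> is itself a flat. It is proper because it cannot
  contain both ends of an edge of the given triangle.\<close>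

lemma par_adj:
  assumes "par p q" "p \<noteq> q" shows "adj p q"
proof -
  let ?F = "{q \<in> V. q = p \<or> {p, q} \<notin> H}"
  obtain u v w where uv: "u \<noteq> v" "{u, v, w} \<in> H" using triangle by blast
  have "{u, v} \<in> H" by (rule face_subset[OF uv(2)]) auto
  have "\<not> (par p u \<and> par p v)"
    using edge_not_par[OF \<open>{u, v} \<in> H\<close> uv(1)] par_trans[of u p v] par_sym[of p u] by blast
  moreover have "u \<in> V" "v \<in> V" using edge_in_V[OF \<open>{u, v} \<in> H\<close>] by auto
  moreover have p: "p \<in> V" using assms(1) by (simp add: par_def)
  ultimately have F: "?F \<noteq> V" unfolding par_def by blast
  have "p \<in> ?F" "q \<in> ?F" using assms(1) by (simp_all add: par_def)
  with F have "?F \<noteq> V \<and> p \<in> ?F \<and> q \<in> ?F" by (intro conjI)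
  then show ?thesis unfolding adj_def using assms(2) bexI[OF _ L_class[OF p]] by (intro conjI) assumption+
qed

lemma adj_par:
  assumes "adj p q" "par q r" "p \<noteq> r" shows "adj p r"
  using assms par_flat unfolding adj_def by blast

section \<open>Connected components of the graph of flats\<close>

lemma conn_refl: "p \<in> V \<Longrightarrow> conn p p"
  by (simp add: conn_def)

lemma conn_trans: "conn p q \<Longrightarrow> conn q r \<Longrightarrow> conn p r"
  unfolding conn_def by (auto intro: rtrancl_trans)

lemma conn_sym: "conn p q \<Longrightarrow> conn q p"
proof -
  have "sym ({(p, q). adj p q}\<^sup>*)" by (rule sym_rtrancl) (auto simp: sym_def intro: adj_sym)
  then show "conn p q \<Longrightarrow> conn q p" unfolding conn_def by (auto dest: symD)
qed

lemma adj_conn: "adj p q \<Longrightarrow> conn p q"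
  using adj_in_V by (auto simp: conn_def)

lemma par_conn: "par p q \<Longrightarrow> conn p q"
  using par_adj adj_conn conn_refl by (cases "p = q") (auto simp: par_def)

lemma conn_induct [consumes 1, case_names refl step]:
  assumes "conn p q" "Q p"
    and step: "\<And>x y. conn p x \<Longrightarrow> adj x y \<Longrightarrow> Q x \<Longrightarrow> Q y"
  shows "Q q"
proof -
  have "p \<in> V" "(p, q) \<in> {(p, q). adj p q}\<^sup>*" using assms(1) by (auto simp: conn_def)
  from this(2) have "conn p q \<and> Q q"
  proof induction
    case base
    then show ?case using assms(2) conn_refl[OF \<open>p \<in> V\<close>] by simp
  next
    case (step y z)
    then show ?case using assms(3) adj_conn conn_trans by blast
  qed
  then show ?thesis by blast
qed

lemma not_conn_edge: "p \<in> V \<Longrightarrow> q \<in> V \<Longrightarrow> \<not> conn p q \<Longrightarrow> {p, q} \<in> H \<and> p \<noteq> q"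
  using not_par par_conn by blast

lemma comp_of_eq: "conn u v \<Longrightarrow> comp_of u = comp_of v"
  using conn_trans conn_sym by blast

text \<open>If all neighbours of \<open>p\<close> were parallel to it, induction along paths would
  put the whole component into one parallel class, which contains no edge.\<close>

lemma nontriv_neighbour:
  assumes "nontriv (comp_of p)" "p \<in> V"
  shows "\<exists>n. adj p n \<and> \<not> par p n"
proof (rule ccontr)
  assume *: "\<not> (\<exists>n. adj p n \<and> \<not> par p n)"
  have par: "par p q" if "conn p q" for q
    using that
  proof (induction rule: conn_induct)
    case refl
    then show ?case using par_refl assms(2) by simp
  next
    case (step x y)
    then have "adj p y \<or> p = y" using adj_par adj_sym par_sym by metis
    then show ?case using * par_refl assms(2) by blast
  qed
  obtain u v where "conn p u" "conn p v" "u \<noteq> v" "{u, v} \<in> H"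
    using assms(1) by (auto simp: nontriv_def)
  then show False using par edge_not_par par_sym par_trans by metis
qed

text \<open>A flat that splits off one vertex contains the other two and is proper.\<close>

lemma triangle_adj:
  assumes "{u, v, w} \<in> H" "u \<noteq> v" "u \<noteq> w" "v \<noteq> w"
  shows "adj u v \<or> adj u w \<or> adj v w"
proof -
  obtain a F where a: "a \<in> {u, v, w}" "F \<in> L" "{u, v, w} - {a} \<subseteq> F" "a \<notin> F"
    using L_split[OF assms(1)] by blast
  moreover have "a \<in> V" using a(1) face_carrier[OF assms(1)] by blast
  ultimately have "F \<noteq> V" by blast
  then show ?thesis using a assms(2-4) unfolding adj_def by blast
qed

lemma adj_edge_nontriv: "adj p q \<Longrightarrow> {p, q} \<in> H \<Longrightarrow> nontriv (comp_of p)"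
  using adj_conn conn_refl adj_in_V unfolding nontriv_def adj_def by blast

lemma ex_nontriv: "\<exists>p\<in>V. nontriv (comp_of p)"
proof -
  obtain u v w where uvw: "u \<noteq> v" "u \<noteq> w" "v \<noteq> w" "{u, v, w} \<in> H" using triangle by blast
  have "{u, v} \<in> H" "{u, w} \<in> H" "{v, w} \<in> H" by (rule face_subset[OF uvw(4)], auto)+
  then show ?thesis using triangle_adj[OF uvw(4,1-3)] adj_edge_nontriv edge_in_V by blast
qed

end

text \<open>
  Vertices parallel to \<open>z\<close> have no edge to \<open>z\<close>, so they are normalised through \<open>w\<close> instead.
\<close>

locale normalized_cocycle = flat_complex V H L + complex_cocycle V H G \<gamma>
  for V :: "'v set" and H :: "'v set set" and L and G (structure) and \<gamma> +
  fixes z w :: 'v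
  assumes z: "z \<in> V" and w: "w \<in> V" and zw: "\<not> par z w"
    and norm_z: "v \<in> V \<Longrightarrow> \<not> par z v \<Longrightarrow> \<gamma> z v = \<one>"
    and norm_w: "par z v \<Longrightarrow> \<gamma> w v = \<one>"
begin

text \<open>For \<open>y\<close> outside \<open>F\<close>, faces of size at most two in
  \<open>F\<close> extend by \<open>y\<close>. Coning from \<open>y\<close> thus makes the cocycle a
  coboundary on \<open>F\<close>, with potential \<open>\<gamma> y u\<close> at
  \<open>u\<close>.\<close>

lemma proper_flat_potential:
  assumes F: "F \<in> L" "F \<noteq> V"
  obtains \<kappa> where "\<And>u. u \<in> F \<Longrightarrow> \<kappa> u \<in> carrier G"
    "\<And>u v. u \<in> F \<Longrightarrow> v \<in> F \<Longrightarrow> {u, v} \<in> H \<Longrightarrow> \<kappa> u \<otimes> \<gamma> u v = \<kappa> v"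
proof -
  obtain y where y: "y \<in> V - F" using F L_subset by blast
  show thesis
  proof (rule that)
    fix u assume u: "u \<in> F"
    then have "{u} \<in> H" using L_subset F(1) vertex_face by blast
    then have "insert y {u} \<in> H" by - (rule L_extend[OF F(1)], use u y in \<open>auto\<close>)
    then show "\<gamma> y u \<in> carrier G" by (rule g_closed)
    fix v assume "v \<in> F" "{u, v} \<in> H"
    then have "insert y {u, v} \<in> H" by - (rule L_extend[OF F(1)], use u y in \<open>auto simp: card_insert_if\<close>)
    then show "\<gamma> y u \<otimes> \<gamma> u v = \<gamma> y v" by (rule g_mult)
  qed
qed

text \<open>The triangle rule holds although \<open>{x, p, q}\<close> need not be a face. If
  \<open>x\<close> lies outside the common flat, it is one; otherwise the potential on that flat
  gives the relation.\<close>

lemma adj_edge_mult: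
  assumes "adj p q" "{p, q} \<in> H" "{x, p} \<in> H" "{x, q} \<in> H"
  shows "\<gamma> x p \<otimes> \<gamma> p q = \<gamma> x q"
proof -
  obtain F where F: "F \<in> L" "F \<noteq> V" "p \<in> F" "q \<in> F" using assms(1) by (auto simp: adj_def)
  have x: "x \<in> V" using assms(3) edge_in_V by blast
  show ?thesis
  proof (cases "x \<in> F")
    case False
    then have "insert x {p, q} \<in> H"
      by - (rule L_extend[OF F(1)], use F assms(2) x in \<open>auto simp: card_insert_if\<close>)
    then show ?thesis by (rule g_mult)
  next
    case True
    obtain \<kappa> where \<kappa>: "\<And>u. u \<in> F \<Longrightarrow> \<kappa> u \<in> carrier G"
      "\<And>u v. u \<in> F \<Longrightarrow> v \<in> F \<Longrightarrow> {u, v} \<in> H \<Longrightarrow> \<kappa> u \<otimes> \<gamma> u v = \<kappa> v"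
      using proper_flat_potential[OF F(1,2)] by blast
    have c: "\<kappa> x \<in> carrier G" "\<gamma> x p \<in> carrier G" "\<gamma> p q \<in> carrier G" "\<gamma> x q \<in> carrier G"
      using \<kappa>(1)[OF True] assms g_closed by auto
    have "\<kappa> x \<otimes> (\<gamma> x p \<otimes> \<gamma> p q) = \<kappa> x \<otimes> \<gamma> x q"
      using \<kappa>(2)[of x p] \<kappa>(2)[of p q] \<kappa>(2)[of x q] True F assms c by (simp add: m_assoc[symmetric])
    then show ?thesis using c by simp
  qed
qed

text \<open>The flat contains \<open>z\<close> along with \<open>p\<close>. If it contains
  \<open>w\<close>, the potential is carried unchanged from \<open>z\<close> to \<open>q\<close> and
  through \<open>w\<close> to \<open>p\<close>. If not, \<open>w\<close> cones off the edges from
  \<open>q\<close> to \<open>z\<close> and to \<open>p\<close>, and both triangles determine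
  \<open>\<gamma> w q\<close>.\<close>

lemma adj_edge_trivial_aux:
  assumes "adj p q" "{p, q} \<in> H" "par z p" "\<not> par z q"
  shows "\<gamma> p q = \<one>"
proof -
  obtain F where F: "F \<in> L" "F \<noteq> V" "p \<in> F" "q \<in> F" using assms(1) by (auto simp: adj_def)
  have pq: "p \<in> V" "q \<in> V" using edge_in_V[OF assms(2)] by auto
  have zF: "z \<in> F" using par_flat[OF par_sym[OF assms(3)] F(1,3)] .
  have wp: "\<not> par w p" using zw assms(3) par_trans par_sym by metis
  have H: "{z, q} \<in> H" "{z, w} \<in> H" "{w, z} \<in> H" "{w, p} \<in> H"
    using not_par[OF z pq(2) assms(4)] not_par[OF z w zw] not_par[OF w pq(1) wp]
    by (simp_all add: insert_commute)
  have 1: "\<gamma> z w = \<one>" "\<gamma> z q = \<one>" "\<gamma> w p = \<one>" "\<gamma> w z = \<one>"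
    using norm_z[OF w zw] norm_z[OF pq(2) assms(4)] norm_w[OF assms(3)] norm_w[OF par_refl[OF z]] by auto
  have c: "\<gamma> p q \<in> carrier G" "\<gamma> w q \<in> carrier G" if "{w, q} \<in> H"
    using that assms(2) g_closed by auto
  show ?thesis
  proof (cases "w \<in> F")
    case True
    obtain \<kappa> where \<kappa>: "\<And>u. u \<in> F \<Longrightarrow> \<kappa> u \<in> carrier G"
      "\<And>u v. u \<in> F \<Longrightarrow> v \<in> F \<Longrightarrow> {u, v} \<in> H \<Longrightarrow> \<kappa> u \<otimes> \<gamma> u v = \<kappa> v"
      using proper_flat_potential[OF F(1,2)] by blast
    have "\<kappa> z = \<kappa> w" "\<kappa> w = \<kappa> p" "\<kappa> z = \<kappa> q"
      using \<kappa>(2)[of z w] \<kappa>(2)[of w p] \<kappa>(2)[of z q] H 1 \<kappa>(1) zF True F by auto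
    then have "\<kappa> p \<otimes> \<gamma> p q = \<kappa> p" using \<kappa>(2)[of p q] F assms(2) by simp
    then show ?thesis using \<kappa>(1)[OF F(3)] g_closed[OF assms(2)] by simp
  next
    case False
    then have wF: "w \<in> V - F" using w by blast
    have "insert w {z, q} \<in> H"
      by (rule L_extend[OF F(1) H(1) _ _ wF]) (use zF F(4) in \<open>auto simp: card_insert_if\<close>)
    then have "\<gamma> w z \<otimes> \<gamma> z q = \<gamma> w q" by (rule g_mult)
    then have wq: "\<gamma> w q = \<one>" using 1 by simp
    have "insert w {p, q} \<in> H"
      by (rule L_extend[OF F(1) assms(2) _ _ wF]) (use F(3,4) in \<open>auto simp: card_insert_if\<close>)
    then have "\<gamma> w p \<otimes> \<gamma> p q = \<gamma> w q" by (rule g_mult)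
    then show ?thesis using 1(3) wq g_closed[OF assms(2)] by simp
  qed
qed

text \<open>At most one end of an edge is parallel to \<open>z\<close>. If neither is, the triangle
  rule with \<open>z\<close> decides; otherwise the normalisation through \<open>w\<close> takes
  over.\<close>

lemma adj_edge_trivial:
  assumes "adj p q" "{p, q} \<in> H"
  shows "\<gamma> p q = \<one>"
proof -
  have pq: "p \<in> V" "q \<in> V" "p \<noteq> q" using edge_in_V[OF assms(2)] assms(1) by (auto simp: adj_def)
  then have npar: "\<not> par p q" using assms(2) by (simp add: par_def)
  consider "\<not> par z p" "\<not> par z q" | "par z p" "\<not> par z q" | "\<not> par z p" "par z q"
    using npar par_sym par_trans by metis
  then show ?thesis
  proof cases
    case 1
    then have "\<gamma> z p \<otimes> \<gamma> p q = \<gamma> z q"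
      using assms not_par z pq by (intro adj_edge_mult) auto
    then show ?thesis using norm_z pq 1 g_closed[OF assms(2)] by simp
  next
    case 2
    then show ?thesis using adj_edge_trivial_aux assms by blast
  next
    case 3
    have "{q, p} \<in> H" using assms(2) by (simp add: insert_commute)
    then have "\<gamma> q p = \<one>" using adj_edge_trivial_aux 3 adj_sym[OF assms(1)] by blast
    then show ?thesis using g_inverse[OF \<open>{q, p} \<in> H\<close>] by simp
  qed
qed

text \<open>Induction along a path of the graph of flats. Its vertices may be parallel to
  \<open>p\<close> or to their predecessor and then span no edge with it, so the claim is made for
  all \<open>r\<close> parallel to the current vertex, with \<open>par p r\<close> as an alternative
  outcome.\<close>

lemma conn_edge_trivial:
  assumes "conn p q" "{p, q} \<in> H"
  shows "\<gamma> p q = \<one>"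
proof (cases "p = q")
  case True
  then show ?thesis using assms(2) g_self by simp
next
  case False
  have p: "p \<in> V" using edge_in_V[OF assms(2)] by blast
  have "\<forall>r. par q r \<longrightarrow> par p r \<or> \<gamma> p r = \<one>"
    using assms(1)
  proof (induction rule: conn_induct)
    case refl
    then show ?case by blast
  next
    case (step x y)
    show ?case
    proof (intro allI impI)
      fix r assume r: "par y r"
      show "par p r \<or> \<gamma> p r = \<one>"
      proof (cases "par p r \<or> par x y")
        case True
        then show ?thesis using step.IH r par_trans by blast
      next
        case False
        have V: "x \<in> V" "r \<in> V" using adj_in_V[OF step.hyps(2)] r by (auto simp: par_def)
        have "\<not> par x r" using False r par_sym par_trans by metis
        then have xr: "adj x r" "{x, r} \<in> H"
          using adj_par[OF step.hyps(2) r] not_par[OF V] by auto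
        have pr: "{p, r} \<in> H" "p \<noteq> r" using not_par[OF p V(2)] False by auto
        show ?thesis
        proof (cases "par p x")
          case True
          then have "adj p r" using adj_par[OF adj_sym[OF xr(1)] par_sym] pr(2) adj_sym by blast
          then show ?thesis using adj_edge_trivial pr(1) by blast
        next
          case npx: False
          then have "\<gamma> p x = \<one>" "{p, x} \<in> H"
            using step.IH par_refl[OF V(1)] not_par[OF p V(1)] by auto
          moreover from this(2) have "\<gamma> p x \<otimes> \<gamma> x r = \<gamma> p r"
            using adj_edge_mult[OF xr _ pr(1)] by blast
          moreover have "\<gamma> x r = \<one>" using adj_edge_trivial[OF xr] .
          ultimately show ?thesis by simp
        qed
      qed
    qed
  qed
  moreover have "par q q" "\<not> par p q" using edge_in_V[OF assms(2)] False assms(2) by (auto simp: par_def)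
  ultimately show ?thesis by blast
qed

text \<open>Neighbours that span an edge are compared by the triangle rule, that edge being trivial.
  Parallel neighbours are both compared with a common neighbour, which exists because the component
  is nontrivial.\<close>

lemma edge_to_nontriv:
  assumes "nontriv (comp_of p)" "conn p q" "y \<in> V" "\<not> conn p y"
  shows "\<gamma> y p = \<gamma> y q"
proof -
  have edge: "{y, u} \<in> H" if "conn p u" for u
  proof -
    have "\<not> conn y u" using that assms(4) conn_sym conn_trans by metis
    then show ?thesis using not_conn_edge[OF assms(3)] that by (auto simp: conn_def)
  qed
  have eq: "\<gamma> y u = \<gamma> y v" if "conn p u" "adj u v" "{u, v} \<in> H" for u v
  proof -
    have "conn p v" using that adj_conn conn_trans by blast
    then have "\<gamma> y u \<otimes> \<gamma> u v = \<gamma> y v" using adj_edge_mult edge that by blast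
    then show ?thesis using adj_edge_trivial[OF that(2,3)] g_closed[OF edge[OF that(1)]] by simp
  qed
  show ?thesis
    using assms(2)
  proof (induction rule: conn_induct)
    case refl
    then show ?case ..
  next
    case (step u v)
    have V: "u \<in> V" "v \<in> V" using adj_in_V[OF step.hyps(2)] by auto
    show ?case
    proof (cases "par u v")
      case False
      then show ?thesis using eq[OF step.hyps] step.IH not_par[OF V] by simp
    next
      case True
      have "nontriv (comp_of u)" using assms(1) comp_of_eq[OF step.hyps(1)] by simp
      then obtain n where n: "adj u n" "\<not> par u n" using nontriv_neighbour V(1) by blast
      have "\<not> par v n" using True n(2) par_trans by blast
      then have "{u, n} \<in> H" "{v, n} \<in> H" "v \<noteq> n"
        using n not_par V adj_in_V[OF n(1)] by auto
      moreover have "adj v n"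
        using adj_par[OF adj_sym[OF n(1)] True] \<open>v \<noteq> n\<close> adj_sym by blast
      moreover have "conn p v" using step.hyps adj_conn conn_trans by blast
      ultimately have "\<gamma> y u = \<gamma> y n" "\<gamma> y v = \<gamma> y n" using eq step.hyps(1) n(1) by auto
      then show ?thesis using step.IH by simp
    qed
  qed
qed

end

section \<open>The free basis\<close>

context flat_complex
begin

text \<open>The quotient map of the contraction. For connected vertices the predicates
  \<open>conn v\<close> coincide, so the choice is constant on a nontrivial component.\<close>

definition rep :: "'v \<Rightarrow> 'v" where
  "rep v = (if nontriv (comp_of v) then SOME u. conn v u else v)"

lemma rep_conn: "v \<in> V \<Longrightarrow> conn v (rep v)"
  unfolding rep_def using someI[of "conn v" v] conn_refl by auto

lemma rep_in: "v \<in> V \<Longrightarrow> rep v \<in> V"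
  using rep_conn by (auto simp: conn_def)

lemma rep_eq: "conn u v \<Longrightarrow> nontriv (comp_of u) \<Longrightarrow> rep u = rep v"
proof -
  assume c: "conn u v" and n: "nontriv (comp_of u)"
  have "conn u = conn v" using comp_of_eq[OF c] by (simp add: set_eq_iff fun_eq_iff)
  then show ?thesis using n by (simp add: rep_def)
qed

lemma rep_trivial: "\<not> nontriv (comp_of v) \<Longrightarrow> rep v = v"
  by (simp add: rep_def)

lemma rep_rep: "v \<in> V \<Longrightarrow> rep (rep v) = rep v"
  using rep_eq[OF rep_conn, of v] rep_trivial[of v] by fastforce

lemma conn_rep_iff: "u \<in> V \<Longrightarrow> v \<in> V \<Longrightarrow> conn (rep u) (rep v) \<longleftrightarrow> conn u v"
  using rep_conn[of u] rep_conn[of v] conn_sym conn_trans by meson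

text \<open>Triangles degenerate under contraction. Hence any assignment to the oriented edges of
  the contracted graph that is trivial on loops and inverts under reversal pulls back to a
  cocycle.\<close>

lemma rep_triangle:
  assumes "{u, v, w} \<in> H"
  shows "rep u = rep v \<or> rep u = rep w \<or> rep v = rep w"
proof (cases "u = v \<or> u = w \<or> v = w")
  case False
  have "{u, v} \<in> H" "{u, w} \<in> H" "{v, w} \<in> H" by (rule face_subset[OF assms], auto)+
  then show ?thesis
    using triangle_adj[OF assms] False adj_edge_nontriv rep_eq adj_conn by blast
qed auto

text \<open>
  After contraction of the nontrivial components the star of \<open>rep z\<close> is a spanning tree, and these are
  the edges outside it.
\<close>

definition gen_edges :: "'v \<Rightarrow> 'v set set" where
  "gen_edges z = {{x, y} |x y. x \<in> rep ` V - {rep z} \<and> y \<in> rep ` V - {rep z} \<and> \<not> conn x y}"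

lemma finite_V: "finite V"
  using complex by (simp add: abstract_simplicial_complex_def)

lemma finite_gen_edges: "finite (gen_edges z)"
proof (rule finite_subset)
  show "gen_edges z \<subseteq> Pow V" using rep_in by (auto simp: gen_edges_def)
qed (simp add: finite_V)

end

text \<open>The vertex \<open>v0\<close> comes from the base point and plays the role of
  \<open>w\<close> in the normalisation; as it is not parallel to \<open>z\<close>, an edge leads
  from it to the root.\<close>

locale based_flat_complex = flat_complex V H L
  for V :: "'v set" and H :: "'v set set" and L +
  fixes a :: "'v \<Rightarrow> real" and v0 z :: 'v
  assumes base: "a \<in> X" "a v0 \<noteq> 0" and z: "z \<in> V" "nontriv (comp_of z)" "\<not> par z v0"
begin

text \<open>Designed so that edges from \<open>z\<close> to vertices not parallel to it, and from
  \<open>v0\<close> to vertices parallel to \<open>z\<close>, get a trivial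
  \<open>edge_class\<close>. Since \<open>v0\<close> is of the former kind, its tail makes a detour
  through \<open>z\<close> that contracts to the spoke.\<close>

definition tail :: "'v \<Rightarrow> real \<Rightarrow> 'v \<Rightarrow> real" where
  "tail v = (if par z v then straight a (vertex_point v0) +++ straight (vertex_point v0) (vertex_point v)
     else (straight a (vertex_point v0) +++ straight (vertex_point v0) (vertex_point z)) +++
       straight (vertex_point z) (vertex_point v))"

lemma v0: "v0 \<in> V"
  using face_carrier[OF support_face[OF base(1)]] base(2) by blast

lemma v0z_edge: "{v0, z} \<in> H"
  using not_par[OF z(1) v0 z(3)] by (simp add: insert_commute)

lemma v0_edge: "par z v \<Longrightarrow> {v0, v} \<in> H"
  using not_par[OF v0, of v] z(3) par_trans par_sym unfolding par_def by metis

lemma tail_z: "tail z = straight a (vertex_point v0) +++ straight (vertex_point v0) (vertex_point z)"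
  using par_refl[OF z(1)] by (simp add: tail_def)

lemma tail_paths_in:
  assumes "v \<in> V" shows "tail v \<in> paths_in X a (vertex_point v)"
proof (cases "par z v")
  case True
  then show ?thesis
    using paths_in_join[OF spoke_path[OF base] edge_path[OF v0_edge]] by (simp add: tail_def)
next
  case False
  then show ?thesis
    using paths_in_join[OF paths_in_join[OF spoke_path[OF base] edge_path[OF v0z_edge]] edge_path]
      not_par[OF z(1) assms] by (simp add: tail_def)
qed

lemma tail_v0: "homotopic_paths X (straight a (vertex_point v0)) (tail v0)"
proof -
  let ?e = "\<lambda>v w. straight (vertex_point v) (vertex_point w)"
  note paths = spoke_path[OF base] edge_path[OF v0z_edge] edge_path[of z v0] v0z_edge
  have zv0: "{z, v0} \<in> H" using v0z_edge by (simp add: insert_commute)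
  have "homotopic_paths X (straight a (vertex_point v0) +++ ?e v0 v0) (straight a (vertex_point v0))"
    using homotopic_paths_spoke_edge[OF base(1) _ base(2), of v0] support_face[OF base(1)] base(2)
    by (simp add: insert_absorb)
  moreover have "homotopic_paths X (?e v0 z +++ ?e z v0) (?e v0 v0)"
    using homotopic_paths_edge_edge[of v0 z v0] v0z_edge by (simp add: insert_commute)
  then have "homotopic_paths X (straight a (vertex_point v0) +++ (?e v0 z +++ ?e z v0))
      (straight a (vertex_point v0) +++ ?e v0 v0)"
    by (rule homotopic_paths_join_right) (use paths in \<open>auto simp: paths_in_def\<close>)
  moreover have "homotopic_paths X (straight a (vertex_point v0) +++ (?e v0 z +++ ?e z v0))
      ((straight a (vertex_point v0) +++ ?e v0 z) +++ ?e z v0)"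
    by (rule homotopic_paths_assoc) (use paths zv0 in \<open>auto simp: paths_in_def\<close>)
  ultimately show ?thesis
    unfolding tail_def using z(3) homotopic_paths_sym homotopic_paths_trans
    by (smt (verit, best))
qed

sublocale based_complex V H a v0 tail
  using base tail_paths_in tail_v0 by unfold_locales

lemma edge_class_tail:
  assumes "tail w = tail v +++ straight (vertex_point v) (vertex_point w)" "w \<in> V"
  shows "edge_class v w = \<one>\<^bsub>P\<^esub>"
  unfolding edge_class_def assms(1)[symmetric]
  by (rule return_class_self[OF _ tail_paths_in[OF assms(2)]])
    (use tail_paths_in[OF assms(2)] in \<open>simp add: paths_in_def\<close>)

sublocale normalized: normalized_cocycle V H L P edge_class z v0
proof unfold_locales
  show "z \<in> V" "v0 \<in> V" "\<not> par z v0" using z v0 by auto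
  fix v assume v: "v \<in> V" "\<not> par z v"
  then have "tail v = tail z +++ straight (vertex_point z) (vertex_point v)"
    unfolding tail_z by (simp add: tail_def)
  then show "edge_class z v = \<one>\<^bsub>P\<^esub>" using edge_class_tail v by blast
next
  fix v assume v: "par z v"
  let ?s = "straight a (vertex_point v0)" and ?e = "straight (vertex_point v0) (vertex_point v)"
  have V: "v \<in> V" using v by (simp add: par_def)
  have "homotopic_paths X (tail v0 +++ ?e) (?s +++ ?e)"
    by (rule homotopic_paths_join_left[OF homotopic_paths_sym[OF tail_v0]])
      (use tail_paths_in[OF v0] edge_path[OF v0_edge[OF v]] in \<open>auto simp: paths_in_def\<close>)
  moreover have "?s +++ ?e = tail v" using v by (simp add: tail_def)
  ultimately show "edge_class v0 v = \<one>\<^bsub>P\<^esub>"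
    unfolding edge_class_def using return_class_self[OF _ tail_paths_in[OF V]] by simp
qed

text \<open>The second end moves by \<open>edge_to_nontriv\<close>, and \<open>rep\<close> fixes it
  in a trivial component; the first end moves likewise after reversing the edge.\<close>

lemma edge_class_rep:
  assumes "u \<in> V" "v \<in> V" "\<not> conn u v"
  shows "edge_class u v = edge_class (rep u) (rep v)"
proof -
  have flip: "edge_class y x = edge_class y' x"
    if "x \<in> V" "conn y y'" "\<not> conn x y" "edge_class x y = edge_class x y'" for x y y'
  proof -
    have "\<not> conn x y'" using that(2,3) conn_sym conn_trans by blast
    then have "{x, y} \<in> H" "{x, y'} \<in> H"
      using that not_conn_edge unfolding conn_def by blast+
    then show ?thesis using edge.g_inverse that(4) by simp
  qed
  have right: "edge_class x y = edge_class x (rep y)" if "x \<in> V" "y \<in> V" "\<not> conn x y" for x y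
  proof (cases "nontriv (comp_of y)")
    case True
    then show ?thesis
      using normalized.edge_to_nontriv[OF True rep_conn[OF that(2)] that(1)] that(3) conn_sym by blast
  qed (simp add: rep_trivial)
  have nc: "\<not> conn v u" "\<not> conn (rep v) u"
    using assms conn_sym conn_trans rep_conn by blast+
  have "edge_class u v = edge_class (rep u) v"
    by (rule flip[OF assms(2) rep_conn[OF assms(1)] nc(1) right[OF assms(2,1) nc(1)]])
  also have "\<dots> = edge_class (rep u) (rep v)"
    using right[of "rep u" v] assms rep_in conn_sym conn_trans rep_conn by meson
  finally show ?thesis .
qed

text \<open>These are the tree edges of the contracted graph. After \<open>u\<close> is moved to
  \<open>z\<close> the normalisation applies, because a vertex of another component is not parallel
  to \<open>z\<close>.\<close>

lemma edge_class_root: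
  assumes "v \<in> V" "rep u = rep z" "\<not> conn u v" "u \<in> V"
  shows "edge_class u v = \<one>\<^bsub>P\<^esub>"
proof -
  have uz: "conn u z" using assms rep_conn[of u] rep_conn[OF z(1)] conn_sym conn_trans by metis
  then have zv: "\<not> conn z v" using assms(3) conn_trans by blast
  have "edge_class u v = edge_class z v"
    using edge_class_rep[OF assms(4,1,3)] edge_class_rep[OF z(1) assms(1) zv] assms(2) by simp
  also have "\<dots> = \<one>\<^bsub>P\<^esub>" using normalized.norm_z[OF assms(1)] zv par_conn by blast
  finally show ?thesis .
qed

text \<open>A generator is the number of an edge off the tree, and the boolean of a letter records
  the direction. The cocycle \<open>g\<close> sends an edge to the letter of its contracted image,
  or to the empty word if that image is a point or a tree edge; \<open>f\<close> sends a generator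
  back to the \<open>edge_class\<close> of its edge taken in positive direction.\<close>

theorem fundamental_group_free: "P \<cong> free_group {..<card (gen_edges z)}"
proof -
  define n where "n = card (gen_edges z)"
  define F where "F = free_group {..<n}"
  define Q where "Q = rep ` V - {rep z}"
  obtain b where b: "bij_betw b (gen_edges z) {..<n}"
    using ex_bij_betw_finite_nat[OF finite_gen_edges] unfolding n_def atLeast0LessThan by blast
  \<comment> \<open>An arbitrary numbering of the vertices, which orients the generating
    edges.\<close>
  obtain idx :: "'v \<Rightarrow> nat" where idx: "inj_on idx V"
    using ex_bij_betw_finite_nat[OF finite_V] unfolding bij_betw_def by blast
  have Q_V: "Q \<subseteq> V" using rep_in by (auto simp: Q_def)
  have gen: "gen_edges z = {{x, y} |x y. x \<in> Q \<and> y \<in> Q \<and> \<not> conn x y}"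
    by (simp add: gen_edges_def Q_def)
  have "\<exists>x y. x \<in> Q \<and> y \<in> Q \<and> \<not> conn x y \<and> idx x < idx y \<and> b {x, y} = i" if "i < n" for i
  proof -
    have "i \<in> b ` gen_edges z" using b that by (simp add: bij_betw_def)
    then obtain x y where xy: "x \<in> Q" "y \<in> Q" "\<not> conn x y" "b {x, y} = i"
      unfolding gen by blast
    have "x \<noteq> y" using xy Q_V conn_refl by blast
    then have "idx x \<noteq> idx y" using idx xy Q_V by (meson inj_onD subsetD)
    then consider "idx x < idx y" | "idx y < idx x" by linarith
    then show ?thesis
    proof cases
      case 2
      have "\<not> conn y x" "b {y, x} = i" using xy conn_sym by (auto simp: insert_commute)
      then show ?thesis using 2 xy(1,2) by blast
    qed (use xy in blast)
  qed
  then obtain lo hi where lohi: "\<And>i. i < n \<Longrightarrow> lo i \<in> Q \<and> hi i \<in> Q \<and> \<not> conn (lo i) (hi i) \<and>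
      idx (lo i) < idx (hi i) \<and> b {lo i, hi i} = i"
    by metis
  define g' where "g' x y = (if conn x y \<or> x = rep z \<or> y = rep z then [] else [(idx x < idx y, b {x, y})])" for x y
  define g where "g u v = g' (rep u) (rep v)" for u v
  define f where "f i = edge_class (lo i) (hi i)" for i
  interpret F: group F unfolding F_def by (rule group_free_group)
  have b_in: "b {rep u, rep v} < n" if "u \<in> V" "v \<in> V" "\<not> conn (rep u) (rep v)" "rep u \<noteq> rep z" "rep v \<noteq> rep z" for u v
  proof -
    have "{rep u, rep v} \<in> gen_edges z" unfolding gen Q_def using that by blast
    then show ?thesis using b by (auto simp: bij_betw_def)
  qed
  have g_carrier: "g u v \<in> carrier F" if "u \<in> V" "v \<in> V" for u v
    using b_in[OF that] by (auto simp: g_def g'_def F_def free_group_def)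
  have g_inv: "g u v \<otimes>\<^bsub>F\<^esub> g v u = []" if "u \<in> V" "v \<in> V" for u v
  proof -
    have "idx (rep u) < idx (rep v) \<longleftrightarrow> \<not> idx (rep v) < idx (rep u)" if "\<not> conn (rep u) (rep v)"
    proof -
      have "rep u \<noteq> rep v" using that conn_refl rep_in \<open>u \<in> V\<close> by metis
      then have "idx (rep u) \<noteq> idx (rep v)" using idx rep_in \<open>u \<in> V\<close> \<open>v \<in> V\<close> by (meson inj_onD)
      then show ?thesis by linarith
    qed
    then show ?thesis
      using conn_sym[of "rep u" "rep v"] conn_sym[of "rep v" "rep u"]
      by (auto simp: g_def g'_def F_def free_group_def insert_commute)
  qed
  have "cocycle F H g"
    unfolding cocycle_def
  proof (intro allI impI conjI)
    fix u v w assume uvw: "{u, v, w} \<in> H"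
    then have V: "u \<in> V" "v \<in> V" "w \<in> V" using face_carrier[OF uvw] by auto
    show "g u v \<in> carrier F" using g_carrier V by blast
    have refl: "g' (rep x) (rep x) = \<one>\<^bsub>F\<^esub>" if "x \<in> V" for x
      using conn_refl[OF rep_in[OF that]] by (simp add: g'_def F_def free_group_def)
    \<comment> \<open>The contracted triangle either has one of its first two sides collapsed or
      runs along one edge forth and back.\<close>
    from rep_triangle[OF uvw] consider "rep u = rep v" | "rep v = rep w" | "rep u = rep w" by blast
    then show "g u v \<otimes>\<^bsub>F\<^esub> g v w = g u w"
    proof cases
      case 1
      then show ?thesis using refl[OF V(1)] g_carrier[OF V(1,3)] by (simp add: g_def)
    next
      case 2
      then show ?thesis using refl[OF V(2)] g_carrier[OF V(1,2)] by (simp add: g_def)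
    next
      case 3
      then have "g v w = g v u" "g u w = \<one>\<^bsub>F\<^esub>" using refl[OF V(3)] by (simp_all add: g_def)
      then show ?thesis using g_inv[OF V(1,2)] by (simp add: F_def free_group_def)
    qed
  qed
  then interpret C: complex_cocycle V H F g
    by unfold_locales
  have f: "f \<in> {..<n} \<rightarrow> carrier P"
  proof
    fix i assume "i \<in> {..<n}"
    then have "{lo i, hi i} \<in> H" using lohi[of i] Q_V not_conn_edge by blast
    then show "f i \<in> carrier P" unfolding f_def by (rule edge.g_closed)
  qed
  have f_b: "f (b {x, y}) = edge_class x y" if "x \<in> Q" "y \<in> Q" "\<not> conn x y" "idx x < idx y" for x y
  proof -
    let ?i = "b {x, y}"
    have xy: "{x, y} \<in> gen_edges z" unfolding gen using that by blast
    then have i: "?i < n" using b by (auto simp: bij_betw_def)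
    have "{lo ?i, hi ?i} \<in> gen_edges z" unfolding gen using lohi[OF i] by blast
    then have "{lo ?i, hi ?i} = {x, y}"
      using lohi[OF i] b xy unfolding bij_betw_def by (meson inj_onD)
    then have "lo ?i = x \<and> hi ?i = y \<or> lo ?i = y \<and> hi ?i = x" by (simp add: doubleton_eq_iff)
    then have "lo ?i = x \<and> hi ?i = y" using lohi[OF i] that(4) by (metis less_asym)
    then show ?thesis by (simp add: f_def)
  qed
  have psi: "word_value P f (g u v) = edge_class u v" if uv: "{u, v} \<in> H" for u v
  proof -
    have V: "u \<in> V" "v \<in> V" using edge_in_V[OF uv] by auto
    have vu: "{v, u} \<in> H" using uv by (simp add: insert_commute)
    show ?thesis
    proof (cases "conn u v")
      case True
      then show ?thesis
        using normalized.conn_edge_trivial[OF True uv] conn_rep_iff[OF V] by (simp add: g_def g'_def)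
    next
      case nconn: False
      have nconn': "\<not> conn v u" using nconn conn_sym by blast
      consider "rep u = rep z" | "rep v = rep z" | "rep u \<in> Q" "rep v \<in> Q" using V by (auto simp: Q_def)
      then show ?thesis
      proof cases
        case 1
        then show ?thesis using edge_class_root[OF V(2) 1 nconn V(1)] by (simp add: g_def g'_def)
      next
        case 2
        then have "edge_class v u = \<one>\<^bsub>P\<^esub>" using edge_class_root[OF V(1) 2 nconn' V(2)] by simp
        then have "edge_class u v = \<one>\<^bsub>P\<^esub>" using edge.g_inverse[OF vu] by simp
        then show ?thesis using 2 by (simp add: g_def g'_def)
      next
        case 3
        have nc: "\<not> conn (rep u) (rep v)" "\<not> conn (rep v) (rep u)"
          using conn_rep_iff V nconn nconn' by auto
        have "rep u \<noteq> rep v" using nc conn_refl rep_in V by metis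
        then have "idx (rep u) \<noteq> idx (rep v)" using idx rep_in V by (meson inj_onD)
        have g_eq: "g u v = [(idx (rep u) < idx (rep v), b {rep u, rep v})]"
          using nc 3 by (simp add: g_def g'_def Q_def)
        have rH: "{rep v, rep u} \<in> H" using not_conn_edge[OF rep_in rep_in nc(2)] V by blast
        have c: "edge_class (rep u) (rep v) \<in> carrier P" "edge_class (rep v) (rep u) \<in> carrier P"
          using edge.g_closed[OF rH] edge.g_closed[of "rep u" "rep v"] rH by (auto simp: insert_commute)
        show ?thesis
        proof (cases "idx (rep u) < idx (rep v)")
          case True
          then show ?thesis
            using f_b[OF 3 nc(1) True] edge_class_rep[OF V nconn] c
            by (simp add: g_eq letter_value_def)
        next
          case False
          then have "idx (rep v) < idx (rep u)" using \<open>idx (rep u) \<noteq> idx (rep v)\<close> by linarith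
          then have "f (b {rep u, rep v}) = edge_class (rep v) (rep u)"
            using f_b[OF 3(2,1) nc(2)] by (simp add: insert_commute)
          then show ?thesis
            using False edge_class_rep[OF V nconn] edge.g_inverse[OF rH] c
            by (simp add: g_eq letter_value_def)
        qed
      qed
    qed
  qed
  have g_root: "g x v = \<one>\<^bsub>F\<^esub>" if "rep x = rep z \<or> rep v = rep z" for x v
    using that by (auto simp: g_def g'_def F_def free_group_def)
  have transport_edge: "C.transport (straight (vertex_point x) (vertex_point v)) x v (g x v)" if "{x, v} \<in> H" for x v
  proof (rule C.transport_star)
    fix t :: real
    show "insert x {u. straight (vertex_point x) (vertex_point v) t u \<noteq> 0} \<in> H"
      by (rule face_subset[OF that]) (auto simp: straight_def vertex_point_def split: if_splits)
  qed (use edge_path[OF that] in \<open>auto simp: paths_in_def\<close>)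
  have "C.transport (straight a (vertex_point v0)) v0 v0 (g v0 v0)"
  proof (rule C.transport_star)
    fix t :: real
    show "insert v0 {u. straight a (vertex_point v0) t u \<noteq> 0} \<in> H"
      by (rule face_subset[OF support_face[OF base(1)]])
        (use base(2) in \<open>auto simp: straight_def vertex_point_def\<close>)
  qed (use spoke_path[OF base] base(2) in \<open>auto simp: paths_in_def\<close>)
  then have spoke: "C.transport (straight a (vertex_point v0)) v0 v0 \<one>\<^bsub>F\<^esub>"
    using C.g_self[OF vertex_face[OF v0]] by simp
  have transport_root: "C.transport (straight a (vertex_point v0) +++ straight (vertex_point v0) (vertex_point v)) v0 v \<one>\<^bsub>F\<^esub>"
    if "par z v" for v
  proof -
    have "rep v = rep z" using rep_eq[OF par_conn[OF that] z(2)] by simp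
    then have "g v0 v = \<one>\<^bsub>F\<^esub>" using g_root by blast
    then show ?thesis
      using C.transport_join[OF spoke transport_edge[OF v0_edge[OF that]]] by simp
  qed
  have "C.transport (tail v) v0 v \<one>\<^bsub>F\<^esub>" if v: "v \<in> V" for v
  proof (cases "par z v")
    case True
    then show ?thesis using transport_root by (simp add: tail_def)
  next
    case False
    have "{z, v} \<in> H" using not_par[OF z(1) v False] by blast
    then show ?thesis
      using C.transport_join[OF transport_root[OF par_refl[OF z(1)]] transport_edge[of z v]] False g_root[of z v]
      by (simp add: tail_def)
  qed
  moreover have "carrier F \<subseteq> K" if K: "subgroup K F" "\<And>u v. {u, v} \<in> H \<Longrightarrow> g u v \<in> K" for K
    unfolding F_def
  proof (rule free_group_generated[OF K(1)[unfolded F_def]])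
    fix i assume "i \<in> {..<n}"
    then have i: "lo i \<in> Q" "hi i \<in> Q" "\<not> conn (lo i) (hi i)" "idx (lo i) < idx (hi i)" "b {lo i, hi i} = i"
      using lohi[of i] by auto
    have r: "rep (lo i) = lo i" "rep (hi i) = hi i" using i rep_rep by (auto simp: Q_def)
    have "g (lo i) (hi i) = [(True, i)]"
      using i r by (auto simp: g_def g'_def Q_def)
    moreover have "{lo i, hi i} \<in> H" using i not_conn_edge Q_V by blast
    ultimately show "[(True, i)] \<in> K" using K(2) by metis
  qed
  moreover have "word_value P f \<in> hom F P" unfolding F_def by (rule edge.word_value_hom[OF f])
  ultimately have "P \<cong> F"
    using fundamental_group_iso[OF C.complex_cocycle_axioms] psi by blast
  then show ?thesis by (simp add: F_def n_def)
qed

end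

section \<open>Counting the free generators\<close>

context flat_complex
begin

definition components :: "'v set set" where
  "components = comp_of ` V"

lemma component_eq: "C \<in> components \<Longrightarrow> u \<in> C \<Longrightarrow> C = comp_of u"
  unfolding components_def using comp_of_eq by blast

lemma component_unique: "C \<in> components \<Longrightarrow> D \<in> components \<Longrightarrow> u \<in> C \<Longrightarrow> u \<in> D \<Longrightarrow> C = D"
  using component_eq[of C u] component_eq[of D u] by simp

lemma component_subset: "C \<in> components \<Longrightarrow> C \<subseteq> V"
  by (auto simp: components_def conn_def)

lemma finite_components: "finite components"
  using finite_V by (simp add: components_def)

lemma rep_in_component: "C \<in> components \<Longrightarrow> u \<in> C \<Longrightarrow> rep u \<in> C"
  using component_eq component_subset rep_conn by blast

text \<open>Counts the vertices of the contracted graph. Since \<open>rep\<close> keeps every vertex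
  in its component, the images of different components are disjoint.\<close>

lemma card_rep: "card (rep ` V) =
    card {C \<in> components. nontriv C} + (\<Sum>C\<in>{C \<in> components. \<not> nontriv C}. card C)"
proof -
  have "\<Union>components = V" using component_subset conn_refl unfolding components_def by blast
  then have "rep ` V = (\<Union>C\<in>components. rep ` C)" by (metis image_Union)
  also have "card \<dots> = (\<Sum>C\<in>components. card (rep ` C))"
  proof (rule card_UN_disjoint)
    show "\<forall>C\<in>components. finite (rep ` C)"
      using finite_subset[OF component_subset finite_V] by blast
    show "\<forall>C\<in>components. \<forall>D\<in>components. C \<noteq> D \<longrightarrow> rep ` C \<inter> rep ` D = {}"
    proof (intro ballI impI)
      fix C D assume CD: "C \<in> components" "D \<in> components" "C \<noteq> D"
      then have "C \<inter> D = {}" using component_unique by blast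
      moreover have "rep ` C \<subseteq> C" "rep ` D \<subseteq> D" using rep_in_component CD(1,2) by auto
      ultimately show "rep ` C \<inter> rep ` D = {}" by blast
    qed
  qed (rule finite_components)
  also have "\<dots> = (\<Sum>C\<in>components. if nontriv C then 1 else card C)"
  proof (rule sum.cong[OF refl])
    fix C assume C: "C \<in> components"
    then obtain v where v: "v \<in> V" "C = comp_of v" by (auto simp: components_def)
    show "card (rep ` C) = (if nontriv C then 1 else card C)"
    proof (cases "nontriv C")
      case True
      then have "rep u = rep v" if "u \<in> C" for u using rep_eq[of v u] v that by simp
      moreover have "v \<in> C" using v conn_refl by simp
      ultimately have "rep ` C = {rep v}" by blast
      then show ?thesis using True by simp
    next
      case False
      then have "rep u = u" if "u \<in> C" for u using component_eq[OF C that] by (metis rep_trivial)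
      then show ?thesis using False by simp
    qed
  qed
  also have "\<dots> = (\<Sum>C\<in>{C \<in> components. nontriv C}. 1) + (\<Sum>C\<in>{C \<in> components. \<not> nontriv C}. card C)"
    using finite_components by (simp add: sum.If_cases Int_def Collect_neg_eq[symmetric])
  finally show ?thesis by simp
qed

text \<open>Pairs of contracted vertices other than the root either join different components and
  are generators, or lie in one component. The latter is then trivial, since a nontrivial one has a
  single representative. The root accounts for the \<open>- 1\<close>; the sum of pairs stands on
  the left to avoid a truncated difference.\<close>

lemma card_gen_edges:
  assumes z: "z \<in> V" "nontriv (comp_of z)"
  shows "card (gen_edges z) + (\<Sum>C\<in>{C \<in> components. \<not> nontriv C}. card C choose 2) =
    (card {C \<in> components. nontriv C} + (\<Sum>C\<in>{C \<in> components. \<not> nontriv C}. card C) - 1) choose 2"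
proof -
  define T where "T = {C \<in> components. \<not> nontriv C}"
  define Q where "Q = rep ` V - {rep z}"
  define pairs where "pairs A = {e. e \<subseteq> A \<and> card e = 2}" for A :: "'v set"
  have finT: "finite T" using finite_components by (simp add: T_def)
  have finC: "finite C" if "C \<in> T" for C
    using that finite_subset[OF component_subset finite_V] by (simp add: T_def)
  have Q_V: "Q \<subseteq> V" using rep_in by (auto simp: Q_def)
  have pairs_Q: "pairs Q = gen_edges z \<union> (\<Union>C\<in>T. pairs C)"
  proof
    show "pairs Q \<subseteq> gen_edges z \<union> (\<Union>C\<in>T. pairs C)"
    proof
      fix e assume "e \<in> pairs Q"
      then obtain x y where e: "e = {x, y}" "x \<noteq> y" "x \<in> Q" "y \<in> Q"
        unfolding pairs_def card_2_iff by auto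
      show "e \<in> gen_edges z \<union> (\<Union>C\<in>T. pairs C)"
      proof (cases "conn x y")
        case False
        then show ?thesis using e unfolding gen_edges_def Q_def by blast
      next
        case True
        have r: "rep x = x" "rep y = y" using e rep_rep by (auto simp: Q_def)
        then have "\<not> nontriv (comp_of x)" using rep_eq[OF True] e(2) by auto
        moreover have "comp_of x \<in> components" using e(3) Q_V by (auto simp: components_def)
        moreover have "e \<subseteq> comp_of x" using e True conn_refl Q_V by auto
        ultimately show ?thesis using e by (auto simp: T_def pairs_def)
      qed
    qed
    have "gen_edges z \<subseteq> pairs Q"
    proof
      fix e assume "e \<in> gen_edges z"
      then obtain x y where e: "e = {x, y}" "x \<in> Q" "y \<in> Q" "\<not> conn x y"
        unfolding gen_edges_def Q_def by blast
      then have "x \<noteq> y" using conn_refl Q_V by blast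
      then show "e \<in> pairs Q" using e by (simp add: pairs_def)
    qed
    moreover have "C \<subseteq> Q" if C: "C \<in> T" for C
    proof
      fix u assume u: "u \<in> C"
      have C': "C = comp_of u" "C \<in> components" "\<not> nontriv C" using C u component_eq by (auto simp: T_def)
      then have "rep u = u" using rep_trivial by simp
      moreover have "u \<noteq> rep z" using C' z rep_conn[OF z(1)] comp_of_eq by metis
      moreover have "u \<in> V" using u component_subset[OF C'(2)] by blast
      ultimately show "u \<in> Q" unfolding Q_def by (metis Diff_iff imageI singletonD)
    qed
    ultimately show "gen_edges z \<union> (\<Union>C\<in>T. pairs C) \<subseteq> pairs Q" unfolding pairs_def by blast
  qed
  have card_pairs: "card (pairs A) = card A choose 2" if "finite A" for A
    unfolding pairs_def by (rule n_subsets[OF that])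
  have fin_pairs: "finite (pairs A)" if "finite A" for A
    using that by (simp add: pairs_def)
  have disj: "gen_edges z \<inter> (\<Union>C\<in>T. pairs C) = {}"
  proof -
    have False if eC: "e \<in> gen_edges z" "e \<subseteq> C" "C \<in> T" for e C
    proof -
      obtain x y where "e = {x, y}" "\<not> conn x y" using eC(1) unfolding gen_edges_def by blast
      then show False using component_eq[of C x] eC(2,3) by (auto simp: T_def)
    qed
    then show ?thesis unfolding pairs_def by blast
  qed
  have "card (\<Union>C\<in>T. pairs C) = (\<Sum>C\<in>T. card (pairs C))"
  proof (rule card_UN_disjoint[OF finT])
    show "\<forall>C\<in>T. finite (pairs C)" using fin_pairs finC by blast
    show "\<forall>C\<in>T. \<forall>D\<in>T. C \<noteq> D \<longrightarrow> pairs C \<inter> pairs D = {}"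
    proof (intro ballI impI equals0I)
      fix C D e assume CD: "C \<in> T" "D \<in> T" "C \<noteq> D" "e \<in> pairs C \<inter> pairs D"
      then obtain x where "x \<in> C" "x \<in> D" unfolding pairs_def card_2_iff by blast
      then show False using CD(1-3) component_unique[of C D x] by (simp add: T_def)
    qed
  qed
  then have "card (pairs Q) = card (gen_edges z) + (\<Sum>C\<in>T. card C choose 2)"
    unfolding pairs_Q using disj finite_gen_edges fin_pairs finC finT card_pairs
    by (simp add: card_Un_disjoint)
  moreover have "card Q = card (rep ` V) - 1"
    using z(1) finite_V by (simp add: Q_def)
  moreover have "finite Q" using finite_V by (simp add: Q_def)
  ultimately show ?thesis using card_pairs[of Q] card_rep by (simp add: T_def)
qed

end

section \<open>The fundamental group of a TBRSC\<close>

text \<open>Turns parallel classes into sets of vertices lying in the same members of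
  \<open>eps V H\<close>. An edge is separated by its transversal chain; conversely, a member of
  \<open>eps V H\<close> lets a singleton inside extend by a vertex outside.\<close>

lemma TBRSC_edge_iff:
  assumes T: "TBRSC V H" and dim: "complex_dim H \<ge> 2" and pq: "p \<in> V" "q \<in> V" "p \<noteq> q"
  shows "{p, q} \<in> H \<longleftrightarrow> (\<exists>F\<in>eps V H. (p \<in> F) \<noteq> (q \<in> F))"
proof
  assume "{p, q} \<in> H"
  then have "{p, q} \<in> transversals V (eps V H)"
    using TBRSC_subset_H_eps[OF T] by (auto simp: H_eps_def)
  from transversal_split[OF this subset_refl] obtain a F where
    "a \<in> {p, q}" "F \<in> eps V H" "{p, q} - {a} \<subseteq> F" "a \<notin> F" by blast
  then show "\<exists>F\<in>eps V H. (p \<in> F) \<noteq> (q \<in> F)" using pq(3) by blast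
next
  note complex = TBRSC_complex[OF T]
  have *: "{x, y} \<in> H" if "F \<in> eps V H" "x \<in> F" "y \<in> V" "y \<notin> F" for F x y
  proof -
    have "x \<in> V" using that by (auto simp: eps_def)
    then have "{x} \<in> H" using complex by (simp add: abstract_simplicial_complex_def)
    then have "{x} \<in> H \<inter> subsets_upto (complex_dim H) F" using that(2) dim by (simp add: subsets_upto_def)
    then have "{x} \<union> {y} \<in> H" using that unfolding eps_def by blast
    then show ?thesis by (simp add: insert_commute)
  qed
  assume "\<exists>F\<in>eps V H. (p \<in> F) \<noteq> (q \<in> F)"
  then obtain F where F: "F \<in> eps V H" "(p \<in> F) \<noteq> (q \<in> F)" by blast
  then show "{p, q} \<in> H" using *[of F p q] *[of F q p] pq by (auto simp: insert_commute)
qed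

lemma flat_complex_TBRSC:
  assumes T: "TBRSC V H" and dim: "complex_dim H \<ge> 2"
  shows "flat_complex V H (flats V (H_eps V H))"
proof
  note complex = TBRSC_complex[OF T] and sub = TBRSC_subset_H_eps[OF T]
  show "abstract_simplicial_complex V H" by (rule complex)
  show "F \<subseteq> V" if "F \<in> flats V (H_eps V H)" for F using that by (simp add: flats_def)
  show "\<exists>a\<in>A. \<exists>F\<in>flats V (H_eps V H). A - {a} \<subseteq> F \<and> a \<notin> F" if A: "A \<in> H" "A \<noteq> {}" for A
  proof -
    have "A \<in> transversals V (eps V H)" using sub A(1) by (auto simp: H_eps_def)
    from transversal_split[OF this subset_refl A(2)] show ?thesis using eps_subset_flats[of V H] by blast
  qed
  show "insert p A \<in> H" if A: "F \<in> flats V (H_eps V H)" "A \<in> H" "A \<subseteq> F" "card A \<le> 2" "p \<in> V - F" for F A p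
  proof (rule H_eps_small_face[OF complex])
    have "A \<union> {p} \<in> H_eps V H" using A sub unfolding flats_def by blast
    then show "insert p A \<in> H_eps V H" by simp
    \<comment> \<open>The dimension enters here: a set of size three is still small enough for
      \<open>H\<close> and \<open>H_eps V H\<close> to agree on it.\<close>
    show "card (insert p A) \<le> complex_dim H + 1"
      using card_insert_le_m1[of 3 A p] A(4) dim by linarith
  qed
  show "\<exists>u v w. u \<noteq> v \<and> u \<noteq> w \<and> v \<noteq> w \<and> {u, v, w} \<in> H"
  proof -
    obtain A where A: "A \<in> H" "card A = complex_dim H + 1" using ex_face_card[OF complex] by blast
    then obtain B where B: "B \<subseteq> A" "card B = 3"
      using obtain_subset_with_card_n[of 3 A] dim by auto
    then have "B \<in> H" using A(1) complex unfolding abstract_simplicial_complex_def by blast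
    then show ?thesis using B(2) unfolding card_3_iff by blast
  qed
  show "{q \<in> V. q = p \<or> {p, q} \<notin> H} \<in> flats V (H_eps V H)" if p: "p \<in> V" for p
  proof -
    note iff = TBRSC_edge_iff[OF T dim]
    have X: "{q \<in> V. q = p \<or> {p, q} \<notin> H} = {q \<in> V. \<forall>F\<in>eps V H. p \<in> F \<longleftrightarrow> q \<in> F}" (is "_ = ?X")
      using iff[OF p] by blast
    \<comment> \<open>Two elements of a transversal would be separated by a member of
      \<open>eps V H\<close>, so \<open>I\<close> has at most one element and adjoining
      \<open>q\<close> yields a vertex or an edge.\<close>
    have "I \<union> {q} \<in> H_eps V H" if I: "I \<in> H_eps V H" "I \<subseteq> ?X" and q: "q \<in> V - ?X" for I q
    proof -
      have "i = j" if ij: "i \<in> I" "j \<in> I" for i j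
      proof (rule ccontr)
        assume "i \<noteq> j"
        have "I \<in> transversals V (eps V H)" "{i, j} \<subseteq> I" "{i, j} \<noteq> {}"
          using I(1) ij by (auto simp: H_eps_def)
        from transversal_split[OF this] obtain a F where
          "a \<in> {i, j}" "F \<in> eps V H" "{i, j} - {a} \<subseteq> F" "a \<notin> F" by blast
        moreover have "i \<in> F \<longleftrightarrow> j \<in> F" using \<open>F \<in> eps V H\<close> ij I(2) by blast
        ultimately show False using \<open>i \<noteq> j\<close> by blast
      qed
      then consider "I = {}" | i where "I = {i}" by blast
      then have "I \<union> {q} \<in> H"
      proof cases
        case 1
        then show ?thesis using q complex by (simp add: abstract_simplicial_complex_def)
      next
        case (2 i)
        have i: "i \<in> V" "i \<noteq> q" "\<And>F. F \<in> eps V H \<Longrightarrow> p \<in> F \<longleftrightarrow> i \<in> F" using I(2) q 2 by auto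
        obtain F where "F \<in> eps V H" "(p \<in> F) \<noteq> (q \<in> F)" using q by blast
        then have "{i, q} \<in> H" using iff[of i q] i q by blast
        then show ?thesis using 2 by (simp add: insert_commute)
      qed
      then show ?thesis using sub by blast
    qed
    then show ?thesis unfolding X flats_def by blast
  qed
qed

section \<open>Equality of the two rank formulas\<close>

lemma gbinomial_2: "(x :: real) gchoose 2 = x * (x - 1) / 2"
  by (simp add: gbinomial_Suc numeral_2_eq_2 atLeast0_atMost_Suc)

text \<open>Applied with \<open>x = s - 1\<close>. A further component of size \<open>t\<close>
  increases both sides by \<open>(x + S) * t\<close>, where \<open>S\<close> is the sum of the
  previous sizes.\<close>

lemma sum_pairs_identity:
  fixes x :: real and f :: "nat \<Rightarrow> nat"
  shows "((x + (\<Sum>i=1..r. real (f i))) gchoose 2) - (\<Sum>i=1..r. real (f i choose 2)) =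
    (x gchoose 2) + x * (\<Sum>i=1..r. real (f i)) + (\<Sum>j=1..r. \<Sum>i\<in>{1..<j}. real (f i) * real (f j))"
proof (induction r)
  case (Suc r)
  define S where "S = (\<Sum>i=1..r. real (f i))"
  define B where "B = (\<Sum>i=1..r. real (f i choose 2))"
  define U where "U = (\<Sum>j=1..r. \<Sum>i\<in>{1..<j}. real (f i) * real (f j))"
  define t where "t = real (f (Suc r))"
  have "(\<Sum>i\<in>{1..<Suc r}. real (f i) * t) = S * t"
    by (simp add: S_def sum_distrib_right atLeastLessThanSuc_atLeastAtMost)
  then have Suc_eqs: "(\<Sum>i=1..Suc r. real (f i)) = S + t"
    "(\<Sum>j=1..Suc r. \<Sum>i\<in>{1..<j}. real (f i) * real (f j)) = U + S * t"
    by (simp_all add: S_def U_def t_def)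
  have choose: "(\<Sum>i=1..Suc r. real (f i choose 2)) = B + t * (t - 1) / 2"
    using gbinomial_2[of t] by (simp add: B_def t_def binomial_gbinomial)
  show ?case
    unfolding Suc_eqs choose
    using Suc.IH unfolding S_def[symmetric] B_def[symmetric] U_def[symmetric] gbinomial_2
    by (simp add: field_simps)
qed simp

theorem theorem8p2:
  fixes V :: "'a set" and H :: "'a set set"
    and s r :: nat and f :: "nat \<Rightarrow> nat" and D :: "nat \<Rightarrow> 'a set"
    and a :: "'a \<Rightarrow> real"
  assumes "TBRSC V H"
    and "complex_dim H \<ge> 2"
    and "s = card (nontrivial_components V (H_eps V H))"
    and "bij_betw D {1..r} (trivial_components V (H_eps V H))"
    and "\<And>i. i \<in> {1..r} \<Longrightarrow> f i = card (D i)"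
    and "a \<in> geometric_realization V H"
  shows "\<exists>n. free_of_rank (fundamental_group (geometric_realization V H) a) n \<and>
     real n = ((real s + (\<Sum>i=1..r. real (f i)) - 1) gchoose 2) - (\<Sum>i=1..r. real (f i choose 2)) \<and>
     real n = ((real s - 1) gchoose 2) + (real s - 1) * (\<Sum>i=1..r. real (f i))
              + (\<Sum>j=1..r. \<Sum>i\<in>{1..<j}. real (f i) * real (f j))"
proof -
  define J where "J = H_eps V H"
  interpret flat_complex V H "flats V J"
    unfolding J_def by (rule flat_complex_TBRSC[OF assms(1,2)])
  have closure: "flat_closure V J {p, q} \<subset> V \<longleftrightarrow> (\<exists>F\<in>flats V J. F \<noteq> V \<and> p \<in> F \<and> q \<in> F)" for p q
  proof
    assume "flat_closure V J {p, q} \<subset> V"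
    then obtain v where "v \<in> V" "v \<notin> \<Inter>{F \<in> flats V J. {p, q} \<subseteq> F}"
      unfolding flat_closure_def by blast
    then show "\<exists>F\<in>flats V J. F \<noteq> V \<and> p \<in> F \<and> q \<in> F" by blast
  next
    assume "\<exists>F\<in>flats V J. F \<noteq> V \<and> p \<in> F \<and> q \<in> F"
    then obtain F where F: "F \<in> flats V J" "F \<noteq> V" "p \<in> F" "q \<in> F" by blast
    then have "flat_closure V J {p, q} \<subseteq> F" by (auto simp: flat_closure_def)
    then show "flat_closure V J {p, q} \<subset> V" using L_subset[OF F(1)] F(2) by blast
  qed
  have "(p \<in> V \<and> q \<in> V \<and> p \<noteq> q \<and> flat_closure V J {p, q} \<subset> V) \<longleftrightarrow> adj p q" for p q
    using adj_in_V[of p q] closure[of p q] by (simp only: adj_def) argo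
  then have graph: "flat_graph V J = {(p, q). adj p q}"
    by (simp add: flat_graph_def)
  have comps: "graph_components V (flat_graph V J) = components"
    unfolding graph_components_def quotient_def components_def graph conn_def by auto
  have face_iff: "A \<in> J \<longleftrightarrow> A \<in> H" if "card A = 2" for A
    using that TBRSC_subset_H_eps[OF assms(1)] H_eps_small_face[OF complex, of A] assms(2)
    by (auto simp: J_def)
  have triv_iff: "nontrivial_wrt J C \<longleftrightarrow> nontriv C" for C
  proof
    assume "nontrivial_wrt J C"
    then obtain A where A: "A \<in> J" "A \<subseteq> C" "card A = 2"
      by (auto simp: nontrivial_wrt_def subsets_exactly_def)
    then show "nontriv C" using face_iff unfolding nontriv_def card_2_iff by blast
  next
    assume "nontriv C"
    then obtain p q where pq: "p \<in> C" "q \<in> C" "p \<noteq> q" "{p, q} \<in> H" by (auto simp: nontriv_def)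
    then have "{p, q} \<in> J \<inter> subsets_exactly 2 C" using face_iff by (auto simp: subsets_exactly_def)
    then show "nontrivial_wrt J C" by (auto simp: nontrivial_wrt_def)
  qed
  let ?N = "{C \<in> components. nontriv C}" and ?T = "{C \<in> components. \<not> nontriv C}"
  have N: "s = card ?N" and T: "bij_betw D {1..r} ?T"
    using assms(3,4) unfolding nontrivial_components_def trivial_components_def J_def[symmetric] comps triv_iff
    by auto
  obtain v0 where v0: "a v0 \<noteq> 0" using realization_ex_nonzero[OF assms(6)] by blast
  obtain z' where z': "z' \<in> V" "nontriv (comp_of z')" using ex_nontriv by blast
  obtain p q where pq: "conn z' p" "conn z' q" "p \<noteq> q" "{p, q} \<in> H"
    using z'(2) by (auto simp: nontriv_def)
  \<comment> \<open>The base point dictates \<open>v0\<close>, so the root must avoid its parallel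
    class; an edge inside a nontrivial component has an end that does.\<close>
  have "\<not> (par p v0 \<and> par q v0)" using edge_not_par[OF pq(4,3)] par_sym par_trans by blast
  then obtain z where z: "conn z' z" "\<not> par z v0" using pq by blast
  then have z_V: "z \<in> V" "nontriv (comp_of z)" using z'(2) comp_of_eq by (auto simp: conn_def)
  interpret based_flat_complex V H "flats V J" a v0 z
    using assms(6) v0 z(2) z_V by unfold_locales
  let ?n = "card (gen_edges z)"
  have sum_card: "(\<Sum>C\<in>?T. card C) = (\<Sum>i=1..r. f i)"
    and sum_choose: "(\<Sum>C\<in>?T. card C choose 2) = (\<Sum>i=1..r. f i choose 2)"
    using sum.reindex_bij_betw[OF T, of card] sum.reindex_bij_betw[OF T, of "\<lambda>C. card C choose 2"] assms(5)
    by simp_all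
  \<comment> \<open>A nontrivial component exists, so subtracting one in the natural numbers agrees
    with the subtraction in the reals.\<close>
  have "comp_of z \<in> ?N" using z_V by (auto simp: components_def)
  moreover have "finite ?N" using finite_components by simp
  ultimately have "s > 0" unfolding N by (simp only: card_gt_0_iff) blast
  then have "real (s + (\<Sum>i=1..r. f i) - 1) = (real s - 1) + (\<Sum>i=1..r. real (f i))"
    by (simp add: of_nat_diff)
  moreover have "real ?n + (\<Sum>i=1..r. real (f i choose 2)) = real ((s + (\<Sum>i=1..r. f i) - 1) choose 2)"
    using card_gen_edges[OF z_V] 
    unfolding N[symmetric] sum_card sum_choose by (simp flip: of_nat_sum of_nat_add)
  ultimately have n: "real ?n = (((real s - 1) + (\<Sum>i=1..r. real (f i))) gchoose 2) - (\<Sum>i=1..r. real (f i choose 2))"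
    by (simp add: binomial_gbinomial)
  have "free_of_rank P ?n" unfolding free_of_rank_def by (rule fundamental_group_free)
  moreover have "real ?n = ((real s + (\<Sum>i=1..r. real (f i)) - 1) gchoose 2) - (\<Sum>i=1..r. real (f i choose 2))"
    unfolding n by (simp add: algebra_simps)
  moreover have "real ?n = ((real s - 1) gchoose 2) + (real s - 1) * (\<Sum>i=1..r. real (f i))
              + (\<Sum>j=1..r. \<Sum>i\<in>{1..<j}. real (f i) * real (f j))"
    unfolding n by (rule sum_pairs_identity)
  ultimately show ?thesis by blast
qed

end
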